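(* (i) Let $S\in\mathcal G$ be a geometric action, and let $K\subset\tilde D$ be a compact set consisting only of points that have weak local minimizers. Let the two sets $A_1,A_2\subset\tilde D$ be closed in $D$, and assume that the minimization problem $P(A_1,A_2)$ has a minimizing sequence $(\gamma_n)_{n\in\mathbb N}$ such that $\gamma_n\subset K$ for all $n\in\mathbb N$. Then $P(A_1,A_2)$ has a weak minimizer. (ii) If, in addition to the conditions of (i), all points in $K$ have strong local minimizers, then $P(A_1,A_2)$ has a strong minimizer.
   Context: $D\subseteq\mathbb R^n$ is open and connected; $\tilde D\subseteq D$ is connected and closed in $D$. $\bar B_r(x)$ is the closed Euclidean ball. Curves. An unparameterized oriented curve in $D$ is an equivalence class of functions $\varphi\in C([0,T],D)$, $T>0$, that are identical up to continuous non-decreasing changes of parameterization (their Fréchet distance vanishes); the representatives are its parameterizations. $\gamma\subset G$ means that the image of $\gamma$ lies in $G$. $\Gamma$ is the set of rectifiable curves. $\tilde C(0,1)$ is the set of $\varphi\in C([0,1],D)$ that are absolutely continuous in neighborhoods of all but at most finitely many $\alpha_i\in[0,1]$, and $\tilde\Gamma\supset\Gamma$ is the set of curves that can be parameterized by some $\varphi\in\tilde C(0,1)$. For $x\in D$, $\tilde\Gamma(x)\subset\tilde\Gamma$ is the set of curves that can be parameterized by some $\varphi\in C([0,1],D)$ which is either absolutely continuous on $[0,1]$, or satisfies $\varphi(\frac12)=x$ and is absolutely continuous on $[0,\frac12-a]$ and on $[\frac12+a,1]$ for all $a\in(0,\frac12)$. For $A_1,A_2\subset\tilde D$, $\Gamma_{A_1}^{A_2}$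 (resp. $\tilde\Gamma_{A_1}^{A_2}$) is the set of $\gamma\in\Gamma$ (resp. $\tilde\Gamma$) with $\gamma\subset\tilde D$ that start in $A_1$ and end in $A_2$; $\Gamma_{x_1}^{x_2}$ and $\tilde\Gamma_{x_1}^{x_2}(x)$ (curves in $\tilde\Gamma(x)$ contained in $\tilde D$, from $x_1$ to $x_2$) are defined analogously. For Borel $E$ and $\gamma\in\tilde\Gamma$ with parameterization $\varphi\in\tilde C(0,1)$, $\operatorname{length}(\gamma|_E):=\int_0^1|\varphi'|\mathbf 1_{\varphi\in E}\,d\alpha$. Standing assumption on $\tilde D$: $\forall x\in\tilde D\ \forall\nu>0\ \exists r>0\ \forall w\in\bar B_r(x)\cap\tilde D\ \exists\gamma\in\Gamma_x^w$ with $\operatorname{length}(\gamma)\le\nu$. Geometric actions. $\mathcal G$ is the set of functionals $S\colon\tilde\Gamma\to[0,\infty]$, $S(\gamma)=\int_0^1\ell(\varphi,\varphi')\,d\alpha$ with $\varphi\in\tilde C(0,1)$ an arbitrary parameterization of $\gamma$, where $\ell\in C(D\times\mathbb R^n,[0,\infty))$ satisfies $\ell(x,cy)=c\,\ell(x,y)$ for all $x,y$ and $c\ge0$, and $\ell(x,\cdot)$ is convex for every $x\in D$. $P(A_1,A_2)$ denotes the problem $\inf_{\gamma\in\Gamma_{A_1}^{A_2}}S(\gamma)$, and $P(x_1,x_2):=P(\{x_1\},\{x_2\})$. A strong (weak) minimizer is $\gamma^\star\in\Gamma_{A_1}^{A_2}$ ($\gamma^\star\in\tilde\Gamma_{A_1}^{A_2}$)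 with $S(\gamma^\star)=\inf_{\gamma\in\Gamma_{A_1}^{A_2}}S(\gamma)$. A minimizing sequence is $(\gamma_n)\subset\Gamma_{A_1}^{A_2}$ with $S(\gamma_n)\to\inf_{\gamma\in\Gamma_{A_1}^{A_2}}S(\gamma)$. Local minimizers. A point $x\in\tilde D$ has strong local minimizers if there exist $r,\eta>0$ and a compact $K_x\subset\tilde D$ such that for all $x_1,x_2\in\bar B_r(x)\cap\tilde D$ the problem $P(x_1,x_2)$ has a strong minimizer $\gamma^\star\in\Gamma_{x_1}^{x_2}$ with $\gamma^\star\subset K_x$ and $\operatorname{length}(\gamma^\star)\le\eta$. It has weak local minimizers if there exist $r>0$, a function $\eta\colon(0,\infty)\to[0,\infty)$ and a compact $K_x\subset\tilde D$ such that for all $x_1,x_2\in\bar B_r(x)\cap\tilde D$ the problem $P(x_1,x_2)$ has a weak minimizer $\gamma^\star\in\tilde\Gamma_{x_1}^{x_2}(x)$ with $\gamma^\star\subset K_x$ and $\operatorname{length}(\gamma^\star|_{\bar B_u(x)^c})\le\eta(u)$ for all $u>0$. *)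

theory Defs
  imports "HOL-Analysis.Analysis"
begin

section \<open>Absolute continuity and bounded variation\<close>

definition abs_continuous_on :: "real set \<Rightarrow> (real \<Rightarrow> 'a::metric_space) \<Rightarrow> bool" where
  "abs_continuous_on I \<phi> \<longleftrightarrow>
    (\<forall>\<epsilon>>0. \<exists>\<delta>>0. \<forall>(n::nat) (a::nat \<Rightarrow> real) b.
      (\<forall>i<n. a i \<le> b i \<and> {a i..b i} \<subseteq> I) \<and>
      (\<forall>i<n. \<forall>j<n. i \<noteq> j \<longrightarrow> {a i<..<b i} \<inter> {a j<..<b j} = {}) \<and>
      (\<Sum>i<n. b i - a i) < \<delta>
      \<longrightarrow> (\<Sum>i<n. dist (\<phi> (a i)) (\<phi> (b i))) < \<epsilon>)"

definition bounded_variation_on :: "real set \<Rightarrow> (real \<Rightarrow> 'a::metric_space) \<Rightarrow> bool" where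
  "bounded_variation_on I \<phi> \<longleftrightarrow>
    (\<exists>M. \<forall>(n::nat) (t::nat \<Rightarrow> real).
      (\<forall>i\<le>n. t i \<in> I) \<and> (\<forall>i<n. t i \<le> t (Suc i))
      \<longrightarrow> (\<Sum>i<n. dist (\<phi> (t i)) (\<phi> (t (Suc i)))) \<le> M)"

section \<open>Unparameterized oriented curves\<close>

text \<open>A pair \<open>(T, \<phi>)\<close> stands for the restriction of \<open>\<phi>\<close> to \<open>{0..T}\<close>; the values of \<open>\<phi>\<close>
  elsewhere are irrelevant, and the equivalence below identifies functions that agree on \<open>{0..T}\<close>.\<close>

type_synonym 'a path_fun = "real \<times> (real \<Rightarrow> 'a)"
type_synonym 'a curve = "'a path_fun set"

definition path_funs :: "'a::metric_space set \<Rightarrow> 'a path_fun set" where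
  "path_funs D = {(T, \<phi>). 0 < T \<and> continuous_on {0..T} \<phi> \<and> \<phi> ` {0..T} \<subseteq> D}"

definition reparams :: "real \<Rightarrow> (real \<Rightarrow> real) set" where
  "reparams T = {\<alpha>. continuous_on {0..1} \<alpha> \<and> mono_on {0..1} \<alpha> \<and> \<alpha> ` {0..1} = {0..T}}"

definition frechet_dist :: "'a::metric_space path_fun \<Rightarrow> 'a path_fun \<Rightarrow> real" where
  "frechet_dist p q =
    (INF (\<alpha>, \<beta>) \<in> reparams (fst p) \<times> reparams (fst q).
      SUP s\<in>{0..1}. dist (snd p (\<alpha> s)) (snd q (\<beta> s)))"

definition frechet_rel :: "'a::metric_space set \<Rightarrow> ('a path_fun \<times> 'a path_fun) set" where
  "frechet_rel D = {(p, q). p \<in> path_funs D \<and> q \<in> path_funs D \<and> frechet_dist p q = 0}"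

definition curves :: "'a::metric_space set \<Rightarrow> 'a curve set" where
  "curves D = path_funs D // frechet_rel D"

definition curve_image :: "'a curve \<Rightarrow> 'a set" where
  "curve_image \<gamma> = (\<Union>(T, \<phi>)\<in>\<gamma>. \<phi> ` {0..T})"

definition starts_in :: "'a curve \<Rightarrow> 'a set \<Rightarrow> bool" where
  "starts_in \<gamma> A \<longleftrightarrow> (\<forall>(T, \<phi>)\<in>\<gamma>. \<phi> 0 \<in> A)"

definition ends_in :: "'a curve \<Rightarrow> 'a set \<Rightarrow> bool" where
  "ends_in \<gamma> A \<longleftrightarrow> (\<forall>(T, \<phi>)\<in>\<gamma>. \<phi> T \<in> A)"

section \<open>The classes \<open>\<Gamma>\<close>, \<open>\<Gamma>~\<close> and \<open>\<Gamma>~(x)\<close>\<close>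

definition rect_curves :: "'a::metric_space set \<Rightarrow> 'a curve set" where
  "rect_curves D = {\<gamma> \<in> curves D. \<exists>(T, \<phi>)\<in>\<gamma>. bounded_variation_on {0..T} \<phi>}"

definition C_tilde :: "'a::metric_space set \<Rightarrow> (real \<Rightarrow> 'a) set" where
  "C_tilde D = {\<phi>. (1, \<phi>) \<in> path_funs D \<and>
    (\<exists>F. finite F \<and> F \<subseteq> {0..1} \<and>
      (\<forall>\<alpha>\<in>{0..1} - F. \<exists>\<epsilon>>0. abs_continuous_on ({0..1} \<inter> {\<alpha> - \<epsilon>..\<alpha> + \<epsilon>}) \<phi>))}"

definition tilde_params :: "'a::metric_space set \<Rightarrow> 'a curve \<Rightarrow> (real \<Rightarrow> 'a) set" where
  "tilde_params D \<gamma> = {\<phi> \<in> C_tilde D. (1, \<phi>) \<in> \<gamma>}"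

definition tilde_curves :: "'a::metric_space set \<Rightarrow> 'a curve set" where
  "tilde_curves D = {\<gamma> \<in> curves D. tilde_params D \<gamma> \<noteq> {}}"

definition tilde_curves_at :: "'a::metric_space set \<Rightarrow> 'a \<Rightarrow> 'a curve set" where
  "tilde_curves_at D x = {\<gamma> \<in> curves D. \<exists>\<phi>. (1, \<phi>) \<in> \<gamma> \<and>
    (abs_continuous_on {0..1} \<phi> \<or>
     \<phi> (1/2) = x \<and>
     (\<forall>a\<in>{0<..<1/2}. abs_continuous_on {0..1/2 - a} \<phi> \<and> abs_continuous_on {1/2 + a..1} \<phi>))}"

text \<open>In what follows \<open>D'\<close> is the set \<open>D~ \<subseteq> D\<close> in which admissible curves must lie.\<close>

definition joining :: "'a set \<Rightarrow> 'a set \<Rightarrow> 'a set \<Rightarrow> 'a curve set" where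
  "joining D' A1 A2 = {\<gamma>. curve_image \<gamma> \<subseteq> D' \<and> starts_in \<gamma> A1 \<and> ends_in \<gamma> A2}"

section \<open>Length and geometric actions\<close>

text \<open>The integral does not depend on the choice of the parameterization in \<open>C_tilde D\<close>.
  Such a parameterization is differentiable almost everywhere, and elsewhere
  \<^const>\<open>vector_derivative\<close> is an unspecified value on a null set.\<close>

definition length_on :: "'a::euclidean_space set \<Rightarrow> 'a set \<Rightarrow> 'a curve \<Rightarrow> ennreal" where
  "length_on D E \<gamma> =
    (let \<phi> = (SOME \<phi>. \<phi> \<in> tilde_params D \<gamma>)
     in \<integral>\<^sup>+\<alpha>\<in>{0..1}. ennreal (norm (vector_derivative \<phi> (at \<alpha>)) * indicator E (\<phi> \<alpha>)) \<partial>lebesgue)"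

definition curve_length :: "'a::euclidean_space set \<Rightarrow> 'a curve \<Rightarrow> ennreal" where
  "curve_length D \<gamma> = length_on D UNIV \<gamma>"

text \<open>Only the values of \<open>S\<close> on \<open>tilde_curves D\<close> are constrained.\<close>

definition geometric_action ::
    "'a::euclidean_space set \<Rightarrow> ('a curve \<Rightarrow> ennreal) \<Rightarrow> bool" where
  "geometric_action D S \<longleftrightarrow>
    (\<exists>l :: 'a \<Rightarrow> 'a \<Rightarrow> real.
      continuous_on (D \<times> UNIV) (\<lambda>(x, y). l x y) \<and>
      (\<forall>x\<in>D. \<forall>y. 0 \<le> l x y) \<and>
      (\<forall>x\<in>D. \<forall>y. \<forall>c\<ge>0. l x (c *\<^sub>R y) = c * l x y) \<and>
      (\<forall>x\<in>D. convex_on UNIV (l x)) \<and>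
      (\<forall>\<gamma>\<in>tilde_curves D. \<forall>\<phi>\<in>tilde_params D \<gamma>.
        S \<gamma> = (\<integral>\<^sup>+\<alpha>\<in>{0..1}. ennreal (l (\<phi> \<alpha>) (vector_derivative \<phi> (at \<alpha>))) \<partial>lebesgue)))"

section \<open>The minimization problem \<open>P(A1, A2)\<close>\<close>

definition min_value ::
    "'a::euclidean_space set \<Rightarrow> 'a set \<Rightarrow> ('a curve \<Rightarrow> ennreal) \<Rightarrow> 'a set \<Rightarrow> 'a set \<Rightarrow> ennreal" where
  "min_value D D' S A1 A2 = (INF \<gamma>\<in>rect_curves D \<inter> joining D' A1 A2. S \<gamma>)"

definition strong_minimizer ::
    "'a::euclidean_space set \<Rightarrow> 'a set \<Rightarrow> ('a curve \<Rightarrow> ennreal) \<Rightarrow> 'a set \<Rightarrow> 'a set \<Rightarrow> 'a curve \<Rightarrow> bool" where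
  "strong_minimizer D D' S A1 A2 \<gamma> \<longleftrightarrow>
    \<gamma> \<in> rect_curves D \<inter> joining D' A1 A2 \<and> S \<gamma> = min_value D D' S A1 A2"

text \<open>The infimum is still taken over rectifiable curves.\<close>

definition weak_minimizer ::
    "'a::euclidean_space set \<Rightarrow> 'a set \<Rightarrow> ('a curve \<Rightarrow> ennreal) \<Rightarrow> 'a set \<Rightarrow> 'a set \<Rightarrow> 'a curve \<Rightarrow> bool" where
  "weak_minimizer D D' S A1 A2 \<gamma> \<longleftrightarrow>
    \<gamma> \<in> tilde_curves D \<inter> joining D' A1 A2 \<and> S \<gamma> = min_value D D' S A1 A2"

definition minimizing_sequence ::
    "'a::euclidean_space set \<Rightarrow> 'a set \<Rightarrow> ('a curve \<Rightarrow> ennreal) \<Rightarrow> 'a set \<Rightarrow> 'a set \<Rightarrow>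
      (nat \<Rightarrow> 'a curve) \<Rightarrow> bool" where
  "minimizing_sequence D D' S A1 A2 g \<longleftrightarrow>
    (\<forall>n. g n \<in> rect_curves D \<inter> joining D' A1 A2) \<and>
    (\<lambda>n. S (g n)) \<longlonglongrightarrow> min_value D D' S A1 A2"

section \<open>Local minimizers\<close>

definition has_strong_local_minimizers ::
    "'a::euclidean_space set \<Rightarrow> 'a set \<Rightarrow> ('a curve \<Rightarrow> ennreal) \<Rightarrow> 'a \<Rightarrow> bool" where
  "has_strong_local_minimizers D D' S x \<longleftrightarrow>
    (\<exists>(r::real) (\<eta>::real) Kx. 0 < r \<and> 0 < \<eta> \<and> compact Kx \<and> Kx \<subseteq> D' \<and>
      (\<forall>x1 \<in> cball x r \<inter> D'. \<forall>x2 \<in> cball x r \<inter> D'.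
        \<exists>\<gamma>. strong_minimizer D D' S {x1} {x2} \<gamma> \<and>
             curve_image \<gamma> \<subseteq> Kx \<and> curve_length D \<gamma> \<le> ennreal \<eta>))"

definition has_weak_local_minimizers ::
    "'a::euclidean_space set \<Rightarrow> 'a set \<Rightarrow> ('a curve \<Rightarrow> ennreal) \<Rightarrow> 'a \<Rightarrow> bool" where
  "has_weak_local_minimizers D D' S x \<longleftrightarrow>
    (\<exists>(r::real) (\<eta>::real \<Rightarrow> real) Kx. 0 < r \<and> (\<forall>u>0. 0 \<le> \<eta> u) \<and> compact Kx \<and> Kx \<subseteq> D' \<and>
      (\<forall>x1 \<in> cball x r \<inter> D'. \<forall>x2 \<in> cball x r \<inter> D'.
        \<exists>\<gamma> \<in> tilde_curves_at D x. weak_minimizer D D' S {x1} {x2} \<gamma> \<and>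
             curve_image \<gamma> \<subseteq> Kx \<and>
             (\<forall>u>0. length_on D (- cball x u) \<gamma> \<le> ennreal (\<eta> u))))"

end

theory Submission
  imports Defs
begin

text \<open>The existence of minimizers follows from a compactness argument for finite chains of points.
  Write \<open>V x y\<close> for the infimum of the action over rectifiable curves from \<open>x\<close> to \<open>y\<close> in \<open>D'\<close>.
  It satisfies the triangle inequality, because paths can be concatenated, and \<open>V x w\<close> and \<open>V w x\<close>
  tend to 0 as \<open>w\<close> tends to \<open>x\<close>: a short curve from \<open>x\<close> to \<open>w\<close> stays near \<open>x\<close>, where the action is
  at most a constant times the length, and the length is unchanged when the curve is reversed.
  Hence \<open>V\<close> is lower semicontinuous (\<open>value_lower_semicontinuous\<close>).

  Cover \<open>K\<close> by \<open>k\<close> balls around points with local minimizers. A rectifiable path in \<open>K\<close> is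
  followed from its start to its last visit of a ball that contains the start. Afterwards it never
  returns to that ball, so iterating gives a chain \<open>p 0, ..., p k\<close> of points of \<open>K\<close> on the path,
  consecutive ones in a common ball, with
  \<open>(\<Sum>j<k. V (p j) (p (Suc j)))\<close> at most the action of the path (\<open>path_chain\<close>). The number \<open>k\<close>
  does not depend on the path. The chains of a minimizing sequence therefore have a convergent
  subsequence, and by semicontinuity the limiting chain satisfies
  \<open>(\<Sum>j<k. V (p j) (p (Suc j))) \<le> min_value D D' S A1 A2\<close>. Joining local minimizers along
  the limiting chain gives a curve from \<open>A1\<close> to \<open>A2\<close> whose action equals this sum, and the sum is
  also at least the infimum, by the triangle inequality. The joined curve is a minimizer, rectifiable
  if all the local minimizers are.

  Most of the text supplies the real analysis behind this. The action is an integral of derivatives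
  of parameterizations, so its additivity and its behaviour under affine changes of parameter need
  differentiability almost everywhere: Lipschitz functions of one variable are treated with the
  Vitali covering theorem (\<open>lipschitz_differentiable_ae\<close>), and continuous functions of bounded
  variation by factoring them through their variation (\<open>bv_lipschitz_factorization\<close>,
  \<open>bv_differentiable_ae\<close>). The same factorization gives every rectifiable curve a Lipschitz
  parameterization (\<open>rect_curve_lipschitz_param\<close>). That short curves stay near their starting point is the
  inequality between distance and length for absolutely continuous functions
  (\<open>abs_continuous_on_has_integral\<close>, \<open>C_tilde_dist_le_length\<close>).\<close>

section \<open>Differentiability of Lipschitz functions of one variable\<close>

text \<open>The points around which \<open>h\<close> has chords of slope less than \<open>p\<close> (respectively greater
  than \<open>p\<close>) over arbitrarily short intervals. The point is required to be interior to the interval,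
  which makes both sets countable intersections of open sets.\<close>

definition slope_below :: "(real \<Rightarrow> real) \<Rightarrow> real \<Rightarrow> real set" where
  "slope_below h p = {x. \<forall>d>0. \<exists>u v. u < x \<and> x < v \<and> v - u < d \<and> h v - h u < p * (v - u)}"

definition slope_above :: "(real \<Rightarrow> real) \<Rightarrow> real \<Rightarrow> real set" where
  "slope_above h p = {x. \<forall>d>0. \<exists>u v. u < x \<and> x < v \<and> v - u < d \<and> h v - h u > p * (v - u)}"

lemma slope_belowE:
  assumes "x \<in> slope_below h p" "d > 0"
  obtains u v where "u < x" "x < v" "v - u < d" "h v - h u < p * (v - u)"
  using assms unfolding slope_below_def by blast

lemma slope_aboveE:
  assumes "x \<in> slope_above h p" "d > 0"
  obtains u v where "u < x" "x < v" "v - u < d" "h v - h u > p * (v - u)"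
  using assms unfolding slope_above_def by blast

lemma slope_below_mono:
  assumes "p \<le> q"
  shows "slope_below h p \<subseteq> slope_below h q"
proof
  fix x assume x: "x \<in> slope_below h p"
  have "\<exists>u v. u < x \<and> x < v \<and> v - u < d \<and> h v - h u < q * (v - u)" if d: "d > 0" for d
  proof -
    obtain u v where uv: "u < x" "x < v" "v - u < d" "h v - h u < p * (v - u)"
      using x d by (rule slope_belowE)
    have "p * (v - u) \<le> q * (v - u)" using assms uv by (intro mult_right_mono) auto
    then have "h v - h u < q * (v - u)" using uv(4) by linarith
    with uv show ?thesis by blast
  qed
  then show "x \<in> slope_below h q" unfolding slope_below_def by blast
qed

lemma slope_above_eq: "slope_above h p = slope_below (\<lambda>x. - h x) (- p)"
proof -
  have "p * (v - u) < h v - h u \<longleftrightarrow> - h v - - h u < - p * (v - u)" for u v by auto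
  then show ?thesis unfolding slope_above_def slope_below_def by simp
qed

lemma slope_above_antimono: "p \<le> q \<Longrightarrow> slope_above h q \<subseteq> slope_above h p"
  unfolding slope_above_eq by (rule slope_below_mono) simp

lemma borel_small_intervals:
  "{x. \<forall>d>0. \<exists>u v. u < x \<and> x < v \<and> v - u < d \<and> P u v} \<in> sets (borel :: real measure)"
    (is "?A \<in> _")
proof -
  let ?U = "\<lambda>n. \<Union>(u,v)\<in>{(u,v). v - u < inverse (real (Suc n)) \<and> P u v}. {u<..<v::real}"
  have "?A = (\<Inter>n. ?U n)"
  proof (intro set_eqI iffI)
    fix x assume "x \<in> ?A"
    then have *: "\<exists>u v. u < x \<and> x < v \<and> v - u < d \<and> P u v" if "d > 0" for d using that by blast
    show "x \<in> (\<Inter>n. ?U n)"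
    proof
      fix n
      from *[of "inverse (real (Suc n))"] obtain u v
        where "u < x" "x < v" "v - u < inverse (real (Suc n))" "P u v" by auto
      then show "x \<in> ?U n" by (intro UN_I[of "(u,v)"]) auto
    qed
  next
    fix x assume x: "x \<in> (\<Inter>n. ?U n)"
    have "\<exists>u v. u < x \<and> x < v \<and> v - u < d \<and> P u v" if "d > 0" for d :: real
    proof -
      obtain n where n: "inverse (real (Suc n)) < d" using reals_Archimedean[OF \<open>d > 0\<close>] by auto
      have "x \<in> ?U n" using x by blast
      then obtain u v where "v - u < inverse (real (Suc n))" "P u v" "u < x" "x < v" by auto
      with n have "u < x \<and> x < v \<and> v - u < d \<and> P u v" by linarith
      then show ?thesis by blast
    qed
    then show "x \<in> ?A" by blast
  qed
  moreover have "open (?U n)" for n by (intro open_UN) auto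
  ultimately show ?thesis by (auto intro!: sets.countable_INT)
qed

lemma slope_below_borel [measurable]: "slope_below h p \<in> sets borel"
  unfolding slope_below_def by (rule borel_small_intervals)

lemma slope_above_borel [measurable]: "slope_above h p \<in> sets borel"
  unfolding slope_above_def by (rule borel_small_intervals)

text \<open>A homeomorphism stretches a set of points with small slopes at most by that slope: the Vitali
  covering theorem exhausts the set, up to a null set, by disjoint intervals of small slope, and
  the Lipschitz function \<open>h\<close> maps the remaining null set to a null set.\<close>

lemma emeasure_image_slope_below:
  fixes h k :: "real \<Rightarrow> real"
  assumes kh: "\<And>x. k (h x) = x" and hk: "\<And>y. h (k y) = y"
    and mono: "mono h" and cont: "continuous_on UNIV k" and lip: "L-lipschitz_on UNIV h"
    and E: "E \<in> sets borel" "E \<subseteq> slope_below h p" and p: "0 \<le> p"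
  shows "emeasure lborel (h ` E) \<le> ennreal p * emeasure lborel E"
proof (cases "emeasure lborel E = \<infinity> \<and> p > 0")
  case True
  then show ?thesis by (simp add: ennreal_mult_top)
next
  case False
  have img: "h ` X = k -` X" for X using kh hk by (auto simp: image_iff) metis
  have borel_img: "h ` X \<in> sets borel" if "X \<in> sets borel" for X
    using measurable_sets[OF borel_measurable_continuous_onI[OF cont] that] by (simp add: img)
  have main: "emeasure lborel (h ` E) \<le> ennreal p * emeasure lborel E + ennreal p * ennreal e" if "e > 0" for e
  proof -
    have "E \<in> sets lebesgue" using E by simp
    then obtain T where T: "open T" "E \<subseteq> T" "T - E \<in> lmeasurable" "emeasure lebesgue (T - E) < ennreal e"
      by (rule sets_lebesgue_outer_open[OF _ \<open>e > 0\<close>])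
    define K where "K = {(a,r). 0 < r \<and> ball a r \<subseteq> T \<and> h (a + r) - h (a - r) \<le> p * (2 * r)}"
    have "\<exists>i. i \<in> K \<and> x \<in> ball (fst i) (snd i) \<and> snd i < d" if xE: "x \<in> E" and d: "0 < d" for x d
    proof -
      obtain e where e: "e > 0" "ball x e \<subseteq> T" using openE[OF T(1), of x] T(2) xE by blast
      have "x \<in> slope_below h p" using E xE by auto
      then obtain u v where uv: "u < x" "x < v" "v - u < min d e" "h v - h u < p * (v - u)"
        using e d slope_belowE[of x h p "min d e"] by (metis min_less_iff_conj)
      define a r where "a = (u + v) / 2" and "r = (v - u) / 2"
      have ar: "a + r = v" "a - r = u" "2 * r = v - u" by (simp_all add: a_def r_def field_simps)
      have b: "ball a r = {u<..<v}" by (simp add: ball_eq_greaterThanLessThan ar)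
      have "{u<..<v} \<subseteq> ball x e" using uv by (auto simp: dist_real_def)
      then have "(a, r) \<in> K" unfolding K_def using b uv e ar by auto
      moreover have "x \<in> ball a r" "r < d" using b uv ar by simp_all
      ultimately show ?thesis by (intro exI[of _ "(a, r)"]) auto
    qed
    then obtain C where C: "countable C" "C \<subseteq> K"
      "pairwise (\<lambda>i j. disjnt (ball (fst i) (snd i)) (ball (fst j) (snd j))) C"
      "negligible (E - (\<Union>i\<in>C. ball (fst i) (snd i)))"
      by (rule Vitali_covering_theorem_balls)
    let ?B = "\<lambda>i. ball (fst i) (snd i)"
    let ?N = "E - (\<Union>i\<in>C. ?B i)"
    have N: "?N \<in> sets borel" using E C by (intro sets.Diff sets.countable_UN') auto
    have "negligible (h ` ?N)"
    proof (rule negligible_locally_Lipschitz_image[OF _ C(4)])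
      show "DIM(real) \<le> DIM(real)" by simp
      fix x
      show "\<exists>T B. open T \<and> x \<in> T \<and> (\<forall>y\<in>?N \<inter> T. norm (h y - h x) \<le> B * norm (y - x))"
        using lip by (intro exI[of _ UNIV] exI[of _ L]) (auto simp: lipschitz_on_def dist_norm)
    qed
    then have N0: "emeasure lborel (h ` ?N) = 0"
      using borel_img[OF N] by (simp add: negligible_iff_emeasure0)
    have bd: "emeasure lborel (h ` ?B i) \<le> ennreal p * emeasure lborel (?B i)" if "i \<in> C" for i
    proof -
      obtain a r where i: "i = (a,r)" by (cases i)
      have K: "0 < r" "h (a + r) - h (a - r) \<le> p * (2 * r)" using that C i by (auto simp: K_def)
      have "h ` ?B i \<subseteq> {h (a - r)..h (a + r)}"
        using i by (auto simp: ball_eq_greaterThanLessThan intro!: monoD[OF mono])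
      then have "emeasure lborel (h ` ?B i) \<le> emeasure lborel {h (a - r)..h (a + r)}"
        by (intro emeasure_mono) auto
      also have "\<dots> = ennreal (h (a + r) - h (a - r))" using K monoD[OF mono, of "a-r" "a+r"] by simp
      also have "\<dots> \<le> ennreal (p * (2 * r))" using K by (intro ennreal_leI) auto
      also have "\<dots> = ennreal p * emeasure lborel (?B i)"
        using K p i by (simp add: ball_eq_greaterThanLessThan ennreal_mult)
      finally show ?thesis .
    qed
    have dj: "disjoint_family_on ?B C"
      using C(3) by (auto simp: disjoint_family_on_def pairwise_def disjnt_def)
    have dj': "disjoint_family_on (\<lambda>i. h ` ?B i) C"
      using dj unfolding disjoint_family_on_def img by (metis vimage_Int vimage_empty)
    have "emeasure lborel (\<Union>i\<in>C. h ` ?B i) = (\<integral>\<^sup>+i. emeasure lborel (h ` ?B i) \<partial>count_space C)"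
      using C borel_img dj' by (intro emeasure_UN_countable) auto
    also have "\<dots> \<le> (\<integral>\<^sup>+i. ennreal p * emeasure lborel (?B i) \<partial>count_space C)"
      using bd by (intro nn_integral_mono) auto
    also have "\<dots> = ennreal p * (\<integral>\<^sup>+i. emeasure lborel (?B i) \<partial>count_space C)"
      by (intro nn_integral_cmult) auto
    also have "\<dots> = ennreal p * emeasure lborel (\<Union>i\<in>C. ?B i)"
      using C dj by (subst emeasure_UN_countable) auto
    also have "\<dots> \<le> ennreal p * emeasure lborel T"
      using C(2) T(1) by (intro mult_left_mono emeasure_mono) (fastforce simp: K_def)+
    also have "emeasure lborel T = emeasure lborel E + emeasure lborel (T - E)"
      using T E by (subst plus_emeasure) (auto simp: Un_absorb1)
    also have "emeasure lborel (T - E) = emeasure lebesgue (T - E)"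
      using T E by simp
    also have "\<dots> \<le> ennreal e" using T by simp
    finally have UB: "emeasure lborel (\<Union>i\<in>C. h ` ?B i) \<le> ennreal p * emeasure lborel E + ennreal p * ennreal e"
      by (simp add: distrib_left mult_left_mono add_left_mono)
    have "h ` E \<subseteq> h ` ?N \<union> (\<Union>i\<in>C. h ` ?B i)" by blast
    moreover have m: "(\<Union>i\<in>C. h ` ?B i) \<in> sets borel" using C borel_img by (intro sets.countable_UN') auto
    ultimately have "emeasure lborel (h ` E) \<le> emeasure lborel (h ` ?N) + emeasure lborel (\<Union>i\<in>C. h ` ?B i)"
      using borel_img[OF N] by (intro order_trans[OF emeasure_mono emeasure_subadditive]) auto
    then show ?thesis using UB N0 by simp
  qed
  show ?thesis
  proof (rule ennreal_le_epsilon)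
    fix e :: real assume e: "0 < e"
    have "ennreal p * ennreal (e / (p + 1)) \<le> ennreal e"
      using e p by (subst ennreal_mult[symmetric]) (auto intro!: ennreal_leI simp: field_simps)
    then show "emeasure lborel (h ` E) \<le> ennreal p * emeasure lborel E + ennreal e"
      using main[of "e / (p + 1)"] e p by (meson add_left_mono order_trans divide_pos_pos add_nonneg_pos zero_less_one)
  qed
qed

text \<open>A continuous function that does not contract intervals is a homeomorphism of the line with a
  1-Lipschitz inverse. Both the function \<open>t \<mapsto> f t + (L + 1) * t\<close> for an \<open>L\<close>-Lipschitz \<open>f\<close>
  and \<open>t \<mapsto> t + v t\<close> for a variation function \<open>v\<close> are of this kind.\<close>

lemma expanding_bij:
  fixes g :: "real \<Rightarrow> real"
  assumes cont: "continuous_on UNIV g" and ex: "\<And>u v. u \<le> v \<Longrightarrow> v - u \<le> g v - g u"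
  shows "bij g" and "mono (inv g)" and "1-lipschitz_on UNIV (inv g)"
proof -
  have lt: "g u < g v" if "u < v" for u v using ex[of u v] that by simp
  have inj: "inj g" by (rule injI) (metis lt less_irrefl linorder_less_linear)
  have "\<exists>x. g x = y" for y
  proof -
    define m where "m = \<bar>y - g 0\<bar>"
    have "g (-m) \<le> y" "y \<le> g m" using ex[of "-m" 0] ex[of 0 m] by (auto simp: m_def)
    then show ?thesis
      using IVT'[of g "-m" y m] continuous_on_subset[OF cont] by (auto simp: m_def)
  qed
  then have surj: "surj g" by (metis surjI)
  show bij: "bij g" using inj surj by (simp add: bij_def)
  have *: "inv g x \<le> inv g y \<and> inv g y - inv g x \<le> y - x" if "x \<le> y" for x y
  proof -
    have xy: "g (inv g x) = x" "g (inv g y) = y" using surj by (simp_all add: surj_f_inv_f)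
    then have "inv g x \<le> inv g y" using lt[of "inv g y" "inv g x"] that by linarith
    then show ?thesis using ex[of "inv g x" "inv g y"] xy by simp
  qed
  then show "mono (inv g)" by (auto intro: monoI)
  show "1-lipschitz_on UNIV (inv g)"
  proof (rule lipschitz_onI)
    fix x y :: real
    show "dist (inv g x) (inv g y) \<le> 1 * dist x y"
      using *[of x y] *[of y x] by (cases "x \<le> y") (auto simp: dist_real_def)
  qed simp
qed

text \<open>On a bounded set \<open>A\<close> of points with slopes below \<open>p\<close> and above \<open>q\<close>, the map \<open>g\<close> stretches measure
  at most by \<open>p\<close>, and its inverse at most by \<open>1 / q\<close>. Hence the measure of \<open>A\<close> is at most \<open>p / q\<close>
  times itself.\<close>

lemma negligible_slope_gap:
  fixes g :: "real \<Rightarrow> real"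
  assumes ex: "\<And>u v. u \<le> v \<Longrightarrow> v - u \<le> g v - g u" and lip: "L-lipschitz_on UNIV g"
    and p: "0 < p" "p < q"
  shows "negligible (slope_below g p \<inter> slope_above g q)"
proof -
  have cont: "continuous_on UNIV g" using lip by (rule lipschitz_on_continuous_on)
  note b = expanding_bij[OF cont ex]
  define k where "k = inv g"
  have kg: "k (g x) = x" and gk: "g (k y) = y" for x y
    using b(1) by (simp_all add: k_def bij_is_inj bij_is_surj surj_f_inv_f)
  have contk: "continuous_on UNIV k" using b(3) lipschitz_on_continuous_on unfolding k_def by blast
  have lt: "g u < g v" if "u < v" for u v using ex[of u v] that by simp
  have monog: "mono g" using ex by (intro monoI) (metis diff_ge_0_iff_ge order_trans)
  have L0: "L \<ge> 0" using lip by (rule lipschitz_on_nonneg)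
  have "negligible (slope_below g p \<inter> slope_above g q \<inter> {s..t})" (is "negligible ?A") for s t
  proof -
    have A: "?A \<in> sets borel" by measurable
    have img: "g ` X = k -` X" for X using kg gk by (auto simp: image_iff) metis
    have gA: "g ` ?A \<in> sets borel"
      using measurable_sets[OF borel_measurable_continuous_onI[OF contk] A] by (simp add: img)
    have "emeasure lborel ?A \<le> emeasure lborel {s..t}" by (intro emeasure_mono) auto
    also have "\<dots> < \<infinity>" by (simp add: emeasure_lborel_Icc_eq)
    finally obtain a where a: "emeasure lborel ?A = ennreal a" "a \<ge> 0"
      by (metis ennreal_cases infinity_ennreal_def less_irrefl)
    have 1: "emeasure lborel (g ` ?A) \<le> ennreal p * emeasure lborel ?A"
      using p by (intro emeasure_image_slope_below[OF kg gk monog contk lip A]) auto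
    have sub: "g ` ?A \<subseteq> slope_below k (1 / q)"
    proof
      fix y assume "y \<in> g ` ?A"
      then obtain x where x: "x \<in> slope_above g q" "y = g x" by auto
      have "\<exists>u v. u < y \<and> y < v \<and> v - u < d \<and> k v - k u < 1 / q * (v - u)" if "d > 0" for d
      proof -
        have "d / (L + 1) > 0" using that L0 by simp
        then obtain u v where uv: "u < x" "x < v" "v - u < d / (L + 1)" "g v - g u > q * (v - u)"
          by (rule slope_aboveE[OF x(1)])
        have "g v - g u \<le> L * (v - u)"
          using lipschitz_onD[OF lip, of v u] uv lt[of u v] by (simp add: dist_real_def)
        also have "\<dots> < d" using uv L0 by (simp add: field_simps)
        finally have "g v - g u < d" .
        moreover have "k (g v) - k (g u) < 1 / q * (g v - g u)" using uv p by (simp add: kg field_simps)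
        ultimately show ?thesis using lt uv x by (intro exI[of _ "g u"] exI[of _ "g v"]) auto
      qed
      then show "y \<in> slope_below k (1 / q)" unfolding slope_below_def by blast
    qed
    have "k ` g ` ?A = ?A" by (simp add: image_image kg)
    moreover have "emeasure lborel (k ` (g ` ?A)) \<le> ennreal (1 / q) * emeasure lborel (g ` ?A)"
      using p b by (intro emeasure_image_slope_below[OF gk kg _ cont _ gA sub]) (auto simp: k_def)
    ultimately have "emeasure lborel ?A \<le> ennreal (1 / q) * emeasure lborel (g ` ?A)" by simp
    also have "\<dots> \<le> ennreal (1 / q) * (ennreal p * emeasure lborel ?A)"
      by (intro mult_left_mono 1) simp
    also have "\<dots> = ennreal ((1 / q) * (p * a))"
      using p by (simp only: a ennreal_mult'[of "1 / q" "p * a"] ennreal_mult'[of p a] zero_le_divide_1_iff less_imp_le order_less_trans)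
    finally have le: "ennreal a \<le> ennreal ((1 / q) * (p * a))" by (simp only: a)
    have "a \<le> (1 / q) * (p * a)"
      by (rule iffD1[OF ennreal_le_iff le]) (use a p in simp)
    then have "a * q \<le> a * p" using p by (simp add: field_simps)
    then have "a = 0" using a p by (metis mult_le_cancel_left_pos not_less order_le_less)
    then show ?thesis using a(1) A by (simp add: negligible_iff_emeasure0)
  qed
  then show ?thesis by (subst negligible_on_intervals) simp
qed

text \<open>Slope bounds for intervals around \<open>x\<close> extend by continuity to intervals with endpoint \<open>x\<close>.\<close>

lemma slopes_extend:
  fixes g :: "real \<Rightarrow> real"
  assumes cont: "continuous_on UNIV g"
    and le: "\<And>u v. u < x \<Longrightarrow> x < v \<Longrightarrow> v - u < d \<Longrightarrow> g v - g u \<le> c * (v - u)"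
    and uv: "u \<le> x" "x \<le> v" "v - u < d" "u < v"
  shows "g v - g u \<le> c * (v - u)"
proof -
  have *: "g v' - g u \<le> c * (v' - u)" if "x < v'" "v' - u < d" "u \<le> x" for u v'
  proof (cases "u < x")
    case True then show ?thesis using le that by auto
  next
    case False
    then have [simp]: "u = x" using that by simp
    have "isCont (\<lambda>t. c * (v' - t) - (g v' - g t)) x"
      using cont by (intro continuous_intros) (simp add: continuous_on_eq_continuous_at)
    then have "((\<lambda>t. c * (v' - t) - (g v' - g t)) \<longlongrightarrow> c * (v' - x) - (g v' - g x)) (at_left x)"
      unfolding isCont_def by (rule tendsto_within_subset) simp
    moreover have "\<forall>\<^sub>F t in at_left x. 0 \<le> c * (v' - t) - (g v' - g t)"
    proof (rule eventually_at_leftI[of "v' - d"])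
      fix t assume "t \<in> {v' - d<..<x}"
      then have "g v' - g t \<le> c * (v' - t)" using that by (intro le) auto
      then show "0 \<le> c * (v' - t) - (g v' - g t)" by simp
    qed (use that in auto)
    ultimately have "0 \<le> c * (v' - x) - (g v' - g x)"
      by (intro tendsto_lowerbound) auto
    then show ?thesis by simp
  qed
  show ?thesis
  proof (cases "x < v")
    case True then show ?thesis using * uv by auto
  next
    case False
    then have [simp]: "v = x" using uv by simp
    have "isCont (\<lambda>t. c * (t - u) - (g t - g u)) x"
      using cont by (intro continuous_intros) (simp add: continuous_on_eq_continuous_at)
    then have "((\<lambda>t. c * (t - u) - (g t - g u)) \<longlongrightarrow> c * (x - u) - (g x - g u)) (at_right x)"
      unfolding isCont_def by (rule tendsto_within_subset) simp
    moreover have "\<forall>\<^sub>F t in at_right x. 0 \<le> c * (t - u) - (g t - g u)"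
    proof (rule eventually_at_rightI[of _ "u + d"])
      fix t assume "t \<in> {x<..<u + d}"
      then have "g t - g u \<le> c * (t - u)" using uv by (intro *) auto
      then show "0 \<le> c * (t - u) - (g t - g u)" by simp
    qed (use uv in auto)
    ultimately have "0 \<le> c * (x - u) - (g x - g u)"
      by (intro tendsto_lowerbound) auto
    then show ?thesis by simp
  qed
qed

text \<open>The derivative is the supremum of the slopes that are exceeded on arbitrarily short intervals
  around \<open>x\<close>. Rational slopes \<open>p\<close> and \<open>q\<close> suffice.\<close>

lemma differentiable_of_no_slope_gap:
  fixes g :: "real \<Rightarrow> real"
  assumes ex: "\<And>u v. u \<le> v \<Longrightarrow> v - u \<le> g v - g u" and lip: "L-lipschitz_on UNIV g"
    and gap: "\<And>p q. p \<in> \<rat> \<Longrightarrow> q \<in> \<rat> \<Longrightarrow> 0 < p \<Longrightarrow> p < q \<Longrightarrow> x \<notin> slope_below g p \<inter> slope_above g q"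
  shows "g differentiable (at x)"
proof -
  have cont: "continuous_on UNIV g" using lip by (rule lipschitz_on_continuous_on)
  define A where "A = {q. x \<in> slope_above g q}"
  have bd: "q \<le> L" if "q \<in> A" for q
  proof -
    have "x \<in> slope_above g q" using that by (simp add: A_def)
    then obtain u v where uv: "u < x" "x < v" "v - u < 1" "q * (v - u) < g v - g u"
      by (rule slope_aboveE[OF _ zero_less_one])
    have "g v - g u \<le> L * (v - u)" using lipschitz_onD[OF lip, of v u] uv by (simp add: dist_real_def)
    then have "q * (v - u) < L * (v - u)" using uv by linarith
    then show ?thesis using uv by (simp add: mult_less_cancel_right)
  qed
  then have bdA: "bdd_above A" by (rule bdd_aboveI)
  have "0 \<in> A"
  proof -
    have "\<exists>u v. u < x \<and> x < v \<and> v - u < d \<and> 0 * (v - u) < g v - g u" if "d > 0" for d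
    proof -
      have "(x + d / 3) - (x - d / 3) \<le> g (x + d / 3) - g (x - d / 3)" using that by (intro ex) simp
      then show ?thesis using that by (intro exI[of _ "x - d / 3"] exI[of _ "x + d / 3"]) auto
    qed
    then show ?thesis by (simp add: A_def slope_above_def)
  qed
  define D where "D = Sup A"
  have up: "\<exists>d>0. \<forall>u v. u < x \<longrightarrow> x < v \<longrightarrow> v - u < d \<longrightarrow> g v - g u \<le> (D + e) * (v - u)" if "e > 0" for e
  proof -
    have "D + e \<notin> A" using cSup_upper[OF _ bdA, of "D + e"] that by (auto simp: D_def)
    then obtain d where "d > 0" "\<And>u v. \<not> (u < x \<and> x < v \<and> v - u < d \<and> (D + e) * (v - u) < g v - g u)"
      unfolding A_def slope_above_def by blast
    then show ?thesis by (intro exI[of _ d] conjI allI impI) (meson not_less)+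
  qed
  have lo: "\<exists>d>0. \<forall>u v. u < x \<longrightarrow> x < v \<longrightarrow> v - u < d \<longrightarrow> g v - g u \<ge> (D - e) * (v - u)" if "e > 0" for e
  proof -
    have "x \<notin> slope_below g (D - e)"
    proof
      assume below: "x \<in> slope_below g (D - e)"
      obtain q where q: "q \<in> A" "D - e < q"
        using less_cSupD[of A "D - e"] \<open>0 \<in> A\<close> \<open>e > 0\<close> by (auto simp: D_def)
      have pos: "D - e > 0"
      proof -
        obtain u v where uv: "u < x" "x < v" "v - u < 1" "g v - g u < (D - e) * (v - u)"
          by (rule slope_belowE[OF below zero_less_one])
        then have "0 < (D - e) * (v - u)" using ex[of u v] by linarith
        then show ?thesis using uv by (simp add: zero_less_mult_iff)
      qed
      obtain q' where q': "q' \<in> \<rat>" "D - e < q'" "q' < q" using Rats_dense_in_real[OF q(2)] by auto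
      obtain p' where p': "p' \<in> \<rat>" "D - e < p'" "p' < q'" using Rats_dense_in_real[OF q'(2)] by auto
      have "x \<in> slope_below g p'" using below p' slope_below_mono[of "D - e" p' g] by auto
      moreover have "x \<in> slope_above g q'" using q(1) q' slope_above_antimono[of q' q g] by (auto simp: A_def)
      ultimately show False using gap[of p' q'] p' q' pos by auto
    qed
    then obtain d where "d > 0" "\<And>u v. \<not> (u < x \<and> x < v \<and> v - u < d \<and> g v - g u < (D - e) * (v - u))"
      unfolding slope_below_def by blast
    then show ?thesis by (intro exI[of _ d] conjI allI impI) (meson not_less)+
  qed
  have "(g has_derivative (\<lambda>h. D * h)) (at x)"
    unfolding has_derivative_at_alt
  proof (intro conjI allI impI)
    show "bounded_linear (\<lambda>h. D * h)" by (rule bounded_linear_mult_right)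
    fix e :: real assume e: "0 < e"
    obtain d1 where d1: "d1 > 0" "\<And>u v. u < x \<Longrightarrow> x < v \<Longrightarrow> v - u < d1 \<Longrightarrow> g v - g u \<le> (D + e) * (v - u)"
      using up[OF e] by blast
    obtain d2 where d2: "d2 > 0" "\<And>u v. u < x \<Longrightarrow> x < v \<Longrightarrow> v - u < d2 \<Longrightarrow> (D - e) * (v - u) \<le> g v - g u"
      using lo[OF e] by blast
    have contm: "continuous_on UNIV (\<lambda>t. - g t)" using cont by (intro continuous_intros)
    have b: "\<bar>g v - g u - D * (v - u)\<bar> \<le> e * (v - u)" if "u \<le> x" "x \<le> v" "u < v" "v - u < min d1 d2" for u v
    proof -
      have "g v - g u \<le> (D + e) * (v - u)"
        using that by (intro slopes_extend[OF cont d1(2), of x]) auto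
      then have 1: "g v - g u \<le> D * (v - u) + e * (v - u)" by (simp only: distrib_right)
      have "- g v - (- g u) \<le> (e - D) * (v - u)"
      proof (rule slopes_extend[OF contm, of x d2])
        fix u v assume "u < x" "x < v" "v - u < d2"
        then have "(D - e) * (v - u) \<le> g v - g u" by (rule d2(2))
        moreover have "(e - D) * (v - u) = - ((D - e) * (v - u))" by (simp add: algebra_simps)
        ultimately show "- g v - (- g u) \<le> (e - D) * (v - u)" by simp
      qed (use that in auto)
      then have 2: "- g v - (- g u) \<le> e * (v - u) - D * (v - u)" by (simp only: left_diff_distrib)
      show ?thesis using 1 2 by (simp only: abs_le_iff) simp
    qed
    have "norm (g y - g x - D * (y - x)) \<le> e * norm (y - x)" if "norm (y - x) < min d1 d2" for y
    proof -
      consider "y = x" | "y < x" | "x < y" by linarith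
      then show ?thesis
      proof cases
        case 2
        have "g y - g x - D * (y - x) = - (g x - g y - D * (x - y))" by (simp add: algebra_simps)
        then have "norm (g y - g x - D * (y - x)) = \<bar>g x - g y - D * (x - y)\<bar>" by (simp only: real_norm_def abs_minus_cancel)
        also have "\<dots> \<le> e * (x - y)" using 2 that by (intro b) auto
        finally show ?thesis using 2 by simp
      next
        case 3
        have "norm (g y - g x - D * (y - x)) = \<bar>g y - g x - D * (y - x)\<bar>" by (simp only: real_norm_def)
        also have "\<dots> \<le> e * (y - x)" using 3 that by (intro b) auto
        finally show ?thesis using 3 by simp
      qed simp
    qed
    then show "\<exists>d>0. \<forall>y. norm (y - x) < d \<longrightarrow> norm (g y - g x - D * (y - x)) \<le> e * norm (y - x)"
      using d1(1) d2(1) by (intro exI[of _ "min d1 d2"]) auto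
  qed
  then show ?thesis by (rule differentiableI)
qed

lemma lipschitz_real_differentiable_ae:
  fixes f :: "real \<Rightarrow> real"
  assumes lip: "L-lipschitz_on UNIV f"
  shows "negligible {x. \<not> f differentiable (at x)}"
proof -
  define g where "g t = f t + (L + 1) * t" for t
  have L0: "L \<ge> 0" using lip by (rule lipschitz_on_nonneg)
  have f: "\<bar>f v - f u\<bar> \<le> L * (v - u)" if "u \<le> v" for u v
    using lipschitz_onD[OF lip, of v u] that by (simp add: dist_real_def)
  have ex: "v - u \<le> g v - g u" if "u \<le> v" for u v
    using f[OF that] by (simp add: g_def algebra_simps abs_le_iff)
  have gl: "(2 * L + 1)-lipschitz_on UNIV g"
  proof (rule lipschitz_onI)
    have *: "\<bar>g v - g u\<bar> \<le> (2 * L + 1) * (v - u)" if "u \<le> v" for u v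
      using f[OF that] ex[OF that] that by (simp add: g_def algebra_simps abs_le_iff)
    fix u v :: real
    show "dist (g u) (g v) \<le> (2 * L + 1) * dist u v"
      using *[of u v] *[of v u] by (cases "u \<le> v") (auto simp: dist_real_def abs_minus_commute)
  qed (use L0 in simp)
  let ?I = "{(p,q). p \<in> \<rat> \<and> q \<in> \<rat> \<and> 0 < p \<and> p < (q::real)}"
  let ?N = "\<Union>(p,q)\<in>?I. slope_below g p \<inter> slope_above g q"
  have "countable (\<rat> \<times> \<rat> :: (real \<times> real) set)" by (intro countable_SIGMA countable_rat)
  then have "countable ?I" by (rule countable_subset[rotated]) auto
  then have "negligible ?N"
    by (intro negligible_countable_Union) (auto intro!: negligible_slope_gap[OF ex gl])
  moreover have "{x. \<not> f differentiable (at x)} \<subseteq> ?N"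
  proof (rule subsetI, rule ccontr)
    fix x assume x: "x \<in> {x. \<not> f differentiable (at x)}" "x \<notin> ?N"
    have "g differentiable (at x)"
      by (rule differentiable_of_no_slope_gap[OF ex gl]) (use x in auto)
    then have "(\<lambda>t. g t - (L + 1) * t) differentiable (at x)" by (intro derivative_intros) auto
    then show False using x by (simp add: g_def)
  qed
  ultimately show ?thesis using negligible_subset by blast
qed

lemma lipschitz_differentiable_ae:
  fixes f :: "real \<Rightarrow> 'a::euclidean_space"
  assumes lip: "L-lipschitz_on UNIV f"
  shows "negligible {x. \<not> f differentiable (at x)}"
proof -
  have "{x. \<not> f differentiable (at x)} = (\<Union>i\<in>Basis. {x. \<not> (\<lambda>x. f x \<bullet> i) differentiable (at x)})"
    by (subst differentiable_componentwise_within) auto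
  moreover have "negligible {x. \<not> (\<lambda>x. f x \<bullet> i) differentiable (at x)}" if i: "i \<in> Basis" for i
  proof (rule lipschitz_real_differentiable_ae)
    show "L-lipschitz_on UNIV (\<lambda>x. f x \<bullet> i)"
    proof (rule lipschitz_onI)
      fix x y
      have "dist (f x \<bullet> i) (f y \<bullet> i) = \<bar>(f x - f y) \<bullet> i\<bar>" by (simp add: dist_real_def inner_diff_left)
      also have "\<dots> \<le> norm (f x - f y)" by (rule Basis_le_norm[OF i])
      also have "\<dots> \<le> L * dist x y" using lipschitz_onD[OF lip, of x y] by (simp add: dist_norm)
      finally show "dist (f x \<bullet> i) (f y \<bullet> i) \<le> L * dist x y" .
    qed (rule lipschitz_on_nonneg[OF lip])
  qed
  ultimately show ?thesis by (auto intro!: negligible_Union)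
qed

section \<open>Total variation and Lipschitz reparameterization\<close>

text \<open>A pair \<open>(n, p)\<close> stands for the nondecreasing points \<open>p 0 \<le> ... \<le> p n\<close> of the interval;
  the values of \<open>p\<close> beyond \<open>n\<close> are irrelevant.\<close>

definition partitions :: "real \<Rightarrow> real \<Rightarrow> (nat \<times> (nat \<Rightarrow> real)) set" where
  "partitions u v = {(n, p). (\<forall>i\<le>n. p i \<in> {u..v}) \<and> (\<forall>i<n. p i \<le> p (Suc i))}"

text \<open>The length of the polygon with vertices at the points of a partition.\<close>

definition polygon_length :: "(real \<Rightarrow> 'a::metric_space) \<Rightarrow> nat \<times> (nat \<Rightarrow> real) \<Rightarrow> real" where
  "polygon_length f = (\<lambda>(n, p). \<Sum>i<n. dist (f (p i)) (f (p (Suc i))))"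

text \<open>The total variation on \<open>{u..v}\<close>. It is a supremum of reals, hence meaningful only if
  the function has bounded variation there.\<close>

definition variation :: "(real \<Rightarrow> 'a::metric_space) \<Rightarrow> real \<Rightarrow> real \<Rightarrow> real" where
  "variation f u v = (SUP P\<in>partitions u v. polygon_length f P)"

lemma partitions_nonempty: "u \<le> v \<Longrightarrow> partitions u v \<noteq> {}"
  by (auto simp: partitions_def intro!: exI[of _ "0::nat"] exI[of _ "\<lambda>_. u"])

lemma partitions_mono: "a \<le> u \<Longrightarrow> v \<le> b \<Longrightarrow> partitions u v \<subseteq> partitions a b"
  unfolding partitions_def by fastforce

lemma sum_lessThan_plus: "(\<Sum>i<n+m. f i) = (\<Sum>i<n. f i) + (\<Sum>i<m. f (n + i))"
  for f :: "nat \<Rightarrow> real"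
  by (induction m) (auto simp: algebra_simps)

lemma bdd_variation:
  assumes "bounded_variation_on {a..b} f" "a \<le> u" "v \<le> b"
  shows "bdd_above (polygon_length f ` partitions u v)"
proof -
  obtain M where M: "\<And>n t. (\<forall>i\<le>n. t i \<in> {a..b}) \<and> (\<forall>i<n. t i \<le> t (Suc i))
      \<Longrightarrow> (\<Sum>i<n. dist (f (t i)) (f (t (Suc i)))) \<le> M"
    using assms(1) unfolding bounded_variation_on_def by metis
  show ?thesis
  proof (rule bdd_aboveI2[of _ _ M])
    fix P assume "P \<in> partitions u v"
    then have "P \<in> partitions a b" using partitions_mono[OF assms(2,3)] by blast
    then show "polygon_length f P \<le> M"
      using M by (auto simp: partitions_def polygon_length_def)
  qed
qed

lemma polygon_length_le_variation:
  assumes "bounded_variation_on {a..b} f" "a \<le> u" "v \<le> b" "P \<in> partitions u v"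
  shows "polygon_length f P \<le> variation f u v"
  unfolding variation_def using assms(4) bdd_variation[OF assms(1-3)] by (rule cSUP_upper)

lemma variation_superadditive:
  assumes bv: "bounded_variation_on {a..b} f" and uv: "a \<le> u" "u \<le> v" "v \<le> b"
    and Q: "Q \<in> partitions u v"
  shows "variation f a u + polygon_length f Q \<le> variation f a v"
proof -
  obtain m q where mq: "Q = (m, q)" by (cases Q)
  have "variation f a u \<le> variation f a v - polygon_length f Q"
    unfolding variation_def[of f a u]
  proof (rule cSUP_least[OF partitions_nonempty[OF uv(1)]])
    fix P assume P: "P \<in> partitions a u"
    obtain n p where np: "P = (n, p)" by (cases P)
    define r where "r i = (if i \<le> n then p i else q (i - Suc n))" for i
    have p: "\<And>i. i \<le> n \<Longrightarrow> p i \<in> {a..u}" "\<And>i. i < n \<Longrightarrow> p i \<le> p (Suc i)"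
      using P by (auto simp: np partitions_def)
    have q: "\<And>i. i \<le> m \<Longrightarrow> q i \<in> {u..v}" "\<And>i. i < m \<Longrightarrow> q i \<le> q (Suc i)"
      using Q by (auto simp: mq partitions_def)
    have "(n + Suc m, r) \<in> partitions a v"
      unfolding partitions_def
    proof (clarsimp, intro conjI allI impI)
      fix i assume i: "i \<le> Suc (n + m)"
      have "r i \<in> {a..v}"
      proof (cases "i \<le> n")
        case True then show ?thesis using p(1)[of i] uv by (auto simp: r_def)
      next
        case False
        then have "i - Suc n \<le> m" using i by simp
        with False show ?thesis using q(1)[of "i - Suc n"] uv by (auto simp: r_def)
      qed
      then show "a \<le> r i" "r i \<le> v" by auto
    next
      fix i assume i: "i < Suc (n + m)"
      consider "i < n" | "i = n" | "i > n" by linarith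
      then show "r i \<le> r (Suc i)"
      proof cases
        case 1 then show ?thesis using p(2) by (simp add: r_def)
      next
        case 2 then show ?thesis using p(1)[of n] q(1)[of 0] by (simp add: r_def)
      next
        case 3
        then have "Suc i - Suc n = Suc (i - Suc n)" by simp
        with 3 show ?thesis using q(2)[of "i - Suc n"] i by (simp add: r_def)
      qed
    qed
    then have "polygon_length f (n + Suc m, r) \<le> variation f a v"
      using uv by (intro polygon_length_le_variation[OF bv]) auto
    moreover have "polygon_length f P + polygon_length f Q \<le> polygon_length f (n + Suc m, r)"
    proof -
      have "polygon_length f (n + Suc m, r) = (\<Sum>i<n. dist (f (r i)) (f (r (Suc i)))) +
          (dist (f (r n)) (f (r (Suc n))) + (\<Sum>i<m. dist (f (r (n + Suc i))) (f (r (Suc (n + Suc i))))))"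
        unfolding polygon_length_def prod.case by (subst sum_lessThan_plus, subst sum.lessThan_Suc_shift) simp
      moreover have "(\<Sum>i<n. dist (f (r i)) (f (r (Suc i)))) = polygon_length f P"
        by (auto simp: np polygon_length_def r_def intro!: sum.cong)
      moreover have "(\<Sum>i<m. dist (f (r (n + Suc i))) (f (r (Suc (n + Suc i))))) = polygon_length f Q"
        by (auto simp: mq polygon_length_def r_def intro!: sum.cong)
      ultimately show ?thesis by simp
    qed
    ultimately show "polygon_length f P \<le> variation f a v - polygon_length f Q" by simp
  qed
  then show ?thesis by simp
qed

lemma dist_le_variation_diff:
  assumes bv: "bounded_variation_on {a..b} f" and uv: "a \<le> u" "u \<le> v" "v \<le> b"
  shows "dist (f u) (f v) \<le> variation f a v - variation f a u"
proof -
  let ?Q = "(1::nat, \<lambda>i::nat. if i = 0 then u else v)"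
  have "?Q \<in> partitions u v" using uv by (auto simp: partitions_def)
  moreover have "polygon_length f ?Q = dist (f u) (f v)" by (simp add: polygon_length_def)
  ultimately show ?thesis using variation_superadditive[OF bv uv, of ?Q] by simp
qed

lemma variation_self: "variation f a a = 0"
proof -
  have "polygon_length f P = 0" if "P \<in> partitions a a" for P
  proof -
    obtain n p where P: "P = (n, p)" by (cases P)
    have "p i = a" if "i \<le> n" for i using that \<open>P \<in> partitions a a\<close> by (force simp: P partitions_def)
    then show ?thesis by (auto simp: P polygon_length_def intro!: sum.neutral)
  qed
  then have "polygon_length f ` partitions a a = {0}" using partitions_nonempty[of a a] by force
  then show ?thesis by (simp add: variation_def)
qed

text \<open>The length of the polygon for the partition \<open>P\<close> with all points beyond \<open>t\<close> moved to \<open>t\<close>.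
  For continuous \<open>f\<close> it is a finite sum of continuous functions of \<open>t\<close>.\<close>

definition truncated_length :: "(real \<Rightarrow> 'a::metric_space) \<Rightarrow> nat \<times> (nat \<Rightarrow> real) \<Rightarrow> real \<Rightarrow> real" where
  "truncated_length f P t = polygon_length f (fst P, \<lambda>i. min t (snd P i))"

text \<open>The variation up to \<open>t\<close> exceeds the truncated length by an amount that is nondecreasing
  in \<open>t\<close>. For this reason a partition that is nearly optimal on the whole interval is nearly optimal
  at every \<open>t\<close>.\<close>

lemma truncated_length_diff:
  assumes bv: "bounded_variation_on {a..b} f" and uv: "a \<le> u" "u \<le> v" "v \<le> b"
    and P: "P \<in> partitions a b"
  shows "truncated_length f P v - truncated_length f P u \<le> variation f a v - variation f a u"
proof -
  obtain n p where np: "P = (n, p)" by (cases P)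
  have p: "\<And>i. i \<le> n \<Longrightarrow> p i \<in> {a..b}" "\<And>i. i < n \<Longrightarrow> p i \<le> p (Suc i)"
    using P by (auto simp: np partitions_def)
  define q where "q i = max u (min v (p i))" for i
  have "max u (min v (p i)) \<le> max u (min v (p (Suc i)))" if "i < n" for i
    using p(2)[OF that] by (intro max.mono min.mono) auto
  then have "(n, q) \<in> partitions u v"
    using uv by (auto simp: partitions_def q_def)
  then have 1: "variation f a u + polygon_length f (n, q) \<le> variation f a v"
    by (rule variation_superadditive[OF bv uv])
  have "dist (f (min v (p i))) (f (min v (p (Suc i)))) \<le>
      dist (f (min u (p i))) (f (min u (p (Suc i)))) + dist (f (q i)) (f (q (Suc i)))" if "i < n" for i
  proof -
    note le = p(2)[OF that]
    consider "p (Suc i) \<le> u" | "p i \<le> u" "u < p (Suc i)" | "u < p i" by linarith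
    then show ?thesis
    proof cases
      case 1
      then have "min v (p i) = p i" "min u (p i) = p i" "min u (p (Suc i)) = p (Suc i)"
        "min v (p (Suc i)) = p (Suc i)" using le uv by auto
      then show ?thesis by simp
    next
      case 2
      then have "min v (p i) = p i" "min u (p i) = p i" "min u (p (Suc i)) = u" "q i = u"
        "q (Suc i) = min v (p (Suc i))" using uv by (auto simp: q_def)
      then show ?thesis by (simp add: dist_triangle)
    next
      case 3
      then have "q i = min v (p i)" "q (Suc i) = min v (p (Suc i))" using uv le by (auto simp: q_def)
      then show ?thesis by simp
    qed
  qed
  then have "truncated_length f P v \<le> truncated_length f P u + polygon_length f (n, q)"
    by (auto simp: truncated_length_def polygon_length_def np sum.distrib[symmetric] intro!: sum_mono)
  with 1 show ?thesis by simp
qed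

lemma truncated_length_le:
  assumes bv: "bounded_variation_on {a..b} f" and t: "a \<le> t" "t \<le> b" and P: "P \<in> partitions a b"
  shows "truncated_length f P t \<le> variation f a t"
proof -
  obtain n p where np: "P = (n, p)" by (cases P)
  have "(n, \<lambda>i. min t (p i)) \<in> partitions a t"
    using P t by (auto simp: np partitions_def intro!: min.mono)
  then show ?thesis
    using t by (auto simp: truncated_length_def np intro!: polygon_length_le_variation[OF bv])
qed

lemma truncated_length_continuous:
  assumes cont: "continuous_on {a..b} f" and P: "P \<in> partitions a b"
  shows "continuous_on {a..b} (truncated_length f P)"
proof -
  obtain n p where np: "P = (n, p)" by (cases P)
  have p: "\<And>i. i \<le> n \<Longrightarrow> p i \<in> {a..b}" using P by (auto simp: np partitions_def)
  have c: "continuous_on {a..b} (\<lambda>t. f (min t (p i)))" if "i \<le> n" for i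
    using p[OF that]
    by (intro continuous_on_compose2[OF cont]) (auto intro!: continuous_intros)
  have "continuous_on {a..b} (\<lambda>t. \<Sum>i<n. dist (f (min t (p i))) (f (min t (p (Suc i)))))"
    by (intro continuous_intros c) auto
  then show ?thesis by (simp add: truncated_length_def polygon_length_def np)
qed

text \<open>The variation is a uniform limit of truncated lengths.\<close>

lemma variation_continuous:
  assumes bv: "bounded_variation_on {a..b} f" and cont: "continuous_on {a..b} f" and ab: "a \<le> b"
  shows "continuous_on {a..b} (variation f a)"
proof -
  have "\<exists>P\<in>partitions a b. variation f a b - inverse (real (Suc k)) < polygon_length f P" for k
    unfolding variation_def
    using ab by (subst less_cSUP_iff[symmetric]) (auto intro!: bdd_variation[OF bv] partitions_nonempty)
  then obtain P where P: "\<And>k. P k \<in> partitions a b"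
      "\<And>k. variation f a b - inverse (real (Suc k)) < polygon_length f (P k)" by metis
  have tb: "truncated_length f (P k) b = polygon_length f (P k)" for k
  proof -
    obtain n p where np: "P k = (n, p)" by (cases "P k")
    have "min b (p i) = p i" if "i \<le> n" for i using P(1)[of k] that by (auto simp: np partitions_def)
    then show ?thesis by (auto simp: truncated_length_def polygon_length_def np intro!: sum.cong)
  qed
  have est: "dist (truncated_length f (P k) t) (variation f a t) < inverse (real (Suc k))"
    if "t \<in> {a..b}" for k t
  proof -
    have "truncated_length f (P k) t \<le> variation f a t"
      using that by (intro truncated_length_le[OF bv _ _ P(1)]) auto
    moreover have "truncated_length f (P k) b - truncated_length f (P k) t \<le> variation f a b - variation f a t"
      using that by (intro truncated_length_diff[OF bv _ _ _ P(1)]) auto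
    ultimately show ?thesis using P(2)[of k] tb[of k] by (simp add: dist_real_def)
  qed
  have "uniform_limit {a..b} (\<lambda>k. truncated_length f (P k)) (variation f a) sequentially"
  proof (rule uniform_limitI)
    fix e :: real assume "e > 0"
    then have "\<forall>\<^sub>F k in sequentially. inverse (real (Suc k)) < e"
      by (rule order_tendstoD(2)[OF LIMSEQ_inverse_real_of_nat])
    then show "\<forall>\<^sub>F k in sequentially. \<forall>t\<in>{a..b}. dist (truncated_length f (P k) t) (variation f a t) < e"
      by eventually_elim (use est in \<open>meson order_less_trans\<close>)
  qed
  then show ?thesis
    by (rule uniform_limit_theorem[rotated])
      (auto intro!: always_eventually truncated_length_continuous[OF cont P(1)])
qed

text \<open>The new parameter \<open>s t\<close> is \<open>t - a\<close> plus the variation up to \<open>t\<close>. The summand \<open>t - a\<close> makes \<open>s\<close>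
  a homeomorphism even where the function is constant.\<close>

lemma bv_lipschitz_factorization:
  fixes f :: "real \<Rightarrow> 'a::metric_space"
  assumes bv: "bounded_variation_on {a..b} f" and cont: "continuous_on {a..b} f" and ab: "a \<le> b"
  obtains s h where "continuous_on UNIV s" "\<And>u v. u \<le> v \<Longrightarrow> v - u \<le> s v - s u" "s a = 0"
    "1-lipschitz_on UNIV h" "\<And>t. t \<in> {a..b} \<Longrightarrow> f t = h (s t)"
proof -
  \<comment> \<open>The projection \<open>c\<close> onto the interval extends \<open>f\<close> and its variation to the whole line by constants.\<close>
  define c where "c t = max a (min b t)" for t
  have c: "c t \<in> {a..b}" for t using ab by (auto simp: c_def)
  have cmono: "c u \<le> c v" if "u \<le> v" for u v unfolding c_def using that by (intro max.mono min.mono) auto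
  have cid: "c t = t" if "t \<in> {a..b}" for t using that by (auto simp: c_def)
  define s where "s t = t - a + variation f a (c t)" for t
  have d: "dist (f (c u)) (f (c v)) \<le> variation f a (c v) - variation f a (c u)" if "u \<le> v" for u v
    using c cmono[OF that] by (intro dist_le_variation_diff[OF bv]) auto
  have conts: "continuous_on UNIV s"
    unfolding s_def c_def using ab
    by (intro continuous_intros continuous_on_compose2[OF variation_continuous[OF bv cont ab]]) auto
  have ex: "v - u \<le> s v - s u" if "u \<le> v" for u v
  proof -
    have "0 \<le> variation f a (c v) - variation f a (c u)" using d[OF that] by (rule order_trans[OF zero_le_dist])
    then show ?thesis by (simp add: s_def)
  qed
  note b = expanding_bij[OF conts ex]
  define h where "h y = f (c (inv s y))" for y
  have le: "dist (h x) (h y) \<le> y - x" if "x \<le> y" for x y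
  proof -
    have "inv s x \<le> inv s y" using b(2) that by (auto dest: monoD)
    from d[OF this] have "dist (h x) (h y) \<le> s (inv s y) - s (inv s x)"
      using \<open>inv s x \<le> inv s y\<close> by (simp add: h_def s_def)
    then show ?thesis using b(1) by (simp add: bij_is_surj surj_f_inv_f)
  qed
  have "1-lipschitz_on UNIV h"
  proof (rule lipschitz_onI)
    fix x y :: real
    show "dist (h x) (h y) \<le> 1 * dist x y"
      using le[of x y] le[of y x] by (cases "x \<le> y") (auto simp: dist_real_def dist_commute)
  qed simp
  moreover have "f t = h (s t)" if "t \<in> {a..b}" for t
    using b(1) that by (simp add: h_def bij_is_inj cid)
  moreover have "s a = 0" using cid[of a] ab by (simp add: s_def variation_self)
  ultimately show thesis using that[OF conts ex] by blast
qed

text \<open>The points of the open interval at which \<open>f\<close> is not differentiable.\<close>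

abbreviation nondiff :: "(real \<Rightarrow> 'a::real_normed_vector) \<Rightarrow> real \<Rightarrow> real \<Rightarrow> real set" where
  "nondiff f a b \<equiv> {t \<in> {a<..<b}. \<not> f differentiable (at t)}"

text \<open>Write \<open>f = h \<circ> s\<close> as above, with inverse \<open>k\<close> of \<open>s\<close>. Exceptional parameters lie in
  the \<open>k\<close>-image of the null set \<open>N\<close> where \<open>h\<close> or \<open>k\<close> is not differentiable, or of the set
  \<open>Z\<close> where \<open>k\<close> has arbitrarily small slopes; the latter image is null although \<open>Z\<close> need not be.\<close>

lemma bv_differentiable_ae:
  fixes f :: "real \<Rightarrow> 'a::euclidean_space"
  assumes bv: "bounded_variation_on {a..b} f" and cont: "continuous_on {a..b} f" and ab: "a \<le> b"
  shows "negligible (nondiff f a b)"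
proof -
  obtain s h where conts: "continuous_on UNIV s" and ex: "\<And>u v. u \<le> v \<Longrightarrow> v - u \<le> s v - s u"
    and lip: "1-lipschitz_on UNIV h" and fac: "\<And>t. t \<in> {a..b} \<Longrightarrow> f t = h (s t)"
    using bv_lipschitz_factorization[OF bv cont ab] by metis
  note b = expanding_bij[OF conts ex]
  define k where "k = inv s"
  have ks: "k (s x) = x" and sk: "s (k y) = y" for x y
    using b(1) by (simp_all add: k_def bij_is_inj bij_is_surj surj_f_inv_f)
  have lipk: "1-lipschitz_on UNIV k" and monok: "mono k" using b by (simp_all add: k_def)
  define N where "N = {y. \<not> h differentiable (at y)} \<union> {y. \<not> k differentiable (at y)}"
  define Z where "Z = (\<Inter>n. slope_below k (inverse (real (Suc n)))) \<inter> {s a..s b}"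
  have "negligible N" unfolding N_def
    using lipschitz_differentiable_ae[OF lip] lipschitz_differentiable_ae[OF lipk] by (rule negligible_Un)
  then have N: "negligible (k ` N)"
  proof (rule negligible_locally_Lipschitz_image[rotated])
    fix x
    show "\<exists>T B. open T \<and> x \<in> T \<and> (\<forall>y\<in>N \<inter> T. norm (k y - k x) \<le> B * norm (y - x))"
      using lipk by (intro exI[of _ UNIV] exI[of _ 1]) (auto simp: lipschitz_on_def dist_norm)
  qed simp
  have Zb: "Z \<in> sets borel" unfolding Z_def by measurable
  have img: "k ` X = s -` X" for X using ks sk by (auto simp: image_iff) metis
  have kZb: "k ` Z \<in> sets borel"
    using measurable_sets[OF borel_measurable_continuous_onI[OF conts] Zb] by (simp add: img)
  have "emeasure lborel Z \<le> emeasure lborel {s a..s b}" by (intro emeasure_mono) (auto simp: Z_def)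
  also have "\<dots> < \<infinity>" by (simp add: emeasure_lborel_Icc_eq)
  finally have fin: "emeasure lborel Z < \<infinity>" .
  have "Z \<subseteq> slope_below k (inverse (real (Suc n)))" for n unfolding Z_def by blast
  from emeasure_image_slope_below[OF sk ks monok conts lipk Zb this]
  have le: "emeasure lborel (k ` Z) \<le> ennreal (inverse (real (Suc n))) * emeasure lborel Z" for n
    by simp
  have lim: "(\<lambda>n. ennreal (inverse (real (Suc n))) * emeasure lborel Z) \<longlonglongrightarrow> ennreal 0 * emeasure lborel Z"
    using fin by (intro tendsto_mult_ennreal tendsto_ennrealI tendsto_const LIMSEQ_inverse_real_of_nat) auto
  have "emeasure lborel (k ` Z) \<le> ennreal 0 * emeasure lborel Z"
    by (rule LIMSEQ_le_const[OF lim]) (use le in blast)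
  then have Z0: "negligible (k ` Z)" using kZb by (simp add: negligible_iff_emeasure0)
  have "f differentiable (at t)" if t: "t \<in> {a<..<b}" "t \<notin> k ` N" "t \<notin> k ` Z" for t
  proof -
    define y where "y = s t"
    have ty: "t = k y" by (simp add: y_def ks)
    have y: "y \<notin> N" "y \<notin> Z" using t ty by auto
    have yab: "y \<in> {s a..s b}" using t ex[of a t] ex[of t b] by (auto simp: y_def)
    obtain D where D: "(k has_real_derivative D) (at y)"
      using y(1) by (auto simp: N_def real_differentiable_def)
    have "D \<noteq> 0"
    proof
      assume "D = 0"
      have "y \<in> slope_below k p" if p: "p > 0" for p
        unfolding slope_below_def
      proof (intro CollectI allI impI)
        fix d :: real assume d: "d > 0"
        have "(*) 0 = (\<lambda>h::real. 0)" by auto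
        then have "(k has_derivative (\<lambda>h. 0)) (at y)"
          using D \<open>D = 0\<close> by (simp add: has_field_derivative_def)
        then have "\<forall>e>0. \<exists>d>0. \<forall>z. norm (z - y) < d \<longrightarrow> norm (k z - k y - 0) \<le> e * norm (z - y)"
          unfolding has_derivative_at_alt by (rule conjunct2)
        from this[rule_format, of "p / 2"] p obtain \<delta> where \<delta>: "\<delta> > 0"
          "\<forall>z. norm (z - y) < \<delta> \<longrightarrow> norm (k z - k y - 0) \<le> p / 2 * norm (z - y)" by auto
        define e where "e = min \<delta> d / 4"
        have e: "0 < e" "e < \<delta>" "2 * e < d" using d \<delta>(1) by (auto simp: e_def min_def)
        have "\<bar>k (y + e) - k y\<bar> \<le> p / 2 * e" "\<bar>k (y - e) - k y\<bar> \<le> p / 2 * e"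
          using \<delta>(2)[rule_format, of "y + e"] \<delta>(2)[rule_format, of "y - e"] e by auto
        then have "k (y + e) - k (y - e) \<le> p * e" by linarith
        also have "\<dots> < p * (2 * e)" using p e(1) by (intro mult_strict_left_mono) auto
        also have "2 * e = (y + e) - (y - e)" by simp
        finally have "k (y + e) - k (y - e) < p * ((y + e) - (y - e))" .
        moreover have "y - e < y" "y < y + e" "(y + e) - (y - e) < d" using e by linarith+
        ultimately show "\<exists>u v. u < y \<and> y < v \<and> v - u < d \<and> k v - k u < p * (v - u)"
          by blast
      qed
      then have "y \<in> slope_below k (inverse (real (Suc n)))" for n by simp
      then have "y \<in> Z" using yab unfolding Z_def by blast
      then show False using y(2) by simp
    qed
    have "isCont s t" using conts by (simp add: continuous_on_eq_continuous_at)
    then have "(s has_real_derivative inverse D) (at t)"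
      using D \<open>D \<noteq> 0\<close> ks sk unfolding y_def
      by (intro DERIV_inverse_function[where f = k and g = s and a = "t - 1" and b = "t + 1"]) simp_all
    then have "s differentiable (at t)" by (auto simp: real_differentiable_def)
    moreover have "h differentiable (at (s t))" using y(1) by (simp add: N_def y_def)
    ultimately have "(h \<circ> s) differentiable (at t)" by (rule differentiable_chain_at)
    then obtain F where "((h \<circ> s) has_derivative F) (at t)" unfolding differentiable_def by blast
    then have "(f has_derivative F) (at t)"
      by (rule has_derivative_transform_within_open[where s = "{a<..<b}"]) (use t fac in auto)
    then show ?thesis by (rule differentiableI)
  qed
  then have "nondiff f a b \<subseteq> k ` N \<union> k ` Z"
    by (metis (mono_tags, lifting) UnI1 UnI2 mem_Collect_eq subsetI)
  then show ?thesis by (rule negligible_subset[OF negligible_Un[OF N Z0]])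
qed

section \<open>Absolute continuity\<close>

text \<open>The families of intervals that occur in the definition of absolute continuity.\<close>

definition nonoverlapping :: "real set \<Rightarrow> nat \<Rightarrow> (nat \<Rightarrow> real) \<Rightarrow> (nat \<Rightarrow> real) \<Rightarrow> bool" where
  "nonoverlapping I n a b \<longleftrightarrow> (\<forall>i<n. a i \<le> b i \<and> {a i..b i} \<subseteq> I) \<and>
    (\<forall>i<n. \<forall>j<n. i \<noteq> j \<longrightarrow> {a i<..<b i} \<inter> {a j<..<b j} = {})"

lemma nonoverlappingD:
  assumes "nonoverlapping I n a b" "i < n"
  shows "a i \<le> b i" "{a i..b i} \<subseteq> I" "a i \<in> I" "b i \<in> I"
proof -
  show *: "a i \<le> b i" "{a i..b i} \<subseteq> I" using assms by (simp_all add: nonoverlapping_def)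
  have "a i \<in> {a i..b i}" "b i \<in> {a i..b i}" using *(1) by simp_all
  then show "a i \<in> I" "b i \<in> I" using *(2) by blast+
qed

text \<open>The length \<open>r\<close> is a witness for \<open>e\<close> in the definition of absolute continuity.\<close>

definition ac_modulus :: "real set \<Rightarrow> (real \<Rightarrow> 'a::metric_space) \<Rightarrow> real \<Rightarrow> real \<Rightarrow> bool" where
  "ac_modulus I f e r \<longleftrightarrow> r > 0 \<and> (\<forall>n a b. nonoverlapping I n a b \<longrightarrow> (\<Sum>i<n. b i - a i) < r \<longrightarrow>
    (\<Sum>i<n. dist (f (a i)) (f (b i))) < e)"

lemma ac_modulusI:
  assumes "r > 0" "\<And>n a b. nonoverlapping I n a b \<Longrightarrow> (\<Sum>i<n. b i - a i) < r \<Longrightarrow>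
    (\<Sum>i<n. dist (f (a i)) (f (b i))) < e"
  shows "ac_modulus I f e r"
  using assms by (simp add: ac_modulus_def)

lemma ac_modulusD:
  assumes "ac_modulus I f e r"
  shows "r > 0" and "nonoverlapping I n a b \<Longrightarrow> (\<Sum>i<n. b i - a i) < r \<Longrightarrow>
    (\<Sum>i<n. dist (f (a i)) (f (b i))) < e"
  using assms unfolding ac_modulus_def by blast+

lemma abs_continuous_on_iff: "abs_continuous_on I f \<longleftrightarrow> (\<forall>e>0. \<exists>r. ac_modulus I f e r)"
  unfolding abs_continuous_on_def ac_modulus_def nonoverlapping_def by (simp only: imp_conjL)

lemma abs_continuous_onE:
  assumes "abs_continuous_on I f" "e > 0"
  obtains r where "ac_modulus I f e r"
  using assms unfolding abs_continuous_on_iff by blast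

lemma abs_continuous_onI:
  assumes "\<And>e. e > 0 \<Longrightarrow> \<exists>r. ac_modulus I f e r"
  shows "abs_continuous_on I f"
  using assms unfolding abs_continuous_on_iff by blast

lemma nonoverlapping_mono: "nonoverlapping J n a b \<Longrightarrow> J \<subseteq> I \<Longrightarrow> nonoverlapping I n a b"
  unfolding nonoverlapping_def by (meson subset_trans)

lemma abs_continuous_on_subset:
  assumes "abs_continuous_on I f" "J \<subseteq> I"
  shows "abs_continuous_on J f"
proof (rule abs_continuous_onI)
  fix e :: real assume "e > 0"
  with assms(1) obtain r where r: "ac_modulus I f e r" by (rule abs_continuous_onE)
  have "ac_modulus J f e r"
    by (rule ac_modulusI[OF ac_modulusD(1)[OF r] ac_modulusD(2)[OF r nonoverlapping_mono[OF _ assms(2)]]])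
  then show "\<exists>r. ac_modulus J f e r" by blast
qed

lemma abs_continuous_on_cong:
  assumes eq: "\<And>x. x \<in> I \<Longrightarrow> f x = h x" and ac: "abs_continuous_on I f"
  shows "abs_continuous_on I h"
proof (rule abs_continuous_onI)
  fix e :: real assume "0 < e"
  with ac obtain r where r: "ac_modulus I f e r" by (rule abs_continuous_onE)
  have "(\<Sum>i<n. dist (h (a i)) (h (b i))) = (\<Sum>i<n. dist (f (a i)) (f (b i)))"
    if "nonoverlapping I n a b" for n a b
    using nonoverlappingD[OF that] by (intro sum.cong) (auto simp: eq)
  then have "ac_modulus I h e r" using r by (simp add: ac_modulus_def)
  then show "\<exists>r. ac_modulus I h e r" by blast
qed

lemma lipschitz_imp_abs_continuous_on:
  assumes lip: "L-lipschitz_on I f"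
  shows "abs_continuous_on I f"
proof (rule abs_continuous_onI)
  fix e :: real assume e: "0 < e"
  have L: "L \<ge> 0" using lip by (rule lipschitz_on_nonneg)
  have "ac_modulus I f e (e / (L + 1))"
  proof (rule ac_modulusI)
    fix n a b assume no: "nonoverlapping I n a b" and small: "(\<Sum>i<n. b i - a i) < e / (L + 1)"
    have "(\<Sum>i<n. dist (f (a i)) (f (b i))) \<le> (\<Sum>i<n. L * (b i - a i))"
    proof (rule sum_mono)
      fix i assume "i \<in> {..<n}"
      then have "a i \<in> I" "b i \<in> I" "a i \<le> b i" using nonoverlappingD[OF no] by auto
      then show "dist (f (a i)) (f (b i)) \<le> L * (b i - a i)"
        using lipschitz_onD[OF lip, of "a i" "b i"] by (simp add: dist_real_def)
    qed
    also have "\<dots> = L * (\<Sum>i<n. b i - a i)" by (simp add: sum_distrib_left)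
    also have "\<dots> \<le> L * (e / (L + 1))" using small L by (intro mult_left_mono) auto
    also have "\<dots> < e" using L e by (simp add: field_simps)
    finally show "(\<Sum>i<n. dist (f (a i)) (f (b i))) < e" .
  qed (use L e in simp)
  then show "\<exists>r. ac_modulus I f e r" by blast
qed

lemma abs_continuous_on_affine:
  fixes f :: "real \<Rightarrow> 'a::metric_space"
  assumes ac: "abs_continuous_on {c..d} f" and m: "m \<noteq> 0"
    and maps: "\<And>t. t \<in> {u..v} \<Longrightarrow> m * t + q \<in> {c..d}"
  shows "abs_continuous_on {u..v} (\<lambda>t. f (m * t + q))"
proof (rule abs_continuous_onI)
  fix e :: real assume "0 < e"
  with ac obtain r where r: "ac_modulus {c..d} f e r" by (rule abs_continuous_onE)
  have "ac_modulus {u..v} (\<lambda>t. f (m * t + q)) e (r / \<bar>m\<bar>)"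
  proof (rule ac_modulusI)
    fix n a b assume no: "nonoverlapping {u..v} n a b" and small: "(\<Sum>i<n. b i - a i) < r / \<bar>m\<bar>"
    \<comment> \<open>An orientation-reversing map swaps the endpoints of each interval.\<close>
    define a' where "a' i = (if m > 0 then m * a i + q else m * b i + q)" for i
    define b' where "b' i = (if m > 0 then m * b i + q else m * a i + q)" for i
    have ab': "a' i \<le> b' i" "a' i \<in> {c..d}" "b' i \<in> {c..d}" if "i < n" for i
      using nonoverlappingD[OF no that] maps[of "a i"] maps[of "b i"] m
      by (auto simp: a'_def b'_def mult_left_mono_neg not_less)
    have len: "b' i - a' i = \<bar>m\<bar> * (b i - a i)" for i
      using m by (auto simp: a'_def b'_def algebra_simps)
    have mem: "(x - q) / m \<in> {a i<..<b i}" if "x \<in> {a' i<..<b' i}" for x i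
      using that m by (auto simp: a'_def b'_def field_simps split: if_splits)
    have "{a' i<..<b' i} \<inter> {a' j<..<b' j} = {}" if "i < n" "j < n" "i \<noteq> j" for i j
    proof -
      have "{a i<..<b i} \<inter> {a j<..<b j} = {}" using no that unfolding nonoverlapping_def by blast
      then show ?thesis using mem[of _ i] mem[of _ j] by blast
    qed
    moreover have "a' i \<le> b' i \<and> {a' i..b' i} \<subseteq> {c..d}" if "i < n" for i
      using ab'[OF that] by simp
    ultimately have "nonoverlapping {c..d} n a' b'" unfolding nonoverlapping_def by blast
    moreover have "(\<Sum>i<n. b' i - a' i) < r"
    proof -
      have "(\<Sum>i<n. b' i - a' i) = \<bar>m\<bar> * (\<Sum>i<n. b i - a i)" by (simp add: len sum_distrib_left)
      also have "\<dots> < \<bar>m\<bar> * (r / \<bar>m\<bar>)" using small m by (intro mult_strict_left_mono) auto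
      finally show ?thesis using m by simp
    qed
    ultimately have "(\<Sum>i<n. dist (f (a' i)) (f (b' i))) < e" by (rule ac_modulusD(2)[OF r])
    moreover have "(\<Sum>i<n. dist (f (m * a i + q)) (f (m * b i + q))) = (\<Sum>i<n. dist (f (a' i)) (f (b' i)))"
      by (rule sum.cong) (auto simp: a'_def b'_def dist_commute)
    ultimately show "(\<Sum>i<n. dist (f (m * a i + q)) (f (m * b i + q))) < e" by simp
  qed (use ac_modulusD(1)[OF r] m in simp)
  then show "\<exists>r. ac_modulus {u..v} (\<lambda>t. f (m * t + q)) e r" by blast
qed

lemma abs_continuous_on_locally_bv:
  assumes "abs_continuous_on {a..b} f"
  obtains d where "d > 0" "\<And>u v. a \<le> u \<Longrightarrow> v \<le> b \<Longrightarrow> v - u < d \<Longrightarrow> bounded_variation_on {u..v} f"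
proof -
  from assms zero_less_one obtain r where mod: "ac_modulus {a..b} f 1 r" by (rule abs_continuous_onE)
  note r = ac_modulusD[OF mod]
  have "bounded_variation_on {u..v} f" if uv: "a \<le> u" "v \<le> b" "v - u < r" for u v
    unfolding bounded_variation_on_def
  proof (intro exI[of _ 1] allI impI)
    fix n :: nat and t :: "nat \<Rightarrow> real"
    assume t: "(\<forall>i\<le>n. t i \<in> {u..v}) \<and> (\<forall>i<n. t i \<le> t (Suc i))"
    have mono: "t i \<le> t j" if "i \<le> j" "j \<le> n" for i j
      using that by (induction j rule: dec_induct) (use t in \<open>auto intro: order_trans\<close>)
    have "(\<Sum>i<n. dist (f (t i)) (f (t (Suc i)))) < 1"
    proof (rule r(2))
      have "t i \<le> t (Suc i) \<and> {t i..t (Suc i)} \<subseteq> {a..b}" if "i < n" for i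
      proof -
        have "t i \<in> {u..v}" "t (Suc i) \<in> {u..v}" "t i \<le> t (Suc i)" using t that by auto
        then show ?thesis using uv by auto
      qed
      moreover have *: "{t i<..<t (Suc i)} \<inter> {t j<..<t (Suc j)} = {}" if "i < j" "j < n" for i j
        using mono[of "Suc i" j] that by auto
      have "{t i<..<t (Suc i)} \<inter> {t j<..<t (Suc j)} = {}" if "i < n" "j < n" "i \<noteq> j" for i j
        using *[of i j] *[of j i] that by (cases "i < j") (auto simp: Int_commute)
      ultimately show "nonoverlapping {a..b} n t (\<lambda>i. t (Suc i))" unfolding nonoverlapping_def by blast
      have "(\<Sum>i<n. t (Suc i) - t i) = t n - t 0" by (rule sum_lessThan_telescope)
      also have "\<dots> < r"
      proof -
        have "t n \<in> {u..v}" "t 0 \<in> {u..v}" using t by auto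
        then show ?thesis using uv(3) by auto
      qed
      finally show "(\<Sum>i<n. t (Suc i) - t i) < r" .
    qed
    then show "(\<Sum>i<n. dist (f (t i)) (f (t (Suc i)))) \<le> 1" by simp
  qed
  then show thesis using that r(1) by blast
qed

lemma negligible_real_locally:
  fixes S :: "real set"
  assumes "\<And>x. x \<in> S \<Longrightarrow> \<exists>e>0. negligible (S \<inter> {x - e<..<x + e})"
  shows "negligible S"
  unfolding locally_negligible_alt[of S]
proof
  fix x assume x: "x \<in> S"
  then obtain e where e: "e > 0" "negligible (S \<inter> {x - e<..<x + e})" using assms by blast
  then show "\<exists>U. openin (top_of_set S) U \<and> x \<in> U \<and> negligible U"
    using x by (intro exI[of _ "S \<inter> {x - e<..<x + e}"]) (auto intro: openin_open_Int)
qed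

lemma abs_continuous_on_differentiable_ae:
  fixes f :: "real \<Rightarrow> 'a::euclidean_space"
  assumes ac: "abs_continuous_on {a..b} f" and cont: "continuous_on {a..b} f"
  shows "negligible (nondiff f a b)"
proof (rule negligible_real_locally)
  fix x assume x: "x \<in> nondiff f a b"
  obtain d where d: "d > 0" "\<And>u v. a \<le> u \<Longrightarrow> v \<le> b \<Longrightarrow> v - u < d \<Longrightarrow> bounded_variation_on {u..v} f"
    by (rule abs_continuous_on_locally_bv[OF ac]) blast
  define u v where "u = max a (x - d/3)" and "v = min b (x + d/3)"
  have uv: "a \<le> u" "v \<le> b" "v - u < d" "u \<le> v" using d(1) x by (auto simp: u_def v_def)
  have "negligible (nondiff f u v)"
    using uv by (intro bv_differentiable_ae d continuous_on_subset[OF cont]) auto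
  moreover have "nondiff f a b \<inter> {x - d/3<..<x + d/3} \<subseteq>
      nondiff f u v" by (auto simp: u_def v_def)
  ultimately have "negligible (nondiff f a b \<inter> {x - d/3<..<x + d/3})"
    by (rule negligible_subset)
  then show "\<exists>e>0. negligible (nondiff f a b \<inter> {x - e<..<x + e})"
    using d(1) by (intro exI[of _ "d/3"]) auto
qed

lemma C_tilde_continuous: "f \<in> C_tilde D \<Longrightarrow> continuous_on {0..1} f"
  by (auto simp: C_tilde_def path_funs_def)

lemma C_tilde_image: "f \<in> C_tilde D \<Longrightarrow> f ` {0..1} \<subseteq> D"
  by (auto simp: C_tilde_def path_funs_def)

lemma C_tilde_interval_abs_continuous:
  assumes "f \<in> C_tilde D"
  obtains F where "finite F"
    "\<And>t. t \<in> {0..1} - F \<Longrightarrow> \<exists>e>0. abs_continuous_on {max 0 (t - e)..min 1 (t + e)} f"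
proof -
  have eq: "{0..1} \<inter> {t - e..t + e} = {max 0 (t - e)..min 1 (t + e)}" for t e :: real by auto
  obtain F where "finite F" "\<forall>t\<in>{0..1} - F. \<exists>e>0. abs_continuous_on ({0..1} \<inter> {t - e..t + e}) f"
    using assms unfolding C_tilde_def by blast
  then show thesis using that unfolding eq by blast
qed

lemma C_tilde_differentiable_ae:
  fixes f :: "real \<Rightarrow> 'a::euclidean_space"
  assumes "f \<in> C_tilde D"
  shows "negligible (nondiff f 0 1)"
proof -
  obtain F where F: "finite F"
    "\<And>t. t \<in> {0..1} - F \<Longrightarrow> \<exists>e>0. abs_continuous_on {max 0 (t - e)..min 1 (t + e)} f"
    using C_tilde_interval_abs_continuous[OF assms] by blast
  note cont = C_tilde_continuous[OF assms]
  have "negligible (nondiff f 0 1 - F)" (is "negligible ?S")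
  proof (rule negligible_real_locally)
    fix x assume x: "x \<in> ?S"
    then obtain e where e: "e > 0" "abs_continuous_on {max 0 (x - e)..min 1 (x + e)} f" using F(2)[of x] by auto
    have "negligible (nondiff f (max 0 (x - e)) (min 1 (x + e)))"
      by (rule abs_continuous_on_differentiable_ae[OF e(2)]) (rule continuous_on_subset[OF cont], auto)
    moreover have "?S \<inter> {x - e<..<x + e} \<subseteq> nondiff f (max 0 (x - e)) (min 1 (x + e))"
      by auto
    ultimately have "negligible (?S \<inter> {x - e<..<x + e})" by (rule negligible_subset)
    then show "\<exists>e>0. negligible (?S \<inter> {x - e<..<x + e})" using e(1) by blast
  qed
  then have "negligible (?S \<union> F)" using negligible_finite[OF F(1)] by (rule negligible_Un)
  then show ?thesis by (rule negligible_subset) auto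
qed

text \<open>The derivative of an absolutely continuous function is Henstock-Kurzweil integrable, with the
  expected integral. Absolute continuity controls the intervals of a tagged division whose tag lies in
  the exceptional null set \<open>N\<close>: the gauge keeps these intervals inside an open set \<open>U\<close> of small measure.\<close>

lemma abs_continuous_on_has_integral:
  fixes f :: "real \<Rightarrow> 'a::euclidean_space"
  assumes ac: "abs_continuous_on {a..b} f" and ab: "a \<le> b"
    and N: "negligible N" and der: "\<And>t. t \<in> {a<..<b} - N \<Longrightarrow> (f has_vector_derivative f' t) (at t)"
    and endpoints: "a \<in> N" "b \<in> N"
  shows "((\<lambda>t. if t \<in> N then 0 else f' t) has_integral (f b - f a)) {a..b}"
  unfolding has_integral_real
proof (intro allI impI)
  fix e :: real assume e: "e > 0"
  let ?f = "\<lambda>t. if t \<in> N then 0 else f' t"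
  from ac half_gt_zero[OF e] obtain r where mod: "ac_modulus {a..b} f (e / 2) r" by (rule abs_continuous_onE)
  note r = ac_modulusD[OF mod]
  have Nn: "N \<in> null_sets lebesgue" using N by (simp add: negligible_iff_null_sets)
  then have "N \<in> sets lebesgue" by (rule null_setsD2)
  then obtain U where U: "open U" "N \<subseteq> U" "(U - N) \<in> lmeasurable" "emeasure lebesgue (U - N) < ennreal r"
    by (rule sets_lebesgue_outer_open[OF _ r(1)])
  have "emeasure lebesgue U \<le> emeasure lebesgue (U - N) + emeasure lebesgue N"
    using U Nn by (intro order_trans[OF emeasure_mono emeasure_subadditive]) auto
  also have "\<dots> = emeasure lebesgue (U - N)" using Nn by (simp add: null_setsD1)
  finally have Um: "emeasure lborel U < ennreal r" using U(1,4) by simp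
  define e' where "e' = e / (2 * (b - a) + 2)"
  have e': "e' > 0" "e' * (b - a) < e / 2" using e ab by (auto simp: e'_def field_simps)
  have "\<exists>r>0. ball x r \<subseteq> U" if "x \<in> N" for x
    using U that openE by (metis subsetD)
  then obtain r1 where r1: "\<And>x. x \<in> N \<Longrightarrow> r1 x > 0" "\<And>x. x \<in> N \<Longrightarrow> ball x (r1 x) \<subseteq> U" by metis
  have "\<exists>r>0. \<forall>y. norm (y - x) < r \<longrightarrow> norm (f y - f x - (y - x) *\<^sub>R f' x) \<le> e' * norm (y - x)"
    if "x \<in> {a<..<b} - N" for x
    using der[OF that] e'(1) unfolding has_vector_derivative_def has_derivative_at_alt by blast
  then obtain r2 where r2: "\<And>x. x \<in> {a<..<b} - N \<Longrightarrow> r2 x > 0"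
    "\<And>x y. x \<in> {a<..<b} - N \<Longrightarrow> norm (y - x) < r2 x \<Longrightarrow> norm (f y - f x - (y - x) *\<^sub>R f' x) \<le> e' * norm (y - x)"
    by metis
  define \<gamma> where "\<gamma> x = ball x (if x \<in> N then r1 x else if x \<in> {a<..<b} then r2 x else 1)" for x
  have gauge: "gauge \<gamma>" unfolding gauge_def \<gamma>_def using r1 r2 by auto
  have "norm ((\<Sum>(x, k)\<in>p. measure lborel k *\<^sub>R ?f x) - (f b - f a)) < e"
    if p: "p tagged_division_of {a..b}" and fine: "\<gamma> fine p" for p
  proof -
    note tp = tagged_division_ofD[OF p]
    have fin: "finite p" by (rule tp(1))
    have K: "\<exists>c d. K = {c..d} \<and> c \<le> x \<and> x \<le> d \<and> a \<le> c \<and> d \<le> b" if xK: "(x, K) \<in> p" for x K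
    proof -
      obtain c d where "K = {c..d}" using tp(4)[OF xK] by (auto simp: box_real)
      moreover have "x \<in> K" "K \<subseteq> {a..b}" using tp(2,3)[OF xK] by auto
      ultimately show ?thesis by auto
    qed
    define h where "h = (\<lambda>(x, K). measure lborel K *\<^sub>R ?f x - (f (Sup K) - f (Inf K)))"
    define pN where "pN = {q \<in> p. fst q \<in> N}"
    have "(\<Sum>(x, k)\<in>p. measure lborel k *\<^sub>R ?f x) - (f b - f a) = sum h p"
      unfolding h_def additive_tagged_division_1[OF ab p, of f, symmetric]
      by (simp add: sum_subtractf[symmetric] case_prod_unfold)
    also have "norm \<dots> \<le> (\<Sum>q\<in>p. norm (h q))" by (rule norm_sum)
    also have "\<dots> = (\<Sum>q\<in>p - pN. norm (h q)) + (\<Sum>q\<in>pN. norm (h q))"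
      using fin by (intro sum.subset_diff) (auto simp: pN_def)
    also have "(\<Sum>q\<in>p - pN. norm (h q)) \<le> e' * (b - a)"
    proof -
      have "norm (h q) \<le> e' * measure lborel (snd q)" if "q \<in> p - pN" for q
      proof -
        obtain x K where q: "q = (x, K)" by (cases q)
        then have xK: "(x, K) \<in> p" "x \<notin> N" using that by (auto simp: pN_def)
        obtain c d where cd: "K = {c..d}" "c \<le> x" "x \<le> d" "a \<le> c" "d \<le> b" using K[OF xK(1)] by blast
        have "x \<noteq> a" "x \<noteq> b" using endpoints xK(2) by auto
        then have x: "x \<in> {a<..<b} - N" using xK(2) cd by auto
        have "K \<subseteq> \<gamma> x" using fine xK(1) by (auto simp: fine_def)
        moreover have "c \<in> K" "d \<in> K" using cd by auto
        ultimately have "c \<in> \<gamma> x" "d \<in> \<gamma> x" by auto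
        then have "norm (c - x) < r2 x" "norm (d - x) < r2 x" using x by (auto simp: \<gamma>_def dist_norm norm_minus_commute)
        then have 1: "norm (f d - f x - (d - x) *\<^sub>R f' x) \<le> e' * (d - x)" "norm (f c - f x - (c - x) *\<^sub>R f' x) \<le> e' * (x - c)"
          using r2(2)[OF x, of d] r2(2)[OF x, of c] cd by auto
        have "h q = (f c - f x - (c - x) *\<^sub>R f' x) - (f d - f x - (d - x) *\<^sub>R f' x)"
          using cd xK by (simp add: h_def q algebra_simps)
        then have "norm (h q) \<le> e' * (x - c) + e' * (d - x)" using 1 by (metis add_mono norm_triangle_le_diff)
        also have "\<dots> = e' * measure lborel K" using cd by (simp add: algebra_simps)
        finally show ?thesis by (simp add: q)
      qed
      then have "(\<Sum>q\<in>p - pN. norm (h q)) \<le> (\<Sum>q\<in>p - pN. e' * measure lborel (snd q))" by (rule sum_mono)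
      also have "\<dots> \<le> (\<Sum>q\<in>p. e' * measure lborel (snd q))"
        using e'(1) fin by (intro sum_mono2) auto
      also have "\<dots> = e' * (\<Sum>(x, K)\<in>p. measure lborel K)" by (simp add: sum_distrib_left case_prod_unfold)
      also have "\<dots> = e' * (b - a)"
        using additive_content_tagged_division[of p a b] p ab by simp
      finally show ?thesis .
    qed
    also have "(\<Sum>q\<in>pN. norm (h q)) < e / 2"
    proof -
      have finN: "finite pN" using fin by (simp add: pN_def)
      then obtain g where g: "bij_betw g {0..<card pN} pN" using ex_bij_betw_nat_finite by blast
      let ?n = "card pN"
      have gp: "g i \<in> pN" if "i < ?n" for i using g that by (auto simp: bij_betw_def)
      define l u where "l i = Inf (snd (g i))" and "u i = Sup (snd (g i))" for i
      have gK: "snd (g i) = {l i..u i}" "l i \<le> u i" "a \<le> l i" "u i \<le> b" "{l i<..<u i} \<subseteq> U" if "i < ?n" for i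
      proof -
        obtain x K where q: "g i = (x, K)" by (cases "g i")
        then have xK: "(x, K) \<in> p" "x \<in> N" using gp[OF that] by (auto simp: pN_def)
        obtain c d where cd: "K = {c..d}" "c \<le> x" "x \<le> d" "a \<le> c" "d \<le> b" using K[OF xK(1)] by blast
        then have lu: "l i = c" "u i = d" by (auto simp: l_def u_def q)
        have "K \<subseteq> \<gamma> x" using fine xK(1) by (auto simp: fine_def)
        then have "K \<subseteq> U" using r1(2)[OF xK(2)] xK(2) by (auto simp: \<gamma>_def)
        then show "snd (g i) = {l i..u i}" "l i \<le> u i" "a \<le> l i" "u i \<le> b" "{l i<..<u i} \<subseteq> U"
          using cd lu q by auto
      qed
      have disj: "{l i<..<u i} \<inter> {l j<..<u j} = {}" if "i < ?n" "j < ?n" "i \<noteq> j" for i j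
      proof -
        have "g i \<noteq> g j" using g that by (auto simp: bij_betw_def inj_on_def)
        moreover have "g i \<in> p" "g j \<in> p" using gp that by (auto simp: pN_def)
        ultimately have "interior (snd (g i)) \<inter> interior (snd (g j)) = {}"
          using tp(5)[of "fst (g i)" "snd (g i)" "fst (g j)" "snd (g j)"] by (auto simp: prod_eq_iff)
        then show ?thesis using gK(1) that by simp
      qed
      have "ennreal (\<Sum>i<?n. u i - l i) = (\<Sum>i<?n. emeasure lborel {l i<..<u i})"
        using gK(2) by (subst sum_ennreal[symmetric]) (auto intro!: sum.cong)
      also have "\<dots> = emeasure lborel (\<Union>i<?n. {l i<..<u i})"
        using disj by (intro sum_emeasure) (auto simp: disjoint_family_on_def)
      also have "\<dots> \<le> emeasure lborel U" using gK(5) U(1) by (intro emeasure_mono) auto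
      finally have "ennreal (\<Sum>i<?n. u i - l i) < ennreal r" using Um by (rule le_less_trans)
      then have small: "(\<Sum>i<?n. u i - l i) < r"
        using ennreal_leI by (meson linorder_not_le)
      have "(\<Sum>i<?n. dist (f (l i)) (f (u i))) < e / 2"
      proof (rule r(2)[OF _ small])
        have "l i \<le> u i \<and> {l i..u i} \<subseteq> {a..b}" if "i < ?n" for i using gK(2-4)[OF that] by simp
        then show "nonoverlapping {a..b} ?n l u" unfolding nonoverlapping_def using disj by blast
      qed
      moreover have "(\<Sum>q\<in>pN. norm (h q)) = (\<Sum>i\<in>{0..<?n}. norm (h (g i)))"
        using sum.reindex_bij_betw[OF g, of "\<lambda>q. norm (h q)"] by simp
      moreover have "norm (h (g i)) = dist (f (l i)) (f (u i))" if "i < ?n" for i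
      proof -
        have "fst (g i) \<in> N" using gp[OF that] by (simp add: pN_def)
        then show ?thesis by (simp add: h_def case_prod_unfold l_def u_def dist_norm norm_minus_commute)
      qed
      ultimately show ?thesis by (simp add: atLeast0LessThan)
    qed
    finally show ?thesis using e'(2) by simp
  qed
  then show "\<exists>\<gamma>. gauge \<gamma> \<and> (\<forall>\<D>. \<D> tagged_division_of {a..b} \<and> \<gamma> fine \<D> \<longrightarrow>
      norm ((\<Sum>(x, k)\<in>\<D>. measure lborel k *\<^sub>R ?f x) - (f b - f a)) < e)"
    using gauge by blast
qed

section \<open>Action integrals\<close>

lemma negligible_imp_AE: "negligible N \<Longrightarrow> AE x in lebesgue. x \<notin> N"
  by (simp add: AE_not_in negligible_iff_null_sets)

lemma lebesgue_measurable_spike: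
  fixes f g :: "real \<Rightarrow> 'b::topological_space"
  assumes g: "g \<in> borel_measurable lebesgue" and N: "negligible N" and eq: "\<And>x. x \<notin> N \<Longrightarrow> f x = g x"
  shows "f \<in> borel_measurable lebesgue"
proof (rule measurableI)
  fix A :: "'b set" assume A: "A \<in> sets borel"
  have 1: "g -` A \<in> sets lebesgue" using measurable_sets[OF g A] by simp
  have 2: "N \<in> sets lebesgue" using N negligible_imp_measurable by blast
  have 3: "f -` A \<inter> N \<in> sets lebesgue"
    using negligible_subset[OF N, of "f -` A \<inter> N"] negligible_imp_measurable by blast
  have "f -` A = (g -` A - N) \<union> (f -` A \<inter> N)" using eq by auto
  also have "\<dots> \<in> sets lebesgue" using 1 2 3 by blast
  finally show "f -` A \<inter> space lebesgue \<in> sets lebesgue" by simp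
qed simp

text \<open>If the integral on the right is infinite, there is nothing to show; otherwise the derivative
  is Lebesgue integrable and the norm of its integral is bounded by the integral of its norm.\<close>

lemma abs_continuous_on_dist_le:
  fixes f :: "real \<Rightarrow> 'a::euclidean_space"
  assumes ac: "abs_continuous_on {a..b} f" and cont: "continuous_on {a..b} f" and ab: "a \<le> b"
  shows "ennreal (dist (f a) (f b)) \<le> (\<integral>\<^sup>+t\<in>{a..b}. ennreal (norm (vector_derivative f (at t))) \<partial>lebesgue)"
proof -
  define N where "N = nondiff f a b \<union> {a, b}"
  have N: "negligible N" unfolding N_def
    by (intro negligible_Un abs_continuous_on_differentiable_ae[OF ac cont] negligible_finite) simp
  define H where "H t = indicator {a..b} t *\<^sub>R (if t \<in> N then 0 else vector_derivative f (at t))" for t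
  have int: "((\<lambda>t. if t \<in> N then 0 else vector_derivative f (at t)) has_integral (f b - f a)) {a..b}"
  proof (rule abs_continuous_on_has_integral[OF ac ab N])
    fix t assume "t \<in> {a<..<b} - N"
    then have "f differentiable (at t)" by (auto simp: N_def)
    then show "(f has_vector_derivative vector_derivative f (at t)) (at t)"
      by (simp add: vector_derivative_works)
  qed (auto simp: N_def)
  have meas: "H \<in> borel_measurable lebesgue"
    unfolding H_def by (rule has_integral_implies_lebesgue_measurable[OF int])
  have eq: "(\<integral>\<^sup>+t. ennreal (norm (H t)) \<partial>lebesgue) =
      (\<integral>\<^sup>+t\<in>{a..b}. ennreal (norm (vector_derivative f (at t))) \<partial>lebesgue)"
    by (rule nn_integral_cong_AE)
      (use negligible_imp_AE[OF N] in \<open>eventually_elim, auto simp: H_def indicator_def\<close>)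
  show ?thesis
  proof (cases "(\<integral>\<^sup>+t. ennreal (norm (H t)) \<partial>lebesgue) = \<infinity>")
    case True
    then show ?thesis using eq by simp
  next
    case False
    then have "(\<integral>\<^sup>+t. ennreal (norm (H t)) \<partial>lebesgue) < \<infinity>" by (simp add: less_top)
    then have iH: "integrable lebesgue H" using meas by (intro integrableI_bounded)
    then have "set_integrable lebesgue {a..b} (\<lambda>t. if t \<in> N then 0 else vector_derivative f (at t))"
      by (simp add: set_integrable_def H_def[abs_def])
    from has_integral_set_lebesgue[OF this] int
    have "(LINT t:{a..b}|lebesgue. if t \<in> N then 0 else vector_derivative f (at t)) = f b - f a"
      by (rule has_integral_unique)
    then have "integral\<^sup>L lebesgue H = f b - f a"
      by (simp add: set_lebesgue_integral_def H_def[abs_def])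
    then have "ennreal (dist (f a) (f b)) = ennreal (norm (integral\<^sup>L lebesgue H))"
      by (simp add: dist_norm norm_minus_commute)
    also have "\<dots> \<le> (\<integral>\<^sup>+t. ennreal (norm (H t)) \<partial>lebesgue)"
      by (rule integral_norm_bound_ennreal[OF iH])
    finally show ?thesis using eq by simp
  qed
qed

lemma vector_derivative_cong_open:
  fixes f h :: "real \<Rightarrow> 'a::real_normed_vector"
  assumes "open S" "t \<in> S" "\<And>x. x \<in> S \<Longrightarrow> f x = h x"
  shows "vector_derivative f (at t) = vector_derivative h (at t)"
  using assms by (intro vector_derivative_cong_eq) (auto simp: eventually_nhds)

lemma vector_derivative_lim:
  fixes f :: "real \<Rightarrow> 'a::real_normed_vector"
  assumes "f differentiable (at t)"
  shows "(\<lambda>n. real (Suc n) *\<^sub>R (f (t + inverse (real (Suc n))) - f t)) \<longlonglongrightarrow> vector_derivative f (at t)"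
proof -
  let ?D = "vector_derivative f (at t)" and ?h = "\<lambda>n. inverse (real (Suc n))"
  have "(f has_derivative (\<lambda>x. x *\<^sub>R ?D)) (at t)"
    using assms by (simp add: vector_derivative_works has_vector_derivative_def)
  then have lim: "((\<lambda>h. norm (f (t + h) - f t - h *\<^sub>R ?D) / norm h) \<longlongrightarrow> 0) (at 0)"
    unfolding has_derivative_at by blast
  have "filterlim ?h (at 0) sequentially"
    by (intro filterlim_atI LIMSEQ_inverse_real_of_nat) simp
  from filterlim_compose[OF lim this]
  have "(\<lambda>n. norm (f (t + ?h n) - f t - ?h n *\<^sub>R ?D) / norm (?h n)) \<longlonglongrightarrow> 0" .
  moreover have "norm (f (t + ?h n) - f t - ?h n *\<^sub>R ?D) / norm (?h n) =
      norm (real (Suc n) *\<^sub>R (f (t + ?h n) - f t) - ?D)" for n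
  proof -
    have "real (Suc n) *\<^sub>R (f (t + ?h n) - f t) - ?D = real (Suc n) *\<^sub>R (f (t + ?h n) - f t - ?h n *\<^sub>R ?D)"
      by (simp add: scaleR_diff_right)
    then have "norm (real (Suc n) *\<^sub>R (f (t + ?h n) - f t) - ?D) = real (Suc n) * norm (f (t + ?h n) - f t - ?h n *\<^sub>R ?D)"
      by simp
    then show ?thesis by (simp add: divide_inverse mult.commute)
  qed
  ultimately have "(\<lambda>n. norm (real (Suc n) *\<^sub>R (f (t + ?h n) - f t) - ?D)) \<longlonglongrightarrow> 0" by simp
  then show ?thesis by (simp add: tendsto_norm_zero_iff LIM_zero_iff)
qed

text \<open>Almost everywhere the derivative is a limit of difference quotients. The values of \<open>f\<close>
  outside of \<open>{0..1}\<close> are arbitrary, so \<open>f\<close> is first extended by constants.\<close>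

lemma C_tilde_derivative_measurable:
  fixes f :: "real \<Rightarrow> 'a::euclidean_space"
  assumes "f \<in> C_tilde D"
  shows "(\<lambda>t. indicator {0..1} t *\<^sub>R vector_derivative f (at t)) \<in> borel_measurable lebesgue"
proof -
  define h where "h t = f (max 0 (min 1 t))" for t
  have "continuous_on UNIV h" unfolding h_def
    by (intro continuous_on_compose2[OF C_tilde_continuous[OF assms]] continuous_intros) auto
  then have [measurable]: "h \<in> borel_measurable borel" by (rule borel_measurable_continuous_onI)
  define G where "G t = indicator {0..1} t *\<^sub>R lim (\<lambda>n. real (Suc n) *\<^sub>R (h (t + inverse (real (Suc n))) - h t))" for t
  have "G \<in> borel_measurable borel" unfolding G_def by measurable
  then have G: "G \<in> borel_measurable lebesgue" by (simp add: measurable_completion)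
  let ?N = "nondiff f 0 1 \<union> {0, 1}"
  have N: "negligible ?N"
    by (intro negligible_Un C_tilde_differentiable_ae[OF assms] negligible_finite) simp
  show ?thesis
  proof (rule lebesgue_measurable_spike[OF G N])
    fix t assume t: "t \<notin> ?N"
    show "indicator {0..1} t *\<^sub>R vector_derivative f (at t) = G t"
    proof (cases "t \<in> {0..1}")
      case True
      then have t01: "t \<in> {0<..<1}" and diff: "f differentiable (at t)" using t by auto
      have eq: "f x = h x" if "x \<in> {0<..<1}" for x using that by (simp add: h_def)
      obtain F where F: "(f has_derivative F) (at t)" using diff by (auto simp: differentiable_def)
      have "(h has_derivative F) (at t)"
        using F t01 eq by (rule has_derivative_transform_within_open[OF _ open_greaterThanLessThan])
      then have "h differentiable (at t)" by (auto simp: differentiable_def)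
      from limI[OF vector_derivative_lim[OF this]]
      have "lim (\<lambda>n. real (Suc n) *\<^sub>R (h (t + inverse (real (Suc n))) - h t)) = vector_derivative h (at t)" .
      also have "\<dots> = vector_derivative f (at t)"
        using t01 eq by (intro vector_derivative_cong_open[of "{0<..<1}"]) auto
      finally show ?thesis by (simp add: G_def)
    qed (simp add: G_def)
  qed
qed

text \<open>The action of the restriction of a path to \<open>{a..b}\<close>, for the integrand \<open>l\<close>.
  The integrand \<open>\<lambda>x y. norm y\<close> gives the length.\<close>

definition action ::
    "('a::euclidean_space \<Rightarrow> 'a \<Rightarrow> real) \<Rightarrow> (real \<Rightarrow> 'a) \<Rightarrow> real \<Rightarrow> real \<Rightarrow> ennreal" where
  "action l f a b = (\<integral>\<^sup>+t\<in>{a..b}. ennreal (l (f t) (vector_derivative f (at t))) \<partial>lebesgue)"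

lemma action_cong:
  assumes "\<And>t. t \<in> {a..b} \<Longrightarrow> f t = h t"
  shows "action l f a b = action l h a b"
  unfolding action_def
proof (rule nn_integral_cong_AE)
  have "AE t in lebesgue. t \<notin> {a, b}" by (intro negligible_imp_AE negligible_finite) simp
  then show "AE t in lebesgue. ennreal (l (f t) (vector_derivative f (at t))) * indicator {a..b} t =
      ennreal (l (h t) (vector_derivative h (at t))) * indicator {a..b} t"
  proof eventually_elim
    case (elim t)
    show ?case
    proof (cases "t \<in> {a..b}")
      case True
      then have "t \<in> {a<..<b}" using elim by auto
      then have "vector_derivative f (at t) = vector_derivative h (at t)"
        using assms by (intro vector_derivative_cong_open[of "{a<..<b}"]) auto
      then show ?thesis using assms True by simp
    qed simp
  qed
qed

lemma action_integrand_measurable: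
  fixes f :: "real \<Rightarrow> 'a::euclidean_space"
  assumes f: "f \<in> C_tilde D" and l: "continuous_on (D \<times> UNIV) (\<lambda>(x, y). l x y)"
    and ab: "{a..b} \<subseteq> {0..1}"
  shows "(\<lambda>t. ennreal (l (f t) (vector_derivative f (at t))) * indicator {a..b} t) \<in> borel_measurable lebesgue"
proof -
  define h where "h t = f (max 0 (min 1 t))" for t
  have c: "continuous_on UNIV h" unfolding h_def
    by (intro continuous_on_compose2[OF C_tilde_continuous[OF f]] continuous_intros) auto
  then have "h \<in> borel_measurable lborel" using borel_measurable_continuous_onI by simp
  then have hm: "h \<in> borel_measurable lebesgue" by (rule measurable_completion)
  let ?V = "\<lambda>t. indicator {0..1} t *\<^sub>R vector_derivative f (at t)"
  have "h t \<in> D" for t using C_tilde_image[OF f] by (auto simp: h_def)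
  moreover have "(\<lambda>t. (h t, ?V t)) \<in> borel_measurable lebesgue"
    using hm C_tilde_derivative_measurable[OF f] by (rule borel_measurable_Pair)
  ultimately have "(\<lambda>t. (h t, ?V t)) \<in> lebesgue \<rightarrow>\<^sub>M restrict_space borel (D \<times> UNIV)"
    by (intro measurable_restrict_space2) auto
  from measurable_compose[OF this borel_measurable_continuous_on_restrict[OF l]]
  have meas: "(\<lambda>t. l (h t) (?V t)) \<in> borel_measurable lebesgue" by simp
  have "(\<lambda>t. ennreal (l (h t) (?V t)) * indicator {a..b} t) \<in> borel_measurable lebesgue"
    by (intro borel_measurable_times_ennreal borel_measurable_indicator measurable_compose[OF meas measurable_ennreal]) simp
  also have "(\<lambda>t. ennreal (l (h t) (?V t)) * indicator {a..b} t) =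
      (\<lambda>t. ennreal (l (f t) (vector_derivative f (at t))) * indicator {a..b} t)"
  proof
    fix t
    show "ennreal (l (h t) (?V t)) * indicator {a..b} t =
      ennreal (l (f t) (vector_derivative f (at t))) * indicator {a..b} t"
    proof (cases "t \<in> {a..b}")
      case True
      then have "t \<in> {0..1}" using ab by blast
      then show ?thesis by (simp add: h_def)
    qed simp
  qed
  finally show ?thesis .
qed

lemma action_split:
  fixes f :: "real \<Rightarrow> 'a::euclidean_space"
  assumes f: "f \<in> C_tilde D" and l: "continuous_on (D \<times> UNIV) (\<lambda>(x, y). l x y)"
    and abc: "0 \<le> a" "a \<le> c" "c \<le> b" "b \<le> 1"
  shows "action l f a b = action l f a c + action l f c b"
proof -
  let ?f = "\<lambda>t. ennreal (l (f t) (vector_derivative f (at t)))"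
  have "action l f a c + action l f c b =
      (\<integral>\<^sup>+t. ?f t * indicator {a..c} t + ?f t * indicator {c..b} t \<partial>lebesgue)"
    unfolding action_def using abc
    by (intro nn_integral_add[symmetric] action_integrand_measurable[OF f l]) auto
  also have "\<dots> = action l f a b"
    unfolding action_def
  proof (rule nn_integral_cong_AE)
    have "AE t in lebesgue. t \<notin> {c}" by (intro negligible_imp_AE negligible_finite) simp
    then show "AE t in lebesgue. ?f t * indicator {a..c} t + ?f t * indicator {c..b} t = ?f t * indicator {a..b} t"
      by eventually_elim (use abc in \<open>auto simp: indicator_def\<close>)
  qed
  finally show ?thesis by simp
qed

lemma negligible_affine_vimage:
  fixes m q :: real
  assumes "negligible N" "m \<noteq> 0"
  shows "negligible {x. m * x + q \<in> N}"
proof -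
  have "negligible ((\<lambda>y. inverse m * y + (- q / m)) ` N)"
  proof (rule negligible_locally_Lipschitz_image[OF _ assms(1)])
    fix x
    have "norm (inverse m * y + (- q / m) - (inverse m * x + (- q / m))) \<le> \<bar>inverse m\<bar> * norm (y - x)" for y
    proof -
      have "inverse m * y + (- q / m) - (inverse m * x + (- q / m)) = inverse m * (y - x)"
        by (simp add: algebra_simps)
      then show ?thesis by (simp only: real_norm_def abs_mult)
    qed
    then show "\<exists>T B. open T \<and> x \<in> T \<and> (\<forall>y\<in>N \<inter> T. norm (inverse m * y + (- q / m) - (inverse m * x + (- q / m))) \<le> B * norm (y - x))"
      by (intro exI[of _ UNIV] exI[of _ "\<bar>inverse m\<bar>"]) auto
  qed simp
  moreover have "{x. m * x + q \<in> N} \<subseteq> (\<lambda>y. inverse m * y + (- q / m)) ` N"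
  proof
    fix x assume "x \<in> {x. m * x + q \<in> N}"
    moreover have "x = inverse m * (m * x + q) + (- q / m)" using assms(2) by (simp add: field_simps)
    ultimately show "x \<in> (\<lambda>y. inverse m * y + (- q / m)) ` N" by blast
  qed
  ultimately show ?thesis by (rule negligible_subset)
qed

text \<open>Change of variables; for \<open>m < 0\<close> the orientation of the path is reversed, hence the sign on the
  right.\<close>

lemma action_affine:
  fixes f :: "real \<Rightarrow> 'a::euclidean_space"
  assumes f: "f \<in> C_tilde D" and l: "continuous_on (D \<times> UNIV) (\<lambda>(x, y). l x y)"
    and hom: "\<And>x y c. x \<in> D \<Longrightarrow> 0 \<le> c \<Longrightarrow> l x (c *\<^sub>R y) = c * l x y"
    and m: "m \<noteq> 0" and maps: "\<And>t. t \<in> {u..v} \<longleftrightarrow> m * t + q \<in> {c..d}" and cd: "{c..d} \<subseteq> {0..1}"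
  shows "action l (\<lambda>t. f (m * t + q)) u v = action (\<lambda>x y. l x (sgn m *\<^sub>R y)) f c d"
proof -
  let ?l = "\<lambda>x y. l x (sgn m *\<^sub>R y)"
  let ?F = "\<lambda>t. ennreal (?l (f t) (vector_derivative f (at t))) * indicator {c..d} t"
  have "continuous_on (D \<times> UNIV) (\<lambda>z. (\<lambda>(x, y). l x y) (fst z, sgn m *\<^sub>R snd z))"
    by (rule continuous_on_compose2[OF l]) (auto intro!: continuous_intros)
  then have l': "continuous_on (D \<times> UNIV) (\<lambda>(x, y). ?l x y)" by (simp add: case_prod_unfold)
  have F: "?F \<in> borel_measurable lebesgue" by (rule action_integrand_measurable[OF f l' cd])
  have aff: "(\<lambda>x. q + m * x) \<in> lebesgue \<rightarrow>\<^sub>M lebesgue"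
    using lebesgue_affine_measurable[where c= "\<lambda>x::real. m" and t = q] m by simp
  have "action ?l f c d = ennreal \<bar>m\<bar> * (\<integral>\<^sup>+x. ?F (q + m * x) \<partial>lebesgue)"
    unfolding action_def by (rule nn_integral_real_affine_lebesgue[OF F m])
  also have "\<dots> = (\<integral>\<^sup>+x. ennreal \<bar>m\<bar> * ?F (q + m * x) \<partial>lebesgue)"
    by (rule nn_integral_cmult[symmetric]) (rule measurable_compose[OF aff F])
  also have "\<dots> = action l (\<lambda>t. f (m * t + q)) u v"
    unfolding action_def
  proof (rule nn_integral_cong_AE)
    let ?N = "nondiff f 0 1 \<union> {0, 1}"
    have N: "negligible ?N"
      by (intro negligible_Un C_tilde_differentiable_ae[OF f] negligible_finite) simp
    have "AE x in lebesgue. x \<notin> {x. m * x + q \<in> ?N}"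
      by (rule negligible_imp_AE[OF negligible_affine_vimage[OF N m]])
    then show "AE x in lebesgue. ennreal \<bar>m\<bar> * ?F (q + m * x) =
        ennreal (l (f (m * x + q)) (vector_derivative (\<lambda>t. f (m * t + q)) (at x))) * indicator {u..v} x"
    proof eventually_elim
      case (elim x)
      have qm: "q + m * x = m * x + q" by simp
      show ?case
      proof (cases "x \<in> {u..v}")
        case True
        let ?s = "m * x + q"
        have s: "?s \<in> {c..d}" using True maps by blast
        then have s01: "?s \<in> {0..1}" using cd by blast
        then have "f differentiable (at ?s)" using elim by auto
        then have "(f has_vector_derivative vector_derivative f (at ?s)) (at ?s)"
          by (simp add: vector_derivative_works)
        moreover have "((\<lambda>t. m * t + q) has_vector_derivative m) (at x)"
          by (auto intro!: derivative_eq_intros simp flip: has_real_derivative_iff_has_vector_derivative)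
        ultimately have "((f \<circ> (\<lambda>t. m * t + q)) has_vector_derivative (m *\<^sub>R vector_derivative f (at ?s))) (at x)"
          by (intro vector_diff_chain_at)
        then have vd: "vector_derivative (\<lambda>t. f (m * t + q)) (at x) = m *\<^sub>R vector_derivative f (at ?s)"
          by (simp add: o_def vector_derivative_at)
        have D: "f ?s \<in> D" using C_tilde_image[OF f] s01 by blast
        have "l (f ?s) (\<bar>m\<bar> *\<^sub>R (sgn m *\<^sub>R vector_derivative f (at ?s))) = \<bar>m\<bar> * ?l (f ?s) (vector_derivative f (at ?s))"
          using D by (intro hom) auto
        then have "l (f ?s) (m *\<^sub>R vector_derivative f (at ?s)) = \<bar>m\<bar> * ?l (f ?s) (vector_derivative f (at ?s))"
          by (simp add: abs_mult_sgn)
        then show ?thesis using True s by (simp add: vd qm ennreal_mult')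
      next
        case False
        then have "m * x + q \<notin> {c..d}" using maps by blast
        then show ?thesis using False by (simp add: qm del: atLeastAtMost_iff)
      qed
    qed
  qed
  finally show ?thesis by simp
qed

lemma action_mono_interval:
  "a \<le> c \<Longrightarrow> d \<le> b \<Longrightarrow> action l f c d \<le> action l f a b"
  unfolding action_def by (intro nn_integral_mono) (auto simp: indicator_def)

lemma continuous_norm_lagrangian: "continuous_on (D \<times> UNIV) (\<lambda>(x, y). norm y)"
  by (auto simp: case_prod_unfold intro!: continuous_intros)

text \<open>The inequality holds near every point outside of the exceptional set \<open>F\<close>, hence on intervals that
  avoid \<open>F\<close>; by continuity also on intervals that meet \<open>F\<close> only in their endpoints; hence
  on all intervals. The first and the last step use the bisection principle \<open>Bolzano\<close>.\<close>

lemma C_tilde_dist_le_length: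
  fixes f :: "real \<Rightarrow> 'a::euclidean_space"
  assumes f: "f \<in> C_tilde D" and uv: "0 \<le> u" "u \<le> v" "v \<le> 1"
  shows "ennreal (dist (f u) (f v)) \<le> action (\<lambda>x y. norm y) f u v"
proof -
  let ?A = "action (\<lambda>x y. norm y) f"
  define P where "P a b \<longleftrightarrow> (0 \<le> a \<longrightarrow> b \<le> 1 \<longrightarrow> ennreal (dist (f a) (f b)) \<le> ?A a b)" for a b
  note cont = C_tilde_continuous[OF f]
  obtain F where F: "finite F"
    "\<And>t. t \<in> {0..1} - F \<Longrightarrow> \<exists>e>0. abs_continuous_on {max 0 (t - e)..min 1 (t + e)} f"
    using C_tilde_interval_abs_continuous[OF f] by blast
  have P_trans: "P a c" if "P a b" "P b c" "a \<le> b" "b \<le> c" for a b c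
    unfolding P_def
  proof (intro impI)
    assume ac: "0 \<le> a" "c \<le> 1"
    have "ennreal (dist (f a) (f c)) \<le> ennreal (dist (f a) (f b) + dist (f b) (f c))"
      by (intro ennreal_leI dist_triangle)
    also have "\<dots> = ennreal (dist (f a) (f b)) + ennreal (dist (f b) (f c))" by simp
    also have "\<dots> \<le> ?A a b + ?A b c" using that ac by (intro add_mono) (auto simp: P_def)
    also have "\<dots> = ?A a c"
      using that ac by (intro action_split[OF f continuous_norm_lagrangian, symmetric]) auto
    finally show "ennreal (dist (f a) (f c)) \<le> ?A a c" .
  qed
  have A: "P u v" if "0 \<le> u" "u \<le> v" "v \<le> 1" "{u..v} \<inter> F = {}" for u v
    using that(2)
  proof (induction rule: Bolzano)
    case (trans a b c)
    then show ?case by (intro P_trans[of a b c])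
  next
    case (local x)
    then have "x \<in> {0..1} - F" using that by auto
    then obtain e where e: "e > 0" "abs_continuous_on {max 0 (x - e)..min 1 (x + e)} f" using F(2) by blast
    have "P a b" if "a \<le> x" "x \<le> b" "b - a < e" for a b
      unfolding P_def
    proof (intro impI)
      assume ab: "0 \<le> a" "b \<le> 1"
      have "{a..b} \<subseteq> {max 0 (x - e)..min 1 (x + e)}" using that ab by auto
      then have "abs_continuous_on {a..b} f" using e(2) abs_continuous_on_subset by blast
      from abs_continuous_on_dist_le[OF this continuous_on_subset[OF cont]] that ab
      show "ennreal (dist (f a) (f b)) \<le> ?A a b" by (simp add: action_def)
    qed
    then show ?case using e(1) by blast
  qed
  have B: "P u v" if uv: "u \<le> v" "{u<..<v} \<inter> F = {}" for u v
    unfolding P_def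
  proof (intro impI)
    assume uv01: "0 \<le> u" "v \<le> 1"
    show "ennreal (dist (f u) (f v)) \<le> ?A u v"
    proof (cases "u < v")
      case False
      then show ?thesis using uv by simp
    next
      case True
      define h where "h n = (v - u) / 3 * inverse (real (Suc n))" for n
      have h0: "h \<longlonglongrightarrow> 0"
        unfolding h_def using tendsto_mult[OF tendsto_const LIMSEQ_inverse_real_of_nat, of "(v - u) / 3"] by simp
      have hp: "0 < h n" "h n \<le> (v - u) / 3" for n
      proof -
        show "0 < h n" using True by (simp add: h_def)
        have "inverse (real (Suc n)) \<le> 1" by (simp add: inverse_le_1_iff)
        then have "(v - u) / 3 * inverse (real (Suc n)) \<le> (v - u) / 3 * 1" using True by (intro mult_left_mono) auto
        then show "h n \<le> (v - u) / 3" by (simp add: h_def)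
      qed
      have in01: "u + h n \<in> {0..1}" "v - h n \<in> {0..1}" "u + h n \<le> v - h n" for n
        using hp[of n] uv01 True by auto
      have "(\<lambda>n. f (u + h n)) \<longlonglongrightarrow> f (u + 0)"
        using in01 True uv01 by (intro continuous_on_tendsto_compose[OF cont] tendsto_add tendsto_const h0) auto
      moreover have "(\<lambda>n. f (v - h n)) \<longlonglongrightarrow> f (v - 0)"
        using in01 True uv01 by (intro continuous_on_tendsto_compose[OF cont] tendsto_diff tendsto_const h0) auto
      ultimately have "(\<lambda>n. ennreal (dist (f (u + h n)) (f (v - h n)))) \<longlonglongrightarrow> ennreal (dist (f (u + 0)) (f (v - 0)))"
        by (intro tendsto_ennrealI tendsto_dist)
      then have lim: "(\<lambda>n. ennreal (dist (f (u + h n)) (f (v - h n)))) \<longlonglongrightarrow> ennreal (dist (f u) (f v))" by simp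
      have "ennreal (dist (f (u + h n)) (f (v - h n))) \<le> ?A u v" for n
      proof -
        have "{u + h n..v - h n} \<subseteq> {u<..<v}" using hp[of n] by auto
        then have "{u + h n..v - h n} \<inter> F = {}" using uv(2) by blast
        then have "P (u + h n) (v - h n)" using A in01[of n] by auto
        then have "ennreal (dist (f (u + h n)) (f (v - h n))) \<le> ?A (u + h n) (v - h n)"
          using in01[of n] by (auto simp: P_def)
        also have "\<dots> \<le> ?A u v" using hp(1)[of n] by (intro action_mono_interval) auto
        finally show ?thesis .
      qed
      then show ?thesis by (intro LIMSEQ_le_const2[OF lim]) blast
    qed
  qed
  have "P u v" using uv(2)
  proof (induction rule: Bolzano)
    case (trans a b c)
    then show ?case by (intro P_trans[of a b c])
  next
    case (local x)
    obtain d where d: "d > 0" "\<forall>y\<in>F. y \<noteq> x \<longrightarrow> d \<le> dist x y" using finite_set_avoid[OF F(1)] by blast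
    have "P a b" if ab: "a \<le> x" "x \<le> b" "b - a < d" for a b
    proof -
      have ne: "y \<notin> F" if "\<bar>x - y\<bar> < d" "y \<noteq> x" for y using d(2) that by (auto simp: dist_real_def)
      have "P a x" using ab ne by (intro B) (auto simp: disjoint_iff)
      moreover have "P x b" using ab ne by (intro B) (auto simp: disjoint_iff)
      ultimately show ?thesis using ab by (intro P_trans[of a x b])
    qed
    then show ?case using d(1) by blast
  qed
  then show ?thesis using uv by (simp add: P_def)
qed

lemma C_tilde_finite_length_bv:
  fixes f :: "real \<Rightarrow> 'a::euclidean_space"
  assumes f: "f \<in> C_tilde D" and fin: "action (\<lambda>x y. norm y) f 0 1 < \<infinity>"
  shows "bounded_variation_on {0..1} f"
  unfolding bounded_variation_on_def
proof (intro exI allI impI)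
  let ?A = "action (\<lambda>x y. norm y) f"
  fix n :: nat and t :: "nat \<Rightarrow> real"
  assume t: "(\<forall>i\<le>n. t i \<in> {0..1}) \<and> (\<forall>i<n. t i \<le> t (Suc i))"
  have "t 0 \<le> t k \<and> ennreal (\<Sum>i<k. dist (f (t i)) (f (t (Suc i)))) \<le> ?A (t 0) (t k)" if "k \<le> n" for k
    using that
  proof (induction k)
    case (Suc k)
    have tk: "t k \<in> {0..1}" "t (Suc k) \<in> {0..1}" "t k \<le> t (Suc k)" "t 0 \<in> {0..1}" using t Suc.prems by auto
    have IH: "t 0 \<le> t k" "ennreal (\<Sum>i<k. dist (f (t i)) (f (t (Suc i)))) \<le> ?A (t 0) (t k)" using Suc by auto
    have "ennreal (\<Sum>i<Suc k. dist (f (t i)) (f (t (Suc i)))) =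
        ennreal (\<Sum>i<k. dist (f (t i)) (f (t (Suc i)))) + ennreal (dist (f (t k)) (f (t (Suc k))))"
      by (simp add: sum_nonneg)
    also have "\<dots> \<le> ?A (t 0) (t k) + ?A (t k) (t (Suc k))"
      using tk by (intro add_mono IH C_tilde_dist_le_length[OF f]) auto
    also have "\<dots> = ?A (t 0) (t (Suc k))"
      using tk IH by (intro action_split[OF f continuous_norm_lagrangian, symmetric]) auto
    finally show ?case using IH tk by auto
  qed simp
  then have "ennreal (\<Sum>i<n. dist (f (t i)) (f (t (Suc i)))) \<le> ?A (t 0) (t n)" by blast
  also have "\<dots> \<le> ?A 0 1" using t by (intro action_mono_interval) auto
  finally have le: "ennreal (\<Sum>i<n. dist (f (t i)) (f (t (Suc i)))) \<le> ?A 0 1" .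
  show "(\<Sum>i<n. dist (f (t i)) (f (t (Suc i)))) \<le> enn2real (?A 0 1)"
  proof -
    have "?A 0 1 = ennreal (enn2real (?A 0 1))" using fin by simp
    with le have "ennreal (\<Sum>i<n. dist (f (t i)) (f (t (Suc i)))) \<le> ennreal (enn2real (?A 0 1))" by argo
    then show ?thesis by (rule iffD1[OF ennreal_le_iff[OF enn2real_nonneg]])
  qed
qed

section \<open>Frechet classes of paths\<close>

lemma reparams_endpoints:
  assumes "\<alpha> \<in> reparams T" "0 \<le> T"
  shows "\<alpha> 0 = 0" "\<alpha> 1 = T" "\<And>s. s \<in> {0..1} \<Longrightarrow> \<alpha> s \<in> {0..T}"
proof -
  have mono: "mono_on {0..1} \<alpha>" and im: "\<alpha> ` {0..1} = {0..T}" using assms by (auto simp: reparams_def)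
  show m: "\<alpha> s \<in> {0..T}" if "s \<in> {0..1}" for s using im that by blast
  obtain s0 where s0: "s0 \<in> {0..1}" "\<alpha> s0 = 0" using im assms(2) by (metis atLeastAtMost_iff imageE order_refl)
  have "\<alpha> 0 \<le> \<alpha> s0" using mono s0 by (intro mono_onD[OF mono]) auto
  then show "\<alpha> 0 = 0" using m[of 0] s0 by auto
  obtain s1 where s1: "s1 \<in> {0..1}" "\<alpha> s1 = T" using im assms(2) by (metis atLeastAtMost_iff imageE order_refl)
  have "\<alpha> s1 \<le> \<alpha> 1" using mono s1 by (intro mono_onD[OF mono]) auto
  then show "\<alpha> 1 = T" using m[of 1] s1 by auto
qed

lemma frechet_bdd:
  fixes p q :: "'a::metric_space path_fun"
  assumes "p \<in> path_funs D" "q \<in> path_funs D" "\<alpha> \<in> reparams (fst p)" "\<beta> \<in> reparams (fst q)"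
  shows "bdd_above ((\<lambda>s. dist (snd p (\<alpha> s)) (snd q (\<beta> s))) ` {0..1})"
proof -
  have *: "continuous_on {0..1} (\<lambda>s. snd r (\<delta> s))"
    if "r \<in> path_funs D" "\<delta> \<in> reparams (fst r)" for r :: "'a path_fun" and \<delta>
  proof (rule continuous_on_compose2[where t = "{0..fst r}"])
    show "continuous_on {0..fst r} (snd r)" using that(1) by (simp add: path_funs_def case_prod_unfold)
  qed (use that(2) in \<open>auto simp: reparams_def\<close>)
  have "continuous_on {0..1} (\<lambda>s. dist (snd p (\<alpha> s)) (snd q (\<beta> s)))"
    by (rule continuous_on_dist[OF *[OF assms(1,3)] *[OF assms(2,4)]])
  then have "compact ((\<lambda>s. dist (snd p (\<alpha> s)) (snd q (\<beta> s))) ` {0..1})"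
    by (rule compact_continuous_image) simp
  then show ?thesis by (intro bounded_imp_bdd_above compact_imp_bounded)
qed

lemma frechet_rel_approx:
  assumes "(p, q) \<in> frechet_rel D" "e > 0"
  obtains \<alpha> \<beta> where "\<alpha> \<in> reparams (fst p)" "\<beta> \<in> reparams (fst q)"
    "\<And>s. s \<in> {0..1} \<Longrightarrow> dist (snd p (\<alpha> s)) (snd q (\<beta> s)) < e"
proof -
  have pq: "p \<in> path_funs D" "q \<in> path_funs D" and 0: "frechet_dist p q = 0"
    using assms by (auto simp: frechet_rel_def)
  have lin: "(\<lambda>s. T * s) \<in> reparams T" if "0 < T" for T :: real
  proof -
    have "mono_on {0..1} (\<lambda>s. T * s)" using that by (intro mono_onI mult_left_mono) auto
    moreover have "(\<lambda>s. T * s) ` {0..1} = {0..T}"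
      using that image_mult_atLeastAtMost[of T 0 1] by simp
    ultimately show ?thesis by (auto simp: reparams_def intro!: continuous_intros)
  qed
  have "reparams (fst p) \<times> reparams (fst q) \<noteq> {}"
    using lin[of "fst p"] lin[of "fst q"] pq by (auto simp: path_funs_def)
  moreover have "(INF (\<alpha>, \<beta>) \<in> reparams (fst p) \<times> reparams (fst q).
      SUP s\<in>{0..1}. dist (snd p (\<alpha> s)) (snd q (\<beta> s))) < e"
    using 0 assms(2) by (simp add: frechet_dist_def)
  ultimately obtain \<alpha> \<beta> where ab: "\<alpha> \<in> reparams (fst p)" "\<beta> \<in> reparams (fst q)"
    and lt: "(SUP s\<in>{0..1}. dist (snd p (\<alpha> s)) (snd q (\<beta> s))) < e"
    using cInf_lessD[of "(\<lambda>(\<alpha>, \<beta>). SUP s\<in>{0..1}. dist (snd p (\<alpha> s)) (snd q (\<beta> s))) ` (reparams (fst p) \<times> reparams (fst q))" e]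
    by auto
  have "dist (snd p (\<alpha> s)) (snd q (\<beta> s)) < e" if "s \<in> {0..1}" for s
    using cSUP_upper[OF that frechet_bdd[OF pq ab]] lt by simp
  then show thesis by (rule that[OF ab])
qed

text \<open>The infimum in the Frechet distance need not be attained; it is enough to have
  reparameterizations for every positive error.\<close>

lemma frechet_relI:
  assumes pq: "p \<in> path_funs D" "q \<in> path_funs D"
    and approx: "\<And>e. e > 0 \<Longrightarrow> \<exists>\<alpha>\<in>reparams (fst p). \<exists>\<beta>\<in>reparams (fst q).
      \<forall>s\<in>{0..1}. dist (snd p (\<alpha> s)) (snd q (\<beta> s)) \<le> e"
  shows "(p, q) \<in> frechet_rel D"
proof -
  let ?R = "reparams (fst p) \<times> reparams (fst q)"
  let ?f = "\<lambda>(\<alpha>, \<beta>). SUP s\<in>{0..1}. dist (snd p (\<alpha> s)) (snd q (\<beta> s))"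
  have nonneg: "0 \<le> ?f ab" if "ab \<in> ?R" for ab
  proof -
    obtain \<alpha> \<beta> where ab: "ab = (\<alpha>, \<beta>)" by (cases ab)
    have bd: "bdd_above ((\<lambda>s. dist (snd p (\<alpha> s)) (snd q (\<beta> s))) ` {0..1})"
      using that ab by (intro frechet_bdd[OF pq]) auto
    have "0 \<le> (SUP s\<in>{0..1}. dist (snd p (\<alpha> s)) (snd q (\<beta> s)))"
      by (rule cSUP_upper2[OF bd, of 0]) auto
    then show ?thesis by (simp add: ab)
  qed
  have bdd: "bdd_below (?f ` ?R)" by (rule bdd_belowI2[OF nonneg])
  have "Inf (?f ` ?R) \<le> e" if e: "e > 0" for e
  proof -
    obtain \<alpha> \<beta> where ab: "\<alpha> \<in> reparams (fst p)" "\<beta> \<in> reparams (fst q)"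
      "\<forall>s\<in>{0..1}. dist (snd p (\<alpha> s)) (snd q (\<beta> s)) \<le> e" using approx[OF e] by blast
    have "(SUP s\<in>{0..1}. dist (snd p (\<alpha> s)) (snd q (\<beta> s))) \<le> e"
      using ab(3) by (intro cSUP_least) auto
    then show ?thesis using ab by (intro cINF_lower2[OF bdd, of "(\<alpha>, \<beta>)"]) auto
  qed
  then have "Inf (?f ` ?R) \<le> 0" using field_le_epsilon[of "Inf (?f ` ?R)" 0] by simp
  moreover have "?R \<noteq> {}" using approx[of 1] by auto
  then have "0 \<le> Inf (?f ` ?R)" by (intro cINF_greatest nonneg)
  ultimately have "frechet_dist p q = 0" unfolding frechet_dist_def by simp
  then show ?thesis using pq by (simp add: frechet_rel_def)
qed

lemma frechet_rel_self:
  assumes "p \<in> path_funs D"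
  shows "(p, p) \<in> frechet_rel D"
proof (rule frechet_relI[OF assms assms])
  have T: "0 < fst p" using assms by (auto simp: path_funs_def)
  have "(\<lambda>s. fst p * s) \<in> reparams (fst p)"
    using T image_mult_atLeastAtMost[of "fst p" 0 1]
    by (auto simp: reparams_def mono_on_def intro!: continuous_intros mult_left_mono)
  then show "\<exists>\<alpha>\<in>reparams (fst p). \<exists>\<beta>\<in>reparams (fst p). \<forall>s\<in>{0..1}. dist (snd p (\<alpha> s)) (snd p (\<beta> s)) \<le> e"
    if "e > 0" for e
    using that by (intro bexI[of _ "\<lambda>s. fst p * s"]) auto
qed

lemma frechet_rel_endpoints:
  assumes "(p, q) \<in> frechet_rel D"
  shows "snd p 0 = snd q 0" "snd p (fst p) = snd q (fst q)"
proof -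
  have T: "0 \<le> fst p" "0 \<le> fst q" using assms by (auto simp: frechet_rel_def path_funs_def)
  have *: "dist (snd p 0) (snd q 0) < e \<and> dist (snd p (fst p)) (snd q (fst q)) < e" if e: "e > 0" for e
  proof -
    obtain \<alpha> \<beta> where ab: "\<alpha> \<in> reparams (fst p)" "\<beta> \<in> reparams (fst q)"
      "\<And>s. s \<in> {0..1} \<Longrightarrow> dist (snd p (\<alpha> s)) (snd q (\<beta> s)) < e"
      by (rule frechet_rel_approx[OF assms e]) blast
    then show ?thesis using ab(3)[of 0] ab(3)[of 1]
      reparams_endpoints(1,2)[OF ab(1) T(1)] reparams_endpoints(1,2)[OF ab(2) T(2)] by simp
  qed
  show "snd p 0 = snd q 0" using *[of "dist (snd p 0) (snd q 0)"] by (cases "snd p 0 = snd q 0") auto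
  show "snd p (fst p) = snd q (fst q)"
    using *[of "dist (snd p (fst p)) (snd q (fst q))"] by (cases "snd p (fst p) = snd q (fst q)") auto
qed

lemma frechet_rel_image_subset:
  assumes "(p, q) \<in> frechet_rel D"
  shows "snd q ` {0..fst q} \<subseteq> snd p ` {0..fst p}"
proof
  have pq: "p \<in> path_funs D" "q \<in> path_funs D" using assms by (auto simp: frechet_rel_def)
  then have T: "0 \<le> fst p" "0 \<le> fst q" by (auto simp: path_funs_def)
  have "compact (snd p ` {0..fst p})"
    using pq(1) by (intro compact_continuous_image) (auto simp: path_funs_def)
  then have cl: "closed (snd p ` {0..fst p})" by (rule compact_imp_closed)
  fix y assume "y \<in> snd q ` {0..fst q}"
  then obtain t where t: "t \<in> {0..fst q}" "y = snd q t" by blast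
  have "\<exists>x\<in>snd p ` {0..fst p}. dist x y < e" if e: "e > 0" for e
  proof -
    obtain \<alpha> \<beta> where ab: "\<alpha> \<in> reparams (fst p)" "\<beta> \<in> reparams (fst q)"
      "\<And>s. s \<in> {0..1} \<Longrightarrow> dist (snd p (\<alpha> s)) (snd q (\<beta> s)) < e"
      by (rule frechet_rel_approx[OF assms e]) blast
    have "t \<in> \<beta> ` {0..1}" using ab(2) t(1) by (simp add: reparams_def)
    then obtain s where "s \<in> {0..1}" "\<beta> s = t" by blast
    then show ?thesis using ab(3)[of s] reparams_endpoints(3)[OF ab(1) T(1), of s] t(2) by blast
  qed
  then have "\<forall>e>0. \<exists>x\<in>snd p ` {0..fst p}. dist x y < e" by blast
  then show "y \<in> snd p ` {0..fst p}" by (rule iffD1[OF closed_approachable[OF cl]])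
qed

text \<open>The unparameterized curve with parameterization \<open>f\<close> on \<open>{0..1}\<close>.\<close>

definition curve_of :: "'a::metric_space set \<Rightarrow> (real \<Rightarrow> 'a) \<Rightarrow> 'a curve" where
  "curve_of D f = frechet_rel D `` {(1, f)}"

lemma curve_ofD:
  assumes "(T, h) \<in> curve_of D f"
  shows "h 0 = f 0" "h T = f 1" "h ` {0..T} \<subseteq> f ` {0..1}"
proof -
  have rel: "((1, f), (T, h)) \<in> frechet_rel D" using assms by (simp add: curve_of_def)
  show "h 0 = f 0" using frechet_rel_endpoints(1)[OF rel] by simp
  show "h T = f 1" using frechet_rel_endpoints(2)[OF rel] by simp
  show "h ` {0..T} \<subseteq> f ` {0..1}" using frechet_rel_image_subset[OF rel] by simp
qed

lemma curve_of_in_curves: "(1, f) \<in> path_funs D \<Longrightarrow> curve_of D f \<in> curves D"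
  unfolding curve_of_def curves_def by (rule quotientI)

lemma mem_curve_of: "(1, f) \<in> path_funs D \<Longrightarrow> (1, f) \<in> curve_of D f"
  by (simp add: curve_of_def frechet_rel_self)

lemma curve_of_joining:
  assumes "f ` {0..1} \<subseteq> D'" "f 0 \<in> A1" "f 1 \<in> A2"
  shows "curve_of D f \<in> joining D' A1 A2"
  unfolding joining_def
proof (intro CollectI conjI)
  show "curve_image (curve_of D f) \<subseteq> D'"
    unfolding curve_image_def
  proof (rule UN_least)
    fix q assume "q \<in> curve_of D f"
    then show "(case q of (T, h) \<Rightarrow> h ` {0..T}) \<subseteq> D'"
      using curve_ofD(3)[of "fst q" "snd q" D f] assms(1) by (auto simp: case_prod_unfold)
  qed
  show "starts_in (curve_of D f) A1"
    unfolding starts_in_def using curve_ofD(1)[of _ _ D f] assms(2) by (metis (mono_tags, lifting) case_prodI2)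
  show "ends_in (curve_of D f) A2"
    unfolding ends_in_def using curve_ofD(2)[of _ _ D f] assms(3) by (metis (mono_tags, lifting) case_prodI2)
qed

lemma joiningD:
  assumes "\<gamma> \<in> joining D' A1 A2" "(1, f) \<in> \<gamma>"
  shows "f ` {0..1} \<subseteq> D'" "f 0 \<in> A1" "f 1 \<in> A2"
proof -
  have *: "curve_image \<gamma> \<subseteq> D'" "starts_in \<gamma> A1" "ends_in \<gamma> A2" using assms(1) by (auto simp: joining_def)
  show "f ` {0..1} \<subseteq> D'" using *(1) UN_upper[OF assms(2), of "\<lambda>(T, f). f ` {0..T}"]
    by (simp add: curve_image_def)
  show "f 0 \<in> A1" using bspec[OF *(2)[unfolded starts_in_def] assms(2)] by simp
  show "f 1 \<in> A2" using bspec[OF *(3)[unfolded ends_in_def] assms(2)] by simp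
qed

lemma C_tilde_path_funs: "f \<in> C_tilde D \<Longrightarrow> (1, f) \<in> path_funs D"
  by (simp add: C_tilde_def)

lemma curve_of_tilde:
  assumes "f \<in> C_tilde D"
  shows "curve_of D f \<in> tilde_curves D" "f \<in> tilde_params D (curve_of D f)"
proof -
  note f = C_tilde_path_funs[OF assms]
  show par: "f \<in> tilde_params D (curve_of D f)" using assms mem_curve_of[OF f] by (simp add: tilde_params_def)
  show "curve_of D f \<in> tilde_curves D" using par curve_of_in_curves[OF f] by (auto simp: tilde_curves_def)
qed

lemma curve_of_rect:
  assumes "f \<in> C_tilde D" "bounded_variation_on {0..1} f"
  shows "curve_of D f \<in> rect_curves D"
proof -
  note f = C_tilde_path_funs[OF assms(1)]
  have "\<exists>(T, h)\<in>curve_of D f. bounded_variation_on {0..T} h"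
    by (rule bexI[OF _ mem_curve_of[OF f]]) (simp add: assms(2))
  then show ?thesis using curve_of_in_curves[OF f] by (simp add: rect_curves_def)
qed

lemma lipschitz_C_tilde:
  assumes "L-lipschitz_on {0..1} f" "f ` {0..1} \<subseteq> D"
  shows "f \<in> C_tilde D"
proof -
  have "abs_continuous_on {0..1} f" by (rule lipschitz_imp_abs_continuous_on[OF assms(1)])
  then have "abs_continuous_on ({0..1} \<inter> {\<alpha> - 1..\<alpha> + 1}) f" for \<alpha> by (rule abs_continuous_on_subset) auto
  then show ?thesis
    using assms lipschitz_on_continuous_on[OF assms(1)]
    by (auto simp: C_tilde_def path_funs_def intro!: exI[of _ "{}"] exI[of _ 1])
qed

lemma lipschitz_bv:
  assumes "L-lipschitz_on {0..1} f"
  shows "bounded_variation_on {0..1} f"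
  unfolding bounded_variation_on_def
proof (intro exI allI impI)
  fix n :: nat and t :: "nat \<Rightarrow> real"
  assume t: "(\<forall>i\<le>n. t i \<in> {0..1}) \<and> (\<forall>i<n. t i \<le> t (Suc i))"
  have L: "0 \<le> L" by (rule lipschitz_on_nonneg[OF assms])
  have "(\<Sum>i<n. dist (f (t i)) (f (t (Suc i)))) \<le> (\<Sum>i<n. L * (t (Suc i) - t i))"
  proof (rule sum_mono)
    fix i assume "i \<in> {..<n}"
    then have "t i \<in> {0..1}" "t (Suc i) \<in> {0..1}" "t i \<le> t (Suc i)" using t by auto
    then show "dist (f (t i)) (f (t (Suc i))) \<le> L * (t (Suc i) - t i)"
      using lipschitz_onD[OF assms, of "t i" "t (Suc i)"] by (simp add: dist_real_def)
  qed
  also have "\<dots> = L * (t n - t 0)" by (simp add: sum_distrib_left[symmetric] sum_lessThan_telescope)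
  also have "\<dots> \<le> L * 1"
  proof (rule mult_left_mono[OF _ L])
    have "t n \<in> {0..1}" "t 0 \<in> {0..1}" using t by auto
    then show "t n - t 0 \<le> 1" by auto
  qed
  finally show "(\<Sum>i<n. dist (f (t i)) (f (t (Suc i)))) \<le> L * 1" .
qed

text \<open>A parameterization \<open>f\<close> of bounded variation factors as \<open>h \<circ> v\<close> with a Lipschitz function \<open>h\<close> on
  \<open>{0..1}\<close> and a continuous nondecreasing surjection \<open>v\<close>. Composing with \<open>v\<close> turns near-optimal
  reparameterizations for \<open>f\<close> into ones for \<open>h\<close>, so \<open>h\<close> parameterizes the same curve.\<close>

lemma rect_curve_lipschitz_param:
  assumes "\<gamma> \<in> rect_curves D"
  obtains L h where "L-lipschitz_on {0..1} h" "h \<in> tilde_params D \<gamma>" "\<gamma> \<in> tilde_curves D"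
proof -
  have \<gamma>: "\<gamma> \<in> curves D" using assms by (simp add: rect_curves_def)
  then obtain p where p: "p \<in> path_funs D" "\<gamma> = frechet_rel D `` {p}"
    unfolding curves_def by (auto elim: quotientE)
  obtain T f where Tf: "(T, f) \<in> \<gamma>" "bounded_variation_on {0..T} f"
    using assms by (auto simp: rect_curves_def)
  have rel: "(p, (T, f)) \<in> frechet_rel D" using Tf p by auto
  then have T: "0 < T" "continuous_on {0..T} f" "f ` {0..T} \<subseteq> D" by (auto simp: frechet_rel_def path_funs_def)
  obtain s h0 where conts: "continuous_on UNIV s" and ex: "\<And>u v. u \<le> v \<Longrightarrow> v - u \<le> s v - s u"
    and s0: "s 0 = 0" and lip: "1-lipschitz_on UNIV h0" and fac: "\<And>t. t \<in> {0..T} \<Longrightarrow> f t = h0 (s t)"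
    using bv_lipschitz_factorization[OF Tf(2) T(2)] T(1) by (metis less_imp_le)
  define B where "B = s T"
  have B: "B > 0" using ex[of 0 T] T(1) s0 by (simp add: B_def)
  define h where "h y = h0 (B * y)" for y
  define v where "v t = s t / B" for t
  have vim: "v t \<in> {0..1}" if "t \<in> {0..T}" for t
    using ex[of 0 t] ex[of t T] that B s0 by (auto simp: v_def B_def field_simps)
  have vsurj: "\<exists>t\<in>{0..T}. v t = y" if "y \<in> {0..1}" for y
  proof -
    have "s 0 \<le> B * y" "B * y \<le> s T" using that B s0 by (auto simp: B_def mult_left_le)
    then obtain t where "0 \<le> t" "t \<le> T" "s t = B * y"
      using IVT'[of s 0 "B * y" T] T(1) continuous_on_subset[OF conts] by auto
    then show ?thesis using B by (intro bexI[of _ t]) (auto simp: v_def)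
  qed
  have hv: "h (v t) = f t" if "t \<in> {0..T}" for t
    using fac[OF that] B by (simp add: h_def v_def)
  have liph: "B-lipschitz_on {0..1} h"
  proof (rule lipschitz_onI)
    fix x y :: real
    have "dist (h x) (h y) \<le> 1 * dist (B * x) (B * y)"
      unfolding h_def by (rule lipschitz_onD[OF lip]) auto
    also have "\<dots> = B * dist x y" using B by (simp add: dist_real_def flip: right_diff_distrib) (simp add: abs_mult)
    finally show "dist (h x) (h y) \<le> B * dist x y" .
  qed (use B in simp)
  have im: "h ` {0..1} \<subseteq> D"
  proof
    fix z assume "z \<in> h ` {0..1}"
    then obtain y where y: "y \<in> {0..1}" "z = h y" by blast
    then obtain t where "t \<in> {0..T}" "v t = y" using vsurj by blast
    then have "z = f t" using hv y by auto
    then show "z \<in> D" using T(3) \<open>t \<in> {0..T}\<close> by blast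
  qed
  have Ct: "h \<in> C_tilde D" by (rule lipschitz_C_tilde[OF liph im])
  have "(p, (1, h)) \<in> frechet_rel D"
  proof (rule frechet_relI[OF p(1) C_tilde_path_funs[OF Ct]])
    fix e :: real assume "e > 0"
    then obtain \<alpha> \<beta> where ab: "\<alpha> \<in> reparams (fst p)" "\<beta> \<in> reparams T"
      "\<And>r. r \<in> {0..1} \<Longrightarrow> dist (snd p (\<alpha> r)) (f (\<beta> r)) < e"
      by (rule frechet_rel_approx[OF rel]) auto
    have \<beta>T: "\<beta> r \<in> {0..T}" if "r \<in> {0..1}" for r
      using reparams_endpoints(3)[OF ab(2)] T(1) that by auto
    have "(\<lambda>r. v (\<beta> r)) \<in> reparams 1"
      unfolding reparams_def
    proof (intro CollectI conjI)
      have "continuous_on {0..1} \<beta>" using ab(2) by (simp add: reparams_def)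
      then show "continuous_on {0..1} (\<lambda>r. v (\<beta> r))" unfolding v_def using B
        by (intro continuous_intros continuous_on_compose2[OF conts]) auto
      have vm: "v x \<le> v y" if "x \<le> y" for x y
        using ex[OF that] that B by (simp add: v_def divide_right_mono)
      have "mono_on {0..1} \<beta>" using ab(2) by (simp add: reparams_def)
      then show "mono_on {0..1} (\<lambda>r. v (\<beta> r))" by (intro mono_onI vm) (rule mono_onD)
      have "\<beta> ` {0..1} = {0..T}" using ab(2) by (simp add: reparams_def)
      then have "(\<lambda>r. v (\<beta> r)) ` {0..1} = v ` {0..T}" by (metis image_image)
      also have "v ` {0..T} = {0..1}" using vim vsurj by blast
      finally show "(\<lambda>r. v (\<beta> r)) ` {0..1} = {0..1}" .
    qed
    moreover have "dist (snd p (\<alpha> r)) (h (v (\<beta> r))) \<le> e" if "r \<in> {0..1}" for r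
      using ab(3)[OF that] hv[OF \<beta>T[OF that]] by simp
    ultimately show "\<exists>\<alpha>\<in>reparams (fst p). \<exists>\<beta>\<in>reparams (fst (1, h)).
        \<forall>s\<in>{0..1}. dist (snd p (\<alpha> s)) (snd (1, h) (\<beta> s)) \<le> e"
      using ab(1) by (intro bexI[of _ \<alpha>] bexI[of _ "\<lambda>r. v (\<beta> r)"]) auto
  qed
  then have "(1, h) \<in> \<gamma>" using p by auto
  then have "h \<in> tilde_params D \<gamma>" using Ct by (simp add: tilde_params_def)
  then show thesis using that liph \<gamma> by (auto simp: tilde_curves_def)
qed

section \<open>Concatenation and reversal of paths\<close>

lemma lipschitz_on_affine:
  fixes f :: "real \<Rightarrow> 'a::metric_space"
  assumes lip: "L-lipschitz_on {c..d} f" and maps: "\<And>t. t \<in> {u..v} \<Longrightarrow> m * t + q \<in> {c..d}"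
  shows "(L * \<bar>m\<bar>)-lipschitz_on {u..v} (\<lambda>t. f (m * t + q))"
proof (rule lipschitz_onI)
  fix x y assume xy: "x \<in> {u..v}" "y \<in> {u..v}"
  have "dist (f (m * x + q)) (f (m * y + q)) \<le> L * dist (m * x + q) (m * y + q)"
    by (rule lipschitz_onD[OF lip maps[OF xy(1)] maps[OF xy(2)]])
  also have "dist (m * x + q) (m * y + q) = \<bar>m\<bar> * dist x y"
    by (simp add: dist_real_def abs_mult flip: right_diff_distrib)
  finally show "dist (f (m * x + q)) (f (m * y + q)) \<le> L * \<bar>m\<bar> * dist x y" by simp
qed (use lipschitz_on_nonneg[OF lip] in simp)

lemma lipschitz_on_joinpaths:
  fixes f h :: "real \<Rightarrow> 'a::metric_space"
  assumes "L-lipschitz_on {0..1} f" "M-lipschitz_on {0..1} h" "f 1 = h 0"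
  shows "(max L M * 2)-lipschitz_on {0..1} (f +++ h)"
proof -
  have "(max L M)-lipschitz_on {0..1} f" "(max L M)-lipschitz_on {0..1} h"
    using assms(1,2) by (auto intro: lipschitz_on_le)
  note lip = this
  have "(max L M * \<bar>2\<bar>)-lipschitz_on {0..1/2} (\<lambda>t. f (2 * t + 0))"
    by (rule lipschitz_on_affine[OF lip(1)]) auto
  moreover have "(max L M * \<bar>2\<bar>)-lipschitz_on {1/2..1} (\<lambda>t. h (2 * t + (-1)))"
    by (rule lipschitz_on_affine[OF lip(2)]) auto
  ultimately have "(max L M * 2)-lipschitz_on {0..1/2} (\<lambda>t. f (2 * t))"
    "(max L M * 2)-lipschitz_on {1/2..1} (\<lambda>t. h (2 * t - 1))" by simp_all
  from lipschitz_on_concat[OF this] show ?thesis using assms(3) by (simp add: joinpaths_def)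
qed

lemma image_joinpaths_subset: "f ` {0..1} \<subseteq> A \<Longrightarrow> h ` {0..1} \<subseteq> A \<Longrightarrow> (f +++ h) ` {0..1} \<subseteq> A"
  by (auto simp: joinpaths_def image_subset_iff)

lemma joinpaths_0_1: "(f +++ h) 0 = f 0" "(f +++ h) 1 = h 1"
  by (simp_all add: joinpaths_def)

lemma C_tildeI:
  assumes "continuous_on {0..1} f" "f ` {0..1} \<subseteq> D" "finite F"
    and "\<And>t. t \<in> {0..1} - F \<Longrightarrow> \<exists>e>0. abs_continuous_on {max 0 (t - e)..min 1 (t + e)} f"
  shows "f \<in> C_tilde D"
proof -
  have eq: "{0..1} \<inter> {t - e..t + e} = {max 0 (t - e)..min 1 (t + e)}" for t e :: real by auto
  have "finite (F \<inter> {0..1})" "F \<inter> {0..1} \<subseteq> {0..1}" using assms(3) by auto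
  moreover have "\<forall>t\<in>{0..1} - (F \<inter> {0..1}). \<exists>e>0. abs_continuous_on ({0..1} \<inter> {t - e..t + e}) f"
    unfolding eq using assms(4) by blast
  ultimately show ?thesis using assms(1,2) unfolding C_tilde_def path_funs_def by auto
qed

lemma joinpaths_C_tilde:
  assumes f: "f \<in> C_tilde D" and h: "h \<in> C_tilde D" and eq: "f 1 = h 0"
  shows "f +++ h \<in> C_tilde D"
proof -
  obtain F where F: "finite F"
    "\<And>t. t \<in> {0..1} - F \<Longrightarrow> \<exists>e>0. abs_continuous_on {max 0 (t - e)..min 1 (t + e)} f"
    by (rule C_tilde_interval_abs_continuous[OF f]) blast
  obtain G where G: "finite G"
    "\<And>t. t \<in> {0..1} - G \<Longrightarrow> \<exists>e>0. abs_continuous_on {max 0 (t - e)..min 1 (t + e)} h"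
    by (rule C_tilde_interval_abs_continuous[OF h]) blast
  let ?H = "{0, 1/2, 1} \<union> (\<lambda>t. t / 2) ` F \<union> (\<lambda>t. (t + 1) / 2) ` G"
  show ?thesis
  proof (rule C_tildeI[where F = ?H])
    have "path (f +++ h)"
      using C_tilde_continuous[OF f] C_tilde_continuous[OF h] eq
      by (intro path_join_imp) (auto simp: path_def pathfinish_def pathstart_def)
    then show "continuous_on {0..1} (f +++ h)" by (simp add: path_def)
    show "(f +++ h) ` {0..1} \<subseteq> D"
      by (rule image_joinpaths_subset[OF C_tilde_image[OF f] C_tilde_image[OF h]])
    show "finite ?H" using F(1) G(1) by simp
    fix t assume t: "t \<in> {0..1} - ?H"
    show "\<exists>e>0. abs_continuous_on {max 0 (t - e)..min 1 (t + e)} (f +++ h)"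
    proof (cases "t < 1/2")
      case True
      have "2 * t \<notin> F"
      proof
        assume "2 * t \<in> F"
        then have "2 * t / 2 \<in> (\<lambda>t. t / 2) ` F" by (rule imageI)
        then show False using t by simp
      qed
      then have "2 * t \<in> {0..1} - F" using True t by auto
      then obtain e where e: "e > 0" "abs_continuous_on {max 0 (2 * t - e)..min 1 (2 * t + e)} f"
        using F(2) by blast
      define d where "d = min (e / 2) (1/2 - t)"
      have d: "d > 0" "2 * d \<le> e" "t + d \<le> 1/2" using e(1) True by (auto simp: d_def min_def)
      have "abs_continuous_on {max 0 (t - d)..min 1 (t + d)} (\<lambda>t. f (2 * t + 0))"
        by (rule abs_continuous_on_affine[OF e(2)]) (use d in auto)
      then have "abs_continuous_on {max 0 (t - d)..min 1 (t + d)} (f +++ h)"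
        by (rule abs_continuous_on_cong[rotated]) (use d in \<open>auto simp: joinpaths_def\<close>)
      then show ?thesis using d(1) by blast
    next
      case False
      have "2 * t - 1 \<notin> G"
      proof
        assume "2 * t - 1 \<in> G"
        then have "(2 * t - 1 + 1) / 2 \<in> (\<lambda>t. (t + 1) / 2) ` G" by (rule imageI)
        then show False using t by simp
      qed
      moreover have t2: "t > 1/2" using False t by auto
      ultimately have "2 * t - 1 \<in> {0..1} - G" using t by auto
      then obtain e where e: "e > 0" "abs_continuous_on {max 0 (2 * t - 1 - e)..min 1 (2 * t - 1 + e)} h"
        using G(2) by blast
      define d where "d = min (e / 2) (t - 1/2)"
      have d: "d > 0" "2 * d \<le> e" "t - d \<ge> 1/2" using e(1) t2 by (auto simp: d_def min_def)
      have "abs_continuous_on {max 0 (t - d)..min 1 (t + d)} (\<lambda>t. h (2 * t + (-1)))"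
        by (rule abs_continuous_on_affine[OF e(2)]) (use d in auto)
      then have "abs_continuous_on {max 0 (t - d)..min 1 (t + d)} (f +++ h)"
      proof (rule abs_continuous_on_cong[rotated])
        fix x assume "x \<in> {max 0 (t - d)..min 1 (t + d)}"
        then have "x \<ge> 1/2" using d by auto
        then show "h (2 * x + (-1)) = (f +++ h) x"
        proof (cases "x = 1/2")
          case True
          show ?thesis unfolding True using eq by (simp add: joinpaths_def)
        next
          case False
          with \<open>x \<ge> 1/2\<close> show ?thesis by (simp add: joinpaths_def)
        qed
      qed
      then show ?thesis using d(1) by blast
    qed
  qed
qed

lemma reverse_C_tilde:
  assumes f: "f \<in> C_tilde D"
  shows "(\<lambda>t. f (-1 * t + 1)) \<in> C_tilde D"
proof -
  obtain F where F: "finite F"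
    "\<And>t. t \<in> {0..1} - F \<Longrightarrow> \<exists>e>0. abs_continuous_on {max 0 (t - e)..min 1 (t + e)} f"
    by (rule C_tilde_interval_abs_continuous[OF f]) blast
  show ?thesis
  proof (rule C_tildeI[where F = "(\<lambda>t. 1 - t) ` F"])
    show "continuous_on {0..1} (\<lambda>t. f (-1 * t + 1))"
      by (intro continuous_on_compose2[OF C_tilde_continuous[OF f]] continuous_intros) auto
    show "(\<lambda>t. f (-1 * t + 1)) ` {0..1} \<subseteq> D" using C_tilde_image[OF f] by auto
    show "finite ((\<lambda>t. 1 - t) ` F)" using F(1) by simp
    fix t assume t: "t \<in> {0..1} - (\<lambda>t. 1 - t) ` F"
    have "1 - t \<notin> F"
    proof
      assume "1 - t \<in> F"
      then have "1 - (1 - t) \<in> (\<lambda>t. 1 - t) ` F" by (rule imageI)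
      then show False using t by simp
    qed
    then have "1 - t \<in> {0..1} - F" using t by auto
    then obtain e where e: "e > 0" "abs_continuous_on {max 0 (1 - t - e)..min 1 (1 - t + e)} f"
      using F(2) by blast
    have "abs_continuous_on {max 0 (t - e)..min 1 (t + e)} (\<lambda>t. f (-1 * t + 1))"
      by (rule abs_continuous_on_affine[OF e(2)]) auto
    then show "\<exists>e>0. abs_continuous_on {max 0 (t - e)..min 1 (t + e)} (\<lambda>t. f (-1 * t + 1))"
      using e(1) by blast
  qed
qed

lemma action_joinpaths:
  fixes f h :: "real \<Rightarrow> 'a::euclidean_space"
  assumes f: "f \<in> C_tilde D" and h: "h \<in> C_tilde D" and eq: "f 1 = h 0"
    and l: "continuous_on (D \<times> UNIV) (\<lambda>(x, y). l x y)"
    and hom: "\<And>x y c. x \<in> D \<Longrightarrow> 0 \<le> c \<Longrightarrow> l x (c *\<^sub>R y) = c * l x y"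
  shows "action l (f +++ h) 0 1 = action l f 0 1 + action l h 0 1"
proof -
  let ?\<theta> = "f +++ h"
  have \<theta>: "?\<theta> \<in> C_tilde D" by (rule joinpaths_C_tilde[OF f h eq])
  have "action l f 0 1 = action l (\<lambda>t. ?\<theta> (1/2 * t + 0)) 0 1"
    by (rule action_cong) (simp add: joinpaths_def)
  also have "\<dots> = action (\<lambda>x y. l x (sgn (1/2) *\<^sub>R y)) ?\<theta> 0 (1/2)"
    by (rule action_affine[OF \<theta> l hom]) auto
  finally have 1: "action l f 0 1 = action l ?\<theta> 0 (1/2)" by simp
  have "action l h 0 1 = action l (\<lambda>t. ?\<theta> (1/2 * t + 1/2)) 0 1"
  proof (rule action_cong)
    fix t :: real assume "t \<in> {0..1}"
    then show "h t = ?\<theta> (1/2 * t + 1/2)"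
      using eq by (cases "t = 0") (auto simp: joinpaths_def field_simps)
  qed
  also have "\<dots> = action (\<lambda>x y. l x (sgn (1/2) *\<^sub>R y)) ?\<theta> (1/2) 1"
    by (rule action_affine[OF \<theta> l hom]) auto
  finally have 2: "action l h 0 1 = action l ?\<theta> (1/2) 1" by simp
  show ?thesis unfolding 1 2 by (rule action_split[OF \<theta> l]) auto
qed

lemma length_reverse:
  fixes f :: "real \<Rightarrow> 'a::euclidean_space"
  assumes f: "f \<in> C_tilde D"
  shows "action (\<lambda>x y. norm y) (\<lambda>t. f (-1 * t + 1)) 0 1 = action (\<lambda>x y. norm y) f 0 1"
proof -
  have "action (\<lambda>x y. norm y) (\<lambda>t. f (-1 * t + 1)) 0 1 =
      action (\<lambda>x y. norm (sgn (-1) *\<^sub>R y)) f 0 1"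
    by (rule action_affine[OF f continuous_norm_lagrangian]) auto
  then show ?thesis by simp
qed

lemma action_le_length:
  fixes f :: "real \<Rightarrow> 'a::euclidean_space"
  assumes f: "f \<in> C_tilde D" and im: "f ` {0..1} \<subseteq> Z" and C: "0 \<le> C"
    and bound: "\<And>z y. z \<in> Z \<Longrightarrow> l z y \<le> C * norm y"
  shows "action l f 0 1 \<le> ennreal C * action (\<lambda>x y. norm y) f 0 1"
proof -
  have "action l f 0 1 \<le>
      (\<integral>\<^sup>+t. ennreal C * (ennreal (norm (vector_derivative f (at t))) * indicator {0..1} t) \<partial>lebesgue)"
    unfolding action_def
  proof (rule nn_integral_mono)
    fix t :: real
    show "ennreal (l (f t) (vector_derivative f (at t))) * indicator {0..1} t \<le>
      ennreal C * (ennreal (norm (vector_derivative f (at t))) * indicator {0..1} t)"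
    proof (cases "t \<in> {0..1}")
      case True
      then have "f t \<in> Z" using im by blast
      then have "ennreal (l (f t) (vector_derivative f (at t))) \<le> ennreal (C * norm (vector_derivative f (at t)))"
        by (intro ennreal_leI bound)
      then show ?thesis using True C by (simp add: ennreal_mult')
    qed simp
  qed
  also have "\<dots> = ennreal C * action (\<lambda>x y. norm y) f 0 1"
    unfolding action_def
    by (rule nn_integral_cmult[OF action_integrand_measurable[OF f continuous_norm_lagrangian]]) simp
  finally show ?thesis .
qed

text \<open>By homogeneity it suffices to bound the integrand for unit vectors.\<close>

lemma compact_lagrangian_bound:
  fixes l :: "'a::euclidean_space \<Rightarrow> 'a \<Rightarrow> real"
  assumes Z: "compact Z" "Z \<subseteq> D" and l: "continuous_on (D \<times> UNIV) (\<lambda>(x, y). l x y)"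
    and hom: "\<And>x y c. x \<in> D \<Longrightarrow> 0 \<le> c \<Longrightarrow> l x (c *\<^sub>R y) = c * l x y"
  obtains C where "0 \<le> C" "\<And>z y. z \<in> Z \<Longrightarrow> l z y \<le> C * norm y"
proof -
  have "compact ((\<lambda>(x, y). l x y) ` (Z \<times> sphere 0 1))"
    using Z by (intro compact_continuous_image continuous_on_subset[OF l] compact_Times) auto
  then obtain B where B: "\<And>v. v \<in> (\<lambda>(x, y). l x y) ` (Z \<times> sphere 0 1) \<Longrightarrow> norm v \<le> B"
    using compact_imp_bounded bounded_iff by metis
  have "l z y \<le> max 0 B * norm y" if z: "z \<in> Z" for z y
  proof (cases "y = 0")
    case True
    have "z \<in> D" using z Z by blast
    from hom[OF this, of 0 y] have "l z 0 = 0" by simp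
    then show ?thesis using True by simp
  next
    case False
    have "l z (y /\<^sub>R norm y) \<in> (\<lambda>(x, y). l x y) ` (Z \<times> sphere 0 1)"
      using z False by (intro image_eqI[of _ _ "(z, y /\<^sub>R norm y)"]) auto
    then have "l z (y /\<^sub>R norm y) \<le> B" using B by fastforce
    then have "norm y * l z (y /\<^sub>R norm y) \<le> norm y * max 0 B" by (intro mult_left_mono) auto
    moreover have "z \<in> D" using z Z by blast
    from hom[OF this, of "norm y" "y /\<^sub>R norm y"] have "l z y = norm y * l z (y /\<^sub>R norm y)"
      using False by simp
    ultimately show ?thesis by (simp add: mult.commute)
  qed
  then show thesis by (intro that[of "max 0 B"]) auto
qed

section \<open>The value function of the minimization problem\<close>

text \<open>A common convergent subsequence for finitely many sequences in a compact set.\<close>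

lemma finite_family_subseq:
  fixes P :: "nat \<Rightarrow> nat \<Rightarrow> 'a::metric_space"
  assumes K: "compact K" and P: "\<And>n j. j \<le> k \<Longrightarrow> P n j \<in> K"
  shows "\<exists>s l. strict_mono s \<and> (\<forall>j\<le>k. l j \<in> K \<and> (\<lambda>n. P (s n) j) \<longlonglongrightarrow> l j)"
  using P
proof (induction k)
  case 0
  then have "\<forall>n. P n 0 \<in> K" by simp
  then obtain x s where "x \<in> K" "strict_mono s" "((\<lambda>n. P n 0) \<circ> s) \<longlonglongrightarrow> x"
    using K unfolding compact_def by metis
  then show ?case by (intro exI[of _ s] exI[of _ "\<lambda>_. x"]) (simp add: o_def)
next
  case (Suc k)
  then obtain s l where s: "strict_mono s" and l: "\<And>j. j \<le> k \<Longrightarrow> l j \<in> K" "\<And>j. j \<le> k \<Longrightarrow> (\<lambda>n. P (s n) j) \<longlonglongrightarrow> l j"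
    by (metis le_SucI)
  have "\<forall>n. P (s n) (Suc k) \<in> K" using Suc.prems by simp
  then obtain x r where x: "x \<in> K" "strict_mono r" "((\<lambda>n. P (s n) (Suc k)) \<circ> r) \<longlonglongrightarrow> x"
    using K unfolding compact_def by metis
  show ?case
  proof (intro exI[of _ "s \<circ> r"] exI[of _ "l(Suc k := x)"] conjI allI impI)
    show "strict_mono (s \<circ> r)" using s x(2) by (rule strict_mono_o)
    fix j assume j: "j \<le> Suc k"
    show "(l(Suc k := x)) j \<in> K" using j l x by (cases "j = Suc k") auto
    show "(\<lambda>n. P ((s \<circ> r) n) j) \<longlonglongrightarrow> (l(Suc k := x)) j"
    proof (cases "j = Suc k")
      case True
      then show ?thesis using x(3) by (simp add: o_def)
    next
      case False
      then have "j \<le> k" using j by simp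
      from LIMSEQ_subseq_LIMSEQ[OF l(2)[OF this] x(2)] show ?thesis using False by (simp add: o_def)
    qed
  qed
qed

text \<open>A geometric action \<open>S\<close> with integrand \<open>l\<close>, together with the local condition on \<open>D'\<close> that nearby
  points are joined by short curves in \<open>D'\<close>.\<close>

locale action_problem =
  fixes D D' :: "'a::euclidean_space set" and S :: "'a curve \<Rightarrow> ennreal" and l :: "'a \<Rightarrow> 'a \<Rightarrow> real"
  assumes open_D: "open D" and D'_subset: "D' \<subseteq> D"
    and short_curves: "\<And>x \<nu>. x \<in> D' \<Longrightarrow> \<nu> > 0 \<Longrightarrow> \<exists>r>0. \<forall>w \<in> cball x r \<inter> D'.
           \<exists>\<gamma> \<in> rect_curves D \<inter> joining D' {x} {w}. curve_length D \<gamma> \<le> ennreal \<nu>"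
    and l_continuous: "continuous_on (D \<times> UNIV) (\<lambda>(x, y). l x y)"
    and l_hom: "\<And>x y c. x \<in> D \<Longrightarrow> 0 \<le> c \<Longrightarrow> l x (c *\<^sub>R y) = c * l x y"
    and S_eq: "\<And>\<gamma> f. \<gamma> \<in> tilde_curves D \<Longrightarrow> f \<in> tilde_params D \<gamma> \<Longrightarrow> S \<gamma> = action l f 0 1"
begin

text \<open>The infimum of the action over rectifiable curves in \<open>D'\<close> with given endpoints; it is
  infinite if there are none.\<close>

abbreviation V :: "'a \<Rightarrow> 'a \<Rightarrow> ennreal" where
  "V x y \<equiv> min_value D D' S {x} {y}"

text \<open>The total value of the links of a chain \<open>p 0, ..., p k\<close>.\<close>

abbreviation chain_value :: "(nat \<Rightarrow> 'a) \<Rightarrow> nat \<Rightarrow> ennreal" where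
  "chain_value p k \<equiv> \<Sum>j<k. V (p j) (p (Suc j))"

text \<open>A parameterization of a curve that solves the minimization problem for the endpoints \<open>x\<close>
  and \<open>y\<close>, not necessarily a rectifiable one.\<close>

abbreviation minimal_path :: "(real \<Rightarrow> 'a) \<Rightarrow> 'a \<Rightarrow> 'a \<Rightarrow> bool" where
  "minimal_path f x y \<equiv> f ` {0..1} \<subseteq> D' \<and> f 0 = x \<and> f 1 = y \<and> action l f 0 1 = V x y"

text \<open>Lipschitz parameterizations of rectifiable curves in \<open>D'\<close>. Every rectifiable curve in \<open>D'\<close>
  has one, and the class is closed under restriction and concatenation.\<close>

definition lip_paths :: "(real \<Rightarrow> 'a) set" where
  "lip_paths = {h. (\<exists>L. L-lipschitz_on {0..1} h) \<and> h ` {0..1} \<subseteq> D'}"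

lemma lip_paths_C_tilde: "h \<in> lip_paths \<Longrightarrow> h \<in> C_tilde D"
  using D'_subset by (auto simp: lip_paths_def intro!: lipschitz_C_tilde)

lemma lip_paths_image: "h \<in> lip_paths \<Longrightarrow> h ` {0..1} \<subseteq> D'"
  by (simp add: lip_paths_def)

lemma lip_paths_joinpaths:
  assumes "f \<in> lip_paths" "h \<in> lip_paths" "f 1 = h 0"
  shows "f +++ h \<in> lip_paths"
proof -
  obtain L M where "L-lipschitz_on {0..1} f" "M-lipschitz_on {0..1} h"
    using assms by (auto simp: lip_paths_def)
  from lipschitz_on_joinpaths[OF this assms(3)] show ?thesis
    using image_joinpaths_subset[OF assms(1,2)[THEN lip_paths_image]] by (auto simp: lip_paths_def)
qed

lemma lip_paths_segment:
  assumes h: "h \<in> lip_paths" and uv: "0 \<le> u" "u \<le> v" "v \<le> 1"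
  shows "(\<lambda>t. h ((v - u) * t + u)) \<in> lip_paths"
    and "(\<lambda>t. h ((v - u) * t + u)) ` {0..1} \<subseteq> h ` {u..v}"
proof -
  obtain L where L: "L-lipschitz_on {0..1} h" using h by (auto simp: lip_paths_def)
  have maps: "(v - u) * t + u \<in> {u..v}" if "t \<in> {0..1}" for t
  proof -
    have "0 \<le> (v - u) * t" "(v - u) * t \<le> v - u" using that uv by (auto intro: mult_left_le)
    then show ?thesis by auto
  qed
  then show "(\<lambda>t. h ((v - u) * t + u)) ` {0..1} \<subseteq> h ` {u..v}" by blast
  then have im: "(\<lambda>t. h ((v - u) * t + u)) ` {0..1} \<subseteq> D'"
    using lip_paths_image[OF h] uv by force
  have "(L * \<bar>v - u\<bar>)-lipschitz_on {0..1} (\<lambda>t. h ((v - u) * t + u))"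
    by (rule lipschitz_on_affine[OF L]) (use maps uv in force)
  then show "(\<lambda>t. h ((v - u) * t + u)) \<in> lip_paths" using im by (auto simp: lip_paths_def)
qed

lemma action_of_curve: "f \<in> C_tilde D \<Longrightarrow> S (curve_of D f) = action l f 0 1"
  by (rule S_eq[OF curve_of_tilde(1) curve_of_tilde(2)])

lemma min_value_le:
  assumes "f \<in> C_tilde D" "bounded_variation_on {0..1} f" "f ` {0..1} \<subseteq> D'" "f 0 \<in> A1" "f 1 \<in> A2"
  shows "min_value D D' S A1 A2 \<le> action l f 0 1"
proof -
  have "curve_of D f \<in> rect_curves D \<inter> joining D' A1 A2"
    using curve_of_rect[OF assms(1,2)] curve_of_joining[OF assms(3-5)] by blast
  then have "min_value D D' S A1 A2 \<le> S (curve_of D f)" unfolding min_value_def by (rule INF_lower)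
  then show ?thesis using action_of_curve[OF assms(1)] by simp
qed

lemma min_value_le_lipschitz:
  assumes "f \<in> lip_paths" "f 0 \<in> A1" "f 1 \<in> A2"
  shows "min_value D D' S A1 A2 \<le> action l f 0 1"
proof -
  obtain L where "L-lipschitz_on {0..1} f" using assms by (auto simp: lip_paths_def)
  from lipschitz_bv[OF this] show ?thesis
    using assms lip_paths_C_tilde lip_paths_image by (intro min_value_le) auto
qed

lemma rect_curve_lipschitz_path:
  assumes "\<gamma> \<in> rect_curves D" "\<gamma> \<in> joining D' A1 A2"
  obtains h where "h \<in> lip_paths" "(1, h) \<in> \<gamma>" "h 0 \<in> A1" "h 1 \<in> A2" "S \<gamma> = action l h 0 1"
proof -
  obtain L h where h: "L-lipschitz_on {0..1} h" "h \<in> tilde_params D \<gamma>" "\<gamma> \<in> tilde_curves D"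
    by (rule rect_curve_lipschitz_param[OF assms(1)])
  have mem: "(1, h) \<in> \<gamma>" using h(2) by (simp add: tilde_params_def)
  note j = joiningD[OF assms(2) mem]
  have "h \<in> lip_paths" using h(1) j(1) by (auto simp: lip_paths_def)
  then show thesis using mem j(2,3) S_eq[OF h(3,2)] by (rule that)
qed

lemma min_value_less_lipschitz:
  assumes "min_value D D' S A1 A2 < c"
  obtains h where "h \<in> lip_paths" "h 0 \<in> A1" "h 1 \<in> A2" "action l h 0 1 < c"
proof -
  obtain \<gamma> where \<gamma>: "\<gamma> \<in> rect_curves D" "\<gamma> \<in> joining D' A1 A2" "S \<gamma> < c"
    using assms by (auto simp: min_value_def INF_less_iff)
  obtain h where "h \<in> lip_paths" "(1, h) \<in> \<gamma>" "h 0 \<in> A1" "h 1 \<in> A2" "S \<gamma> = action l h 0 1"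
    by (rule rect_curve_lipschitz_path[OF \<gamma>(1,2)])
  then show thesis using \<gamma>(3) by (intro that) auto
qed

lemma joining_mono: "A1 \<subseteq> B1 \<Longrightarrow> A2 \<subseteq> B2 \<Longrightarrow> joining D' A1 A2 \<subseteq> joining D' B1 B2"
  unfolding joining_def starts_in_def ends_in_def by (auto simp: case_prod_unfold)

lemma min_value_le_value_between:
  assumes "x \<in> A1" "y \<in> A2"
  shows "min_value D D' S A1 A2 \<le> V x y"
  unfolding min_value_def using assms joining_mono[of "{x}" A1 "{y}" A2]
  by (intro INF_superset_mono) auto

lemma value_self:
  assumes "x \<in> D'"
  shows "V x x = 0"
proof -
  have "(\<lambda>t. x) \<in> lip_paths"
    using assms by (auto simp: lip_paths_def intro!: exI[of _ 0] lipschitz_onI)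
  then have "V x x \<le> action l (\<lambda>t. x) 0 1"
    by (rule min_value_le_lipschitz) auto
  also have "l x 0 = 0" using l_hom[of x 0 0] assms D'_subset by auto
  then have "action l (\<lambda>t. x) 0 1 = 0" by (simp add: action_def)
  finally show ?thesis by simp
qed

lemma value_triangle: "V x z \<le> V x y + V y z"
proof (rule ennreal_le_epsilon)
  fix e :: real assume e: "0 < e" and fin: "V x y + V y z < top"
  have e2: "0 < ennreal (e / 2)" using e by simp
  have "V x y < V x y + ennreal (e / 2)"
    using fin e2 ennreal_add_left_cancel_less[of _ 0 "ennreal (e / 2)"] by auto
  then obtain f where f: "f \<in> lip_paths" "f 0 \<in> {x}" "f 1 \<in> {y}"
    "action l f 0 1 < V x y + ennreal (e / 2)"
    by (rule min_value_less_lipschitz)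
  have "V y z < V y z + ennreal (e / 2)"
    using fin e2 ennreal_add_left_cancel_less[of _ 0 "ennreal (e / 2)"] by auto
  then obtain h where h: "h \<in> lip_paths" "h 0 \<in> {y}" "h 1 \<in> {z}"
    "action l h 0 1 < V y z + ennreal (e / 2)"
    by (rule min_value_less_lipschitz)
  have eq: "f 1 = h 0" using f h by simp
  have "V x z \<le> action l (f +++ h) 0 1"
    using f h by (intro min_value_le_lipschitz lip_paths_joinpaths eq) (auto simp: joinpaths_0_1)
  also have "\<dots> = action l f 0 1 + action l h 0 1"
    using f(1) h(1) eq l_continuous l_hom
    by (intro action_joinpaths[of _ D] lip_paths_C_tilde)
  also have "\<dots> \<le> (V x y + ennreal (e / 2)) + (V y z + ennreal (e / 2))"
    using f(4) h(4) by (intro add_mono) auto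
  also have "\<dots> = V x y + V y z + (ennreal (e / 2) + ennreal (e / 2))"
    by (simp only: ac_simps)
  also have "ennreal (e / 2) + ennreal (e / 2) = ennreal e" using e by (simp flip: ennreal_plus)
  finally show "V x z \<le> V x y + V y z + ennreal e" .
qed

lemma action_segment:
  assumes h: "h \<in> lip_paths" and uv: "0 \<le> u" "u < v" "v \<le> 1"
  shows "action l (\<lambda>t. h ((v - u) * t + u)) 0 1 = action l h u v"
proof -
  have "action l (\<lambda>t. h ((v - u) * t + u)) 0 1 = action (\<lambda>x y. l x (sgn (v - u) *\<^sub>R y)) h u v"
  proof (rule action_affine[OF lip_paths_C_tilde[OF h] l_continuous l_hom])
    fix t
    have "0 \<le> (v - u) * t \<longleftrightarrow> 0 \<le> t" using uv by (simp add: zero_le_mult_iff)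
    moreover have "(v - u) * t \<le> (v - u) * 1 \<longleftrightarrow> t \<le> 1" using uv by (subst mult_le_cancel_left_pos) auto
    ultimately show "t \<in> {0..1} \<longleftrightarrow> (v - u) * t + u \<in> {u..v}" by auto
  qed (use uv in auto)
  then show ?thesis using uv by simp
qed

lemma value_le_segment:
  assumes h: "h \<in> lip_paths" and uv: "0 \<le> u" "u \<le> v" "v \<le> 1"
  shows "V (h u) (h v) \<le> action l h u v"
proof (cases "u = v")
  case True
  have "h u \<in> D'" using lip_paths_image[OF h] uv by auto
  then show ?thesis using True value_self by simp
next
  case False
  have "V (h u) (h v) \<le> action l (\<lambda>t. h ((v - u) * t + u)) 0 1"
    by (rule min_value_le_lipschitz[OF lip_paths_segment(1)[OF h uv]]) auto
  also have "\<dots> = action l h u v" using False uv by (intro action_segment[OF h]) auto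
  finally show ?thesis .
qed

text \<open>The short curve from \<open>x\<close> to \<open>w\<close> is used with the parameterization that
  defines its length. Since that length is finite, the reversed path has bounded variation and is therefore
  admissible in the definition of the value from \<open>w\<close> to \<open>x\<close>.\<close>

lemma value_small:
  assumes x: "x \<in> D'" and e: "e > 0"
  obtains r where "r > 0" "\<And>w. w \<in> cball x r \<inter> D' \<Longrightarrow> V x w \<le> ennreal e \<and> V w x \<le> ennreal e"
proof -
  obtain R where R: "R > 0" "cball x R \<subseteq> D" using open_D D'_subset x by (meson open_contains_cball subsetD)
  obtain C where C: "0 \<le> C" "\<And>z y. z \<in> cball x R \<Longrightarrow> l z y \<le> C * norm y"
    by (rule compact_lagrangian_bound[OF compact_cball R(2) l_continuous l_hom]) blast+
  define \<nu> where "\<nu> = min R (e / (C + 1))"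
  have \<nu>: "\<nu> > 0" "\<nu> \<le> R" using R e C by (auto simp: \<nu>_def)
  have "C * \<nu> \<le> C * (e / (C + 1))" using C(1) by (intro mult_left_mono) (auto simp: \<nu>_def)
  also have "\<dots> \<le> e" using C(1) e by (simp add: field_simps)
  finally have C\<nu>: "C * \<nu> \<le> e" .
  obtain r where r: "r > 0" "\<forall>w \<in> cball x r \<inter> D'. \<exists>\<gamma> \<in> rect_curves D \<inter> joining D' {x} {w}. curve_length D \<gamma> \<le> ennreal \<nu>"
    using short_curves[OF x \<nu>(1)] by blast
  have "V x w \<le> ennreal e \<and> V w x \<le> ennreal e" if w: "w \<in> cball x r \<inter> D'" for w
  proof -
    let ?len = "action (\<lambda>x y. norm y)"
    obtain \<gamma> where \<gamma>: "\<gamma> \<in> rect_curves D" "\<gamma> \<in> joining D' {x} {w}" "curve_length D \<gamma> \<le> ennreal \<nu>"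
      using r w by blast
    obtain L h where "L-lipschitz_on {0..1} h" "h \<in> tilde_params D \<gamma>" "\<gamma> \<in> tilde_curves D"
      by (rule rect_curve_lipschitz_param[OF \<gamma>(1)])
    then have ex: "\<exists>f. f \<in> tilde_params D \<gamma>" by blast
    define f where "f = (SOME f. f \<in> tilde_params D \<gamma>)"
    have f: "f \<in> tilde_params D \<gamma>" unfolding f_def using ex by (rule someI_ex)
    then have Ct: "f \<in> C_tilde D" and mem: "(1, f) \<in> \<gamma>" by (auto simp: tilde_params_def)
    note j = joiningD[OF \<gamma>(2) mem]
    have len: "?len f 0 1 \<le> ennreal \<nu>"
      using \<gamma>(3) by (simp add: curve_length_def length_on_def f_def[symmetric] action_def)
    then have fin: "?len f 0 1 < \<infinity>" by (auto intro: le_less_trans)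
    have ball: "f ` {0..1} \<subseteq> cball x R"
    proof
      fix z assume "z \<in> f ` {0..1}"
      then obtain t where t: "t \<in> {0..1}" "z = f t" by blast
      have "ennreal (dist (f 0) (f t)) \<le> ?len f 0 t" using t by (intro C_tilde_dist_le_length[OF Ct]) auto
      also have "\<dots> \<le> ?len f 0 1" using t by (intro action_mono_interval) auto
      also have "\<dots> \<le> ennreal \<nu>" by (rule len)
      finally have "dist (f 0) (f t) \<le> \<nu>" by (rule iffD1[OF ennreal_le_iff, rotated]) (use \<nu> in simp)
      then show "z \<in> cball x R" using j(2) t \<nu>(2) by simp
    qed
    have bound: "action l \<theta> 0 1 \<le> ennreal e"
      if "\<theta> \<in> C_tilde D" "\<theta> ` {0..1} \<subseteq> cball x R" "?len \<theta> 0 1 \<le> ennreal \<nu>" for \<theta>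
    proof -
      have "action l \<theta> 0 1 \<le> ennreal C * ?len \<theta> 0 1"
        by (rule action_le_length[OF that(1,2) C])
      also have "\<dots> \<le> ennreal C * ennreal \<nu>" using that(3) by (intro mult_left_mono) auto
      also have "\<dots> = ennreal (C * \<nu>)" using C(1) by (simp add: ennreal_mult')
      also have "\<dots> \<le> ennreal e" using C\<nu> by (rule ennreal_leI)
      finally show ?thesis .
    qed
    have "V x w \<le> action l f 0 1"
      using j by (intro min_value_le[OF Ct C_tilde_finite_length_bv[OF Ct fin]]) auto
    also have "\<dots> \<le> ennreal e" by (rule bound[OF Ct ball len])
    finally have 1: "V x w \<le> ennreal e" .
    let ?\<theta> = "\<lambda>t. f (-1 * t + 1)"
    have \<theta>: "?\<theta> \<in> C_tilde D" by (rule reverse_C_tilde[OF Ct])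
    have im: "?\<theta> ` {0..1} \<subseteq> f ` {0..1}" by auto
    have len\<theta>: "?len ?\<theta> 0 1 = ?len f 0 1" by (rule length_reverse[OF Ct])
    have fin\<theta>: "?len ?\<theta> 0 1 < \<infinity>" unfolding len\<theta> by (rule fin)
    have "V w x \<le> action l ?\<theta> 0 1"
      using j im by (intro min_value_le[OF \<theta> C_tilde_finite_length_bv[OF \<theta> fin\<theta>]]) auto
    also have "\<dots> \<le> ennreal e"
      by (rule bound[OF \<theta> order_trans[OF im ball]]) (unfold len\<theta>, rule len)
    finally show ?thesis using 1 by blast
  qed
  then show thesis using r(1) by (intro that) auto
qed

lemma value_lower_semicontinuous:
  assumes pq: "p \<in> D'" "q \<in> D'" and lim: "P \<longlonglongrightarrow> p" "Q \<longlonglongrightarrow> q"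
    and PQ: "\<And>n. P n \<in> D'" "\<And>n. Q n \<in> D'" and e: "e > 0"
  shows "\<forall>\<^sub>F n in sequentially. V p q \<le> V (P n) (Q n) + ennreal e"
proof -
  have e2: "e / 2 > 0" using e by simp
  obtain r1 where r1: "r1 > 0" "\<And>w. w \<in> cball p r1 \<inter> D' \<Longrightarrow> V p w \<le> ennreal (e / 2) \<and> V w p \<le> ennreal (e / 2)"
    by (rule value_small[OF pq(1) e2]) blast
  obtain r2 where r2: "r2 > 0" "\<And>w. w \<in> cball q r2 \<inter> D' \<Longrightarrow> V q w \<le> ennreal (e / 2) \<and> V w q \<le> ennreal (e / 2)"
    by (rule value_small[OF pq(2) e2]) blast
  have "\<forall>\<^sub>F n in sequentially. dist (P n) p < r1" "\<forall>\<^sub>F n in sequentially. dist (Q n) q < r2"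
    using lim r1(1) r2(1) by (auto dest: tendstoD)
  then show ?thesis
  proof eventually_elim
    case (elim n)
    have 1: "V p (P n) \<le> ennreal (e / 2)" using r1(2)[of "P n"] elim PQ by (simp add: dist_commute)
    have 2: "V (Q n) q \<le> ennreal (e / 2)" using r2(2)[of "Q n"] elim PQ by (simp add: dist_commute)
    have "V p q \<le> V p (P n) + V (P n) q" by (rule value_triangle)
    also have "\<dots> \<le> V p (P n) + (V (P n) (Q n) + V (Q n) q)"
      by (intro add_left_mono value_triangle)
    also have "\<dots> \<le> ennreal (e / 2) + (V (P n) (Q n) + ennreal (e / 2))"
      using 1 2 by (intro add_mono order_refl)
    also have "\<dots> = V (P n) (Q n) + (ennreal (e / 2) + ennreal (e / 2))" by (simp only: ac_simps)
    also have "ennreal (e / 2) + ennreal (e / 2) = ennreal e" using e by (simp flip: ennreal_plus)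
    finally show ?case .
  qed
qed

text \<open>Induction on the number of balls. The path is cut at its last visit \<open>c\<close> of a ball that contains its
  starting point; the tail is covered by the remaining balls, at the cutting point by closedness.\<close>

lemma path_chain:
  assumes B: "finite B" "card B = k" and h: "h \<in> lip_paths"
    and cover: "h ` {0..1} \<subseteq> K \<inter> (\<Union>x\<in>B. cball x (r x))"
  shows "\<exists>p. p 0 = h 0 \<and> p k = h 1 \<and> (\<forall>j\<le>k. p j \<in> K) \<and>
    (\<forall>j<k. \<exists>x\<in>B. p j \<in> cball x (r x) \<and> p (Suc j) \<in> cball x (r x)) \<and>
    chain_value p k \<le> action l h 0 1"
  using B h cover
proof (induction k arbitrary: B h)
  case 0
  then have "B = {}" by simp
  then show ?case using 0(4) by auto
next
  case (Suc k)
  note h = Suc.prems(3) and cover = Suc.prems(4)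
  have cont: "continuous_on {0..1} h" by (rule C_tilde_continuous[OF lip_paths_C_tilde[OF h]])
  have inK: "h t \<in> K" and inU: "h t \<in> (\<Union>x\<in>B. cball x (r x))" if "t \<in> {0..1}" for t
    using cover that by blast+
  have "h 0 \<in> (\<Union>x\<in>B. cball x (r x))" by (rule inU) simp
  then obtain x where x: "x \<in> B" "h 0 \<in> cball x (r x)" by blast
  define T where "T = {t \<in> {0..1}. h t \<in> cball x (r x)}"
  have "T = {0..1} \<inter> h -` cball x (r x)" by (auto simp: T_def)
  then have "closed T" using continuous_closed_preimage[OF cont closed_atLeastAtMost closed_cball, of x "r x"] by simp
  moreover have "bounded T" by (rule bounded_subset[of "{0..1}"]) (auto simp: T_def)
  ultimately have "compact T" by (simp add: compact_eq_bounded_closed)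
  moreover have "0 \<in> T" using x by (simp add: T_def)
  ultimately obtain c where c: "c \<in> T" "\<And>t. t \<in> T \<Longrightarrow> t \<le> c"
    using compact_attains_sup[of T] by blast
  have c01: "0 \<le> c" "c \<le> 1" "h c \<in> cball x (r x)" using c(1) by (auto simp: T_def)
  show ?case
  proof (cases "c = 1")
    case True
    \<comment> \<open>The chain is padded by copies of the endpoint to have exactly \<open>Suc k\<close> links.\<close>
    define p where "p j = (if j = 0 then h 0 else h 1)" for j :: nat
    have "h 1 \<in> D'" using lip_paths_image[OF h] by auto
    then have "chain_value p (Suc k) = V (h 0) (h 1)"
      by (subst sum.lessThan_Suc_shift) (simp add: p_def value_self)
    also have "\<dots> \<le> action l h 0 1" by (rule value_le_segment[OF h]) auto
    finally show ?thesis
      using x c01 True inK by (intro exI[of _ p]) (auto simp: p_def)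
  next
    case False
    then have c1: "c < 1" using c01 by simp
    let ?C = "\<Union>x\<in>B - {x}. cball x (r x)"
    have clC: "closed ?C" using Suc.prems(1) by (intro closed_UN) auto
    have after: "h t \<in> ?C" if "t \<in> {c<..1}" for t
    proof -
      have "t \<notin> T" using c(2)[of t] that by auto
      then have "h t \<notin> cball x (r x)" using that c01 by (auto simp: T_def)
      moreover have "h t \<in> (\<Union>x\<in>B. cball x (r x))" using that c01 by (intro inU) auto
      ultimately show ?thesis by blast
    qed
    have "h c \<in> ?C"
    proof (rule closed_sequentially[OF clC])
      let ?h = "\<lambda>n. c + (1 - c) * inverse (real (Suc n))"
      have h: "?h n \<in> {c<..1}" for n
      proof -
        have "inverse (real (Suc n)) \<le> 1" by (simp add: inverse_le_1_iff)
        then have "(1 - c) * inverse (real (Suc n)) \<le> (1 - c) * 1" using c1 by (intro mult_left_mono) auto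
        moreover have "0 < (1 - c) * inverse (real (Suc n))" using c1 by simp
        ultimately show ?thesis by auto
      qed
      show "h (?h n) \<in> ?C" for n by (rule after[OF h])
      have "?h \<longlonglongrightarrow> c + (1 - c) * 0"
        by (intro tendsto_intros LIMSEQ_inverse_real_of_nat)
      then have lim: "?h \<longlonglongrightarrow> c" by simp
      show "(\<lambda>n. h (?h n)) \<longlonglongrightarrow> h c"
        by (rule continuous_on_tendsto_compose[OF cont lim]) (use h c01 in \<open>auto intro!: always_eventually\<close>)
    qed
    have tailC: "h t \<in> ?C" if "t \<in> {c..1}" for t
    proof (cases "t = c")
      case True
      then show ?thesis using \<open>h c \<in> ?C\<close> by simp
    next
      case False
      then show ?thesis using that by (intro after) simp
    qed
    let ?\<theta> = "\<lambda>t. h ((1 - c) * t + c)"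
    have \<theta>: "?\<theta> \<in> lip_paths" "?\<theta> ` {0..1} \<subseteq> h ` {c..1}"
      using lip_paths_segment[OF h c01(1,2)] by auto
    have "h ` {c..1} \<subseteq> K \<inter> ?C"
    proof (rule image_subsetI)
      fix t assume t: "t \<in> {c..1}"
      then have "t \<in> {0..1}" using c01 by simp
      with t show "h t \<in> K \<inter> ?C" using inK tailC by blast
    qed
    with \<theta>(2) have "?\<theta> ` {0..1} \<subseteq> K \<inter> ?C" by (rule order_trans)
    moreover have "finite (B - {x})" "card (B - {x}) = k" using Suc.prems(1,2) x(1) by auto
    ultimately obtain p where p: "p 0 = ?\<theta> 0" "p k = ?\<theta> 1" "\<forall>j\<le>k. p j \<in> K"
      "\<forall>j<k. \<exists>x\<in>B - {x}. p j \<in> cball x (r x) \<and> p (Suc j) \<in> cball x (r x)"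
      "chain_value p k \<le> action l ?\<theta> 0 1"
      using Suc.IH[OF _ _ \<theta>(1), of "B - {x}"] by blast
    define q where "q j = (case j of 0 \<Rightarrow> h 0 | Suc i \<Rightarrow> p i)" for j
    have q: "q 0 = h 0" "\<And>i. q (Suc i) = p i" by (simp_all add: q_def)
    have p0: "p 0 = h c" using p(1) by simp
    show ?thesis
    proof (intro exI[of _ q] conjI allI impI)
      show "q 0 = h 0" "q (Suc k) = h 1" using q p(2) by simp_all
      show "q j \<in> K" if "j \<le> Suc k" for j using that q p(3) inK by (cases j) auto
      show "\<exists>x\<in>B. q j \<in> cball x (r x) \<and> q (Suc j) \<in> cball x (r x)" if j: "j < Suc k" for j
      proof (cases j)
        case 0
        then show ?thesis using x c01(3) p0 q by (intro bexI[of _ x]) auto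
      next
        case (Suc i)
        then have "i < k" using j by simp
        then obtain y where "y \<in> B - {x}" "p i \<in> cball y (r y)" "p (Suc i) \<in> cball y (r y)" using p(4) by blast
        then show ?thesis using Suc q by auto
      qed
      have "chain_value q (Suc k) =
          V (h 0) (h c) + chain_value p k"
        by (subst sum.lessThan_Suc_shift) (simp add: q p0)
      also have "\<dots> \<le> action l h 0 c + action l h c 1"
        using p(5) action_segment[OF h c01(1) c1] c01
        by (intro add_mono value_le_segment[OF h]) auto
      also have "\<dots> = action l h 0 1"
        using c01 by (intro action_split[OF lip_paths_C_tilde[OF h] l_continuous, symmetric]) auto
      finally show "chain_value q (Suc k) \<le> action l h 0 1" .
    qed
  qed
qed

text \<open>The class \<open>X\<close> is instantiated by \<open>C_tilde D\<close> for weak minimizers and by the Lipschitz paths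
  for strong ones.\<close>

lemma join_chain:
  assumes X: "X \<subseteq> C_tilde D" and X_join: "\<And>f h. f \<in> X \<Longrightarrow> h \<in> X \<Longrightarrow> f 1 = h 0 \<Longrightarrow> f +++ h \<in> X"
    and links: "\<And>j. j < Suc k \<Longrightarrow> \<exists>f\<in>X. minimal_path f (p j) (p (Suc j))"
  shows "\<exists>f\<in>X. f ` {0..1} \<subseteq> D' \<and> f 0 = p 0 \<and> f 1 = p (Suc k) \<and>
      action l f 0 1 = chain_value p (Suc k)"
  using links
proof (induction k)
  case 0
  then show ?case by simp
next
  case (Suc k)
  have "\<exists>f\<in>X. f ` {0..1} \<subseteq> D' \<and> f 0 = p 0 \<and> f 1 = p (Suc k) \<and>
      action l f 0 1 = chain_value p (Suc k)"
    by (rule Suc.IH, rule Suc.prems) simp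
  then obtain f where f: "f \<in> X" "f ` {0..1} \<subseteq> D'" "f 0 = p 0" "f 1 = p (Suc k)"
    "action l f 0 1 = chain_value p (Suc k)" by blast
  obtain h where h: "h \<in> X" "h ` {0..1} \<subseteq> D'" "h 0 = p (Suc k)" "h 1 = p (Suc (Suc k))"
    "action l h 0 1 = V (p (Suc k)) (p (Suc (Suc k)))"
    using Suc.prems[OF lessI] by blast
  have eq: "f 1 = h 0" using f h by simp
  have "action l (f +++ h) 0 1 = action l f 0 1 + action l h 0 1"
    by (rule action_joinpaths[OF subsetD[OF X f(1)] subsetD[OF X h(1)] eq l_continuous l_hom])
  also have "\<dots> = chain_value p (Suc (Suc k))"
    unfolding f(5) h(5) by simp
  finally show ?case
    using X_join[OF f(1) h(1) eq] image_joinpaths_subset[OF f(2) h(2)] f(3) h(4)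
    by (intro bexI[of _ "f +++ h"]) (simp_all add: joinpaths_0_1)
qed

lemma value_le_chain:
  assumes "p 0 \<in> D'"
  shows "V (p 0) (p k) \<le> chain_value p k"
proof (induction k)
  case 0
  then show ?case using assms by (simp add: value_self)
next
  case (Suc k)
  have "V (p 0) (p (Suc k)) \<le> V (p 0) (p k) + V (p k) (p (Suc k))"
    by (rule value_triangle)
  also have "\<dots> \<le> chain_value p (Suc k)" using Suc by (simp add: add_right_mono)
  finally show ?case .
qed

end

section \<open>Existence of minimizers\<close>

context action_problem
begin

text \<open>The compactness argument, for a class \<open>X\<close> of paths that contains local minimizers and is closed
  under concatenation.\<close>

lemma minimizing_path_exists:
  assumes K: "compact K" "K \<subseteq> D'"
    and A1: "closedin (top_of_set D) A1" and A2: "closedin (top_of_set D) A2"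
    and g: "minimizing_sequence D D' S A1 A2 g" and gK: "\<And>n. curve_image (g n) \<subseteq> K"
    and X: "X \<subseteq> C_tilde D" and X_join: "\<And>f h. f \<in> X \<Longrightarrow> h \<in> X \<Longrightarrow> f 1 = h 0 \<Longrightarrow> f +++ h \<in> X"
    and local: "\<And>x. x \<in> K \<Longrightarrow> \<exists>r>0. \<forall>x1\<in>cball x r \<inter> D'. \<forall>x2\<in>cball x r \<inter> D'.
      \<exists>f\<in>X. minimal_path f x1 x2"
  shows "\<exists>f\<in>X. f ` {0..1} \<subseteq> D' \<and> f 0 \<in> A1 \<and> f 1 \<in> A2 \<and>
    action l f 0 1 = min_value D D' S A1 A2"
proof -
  let ?m = "min_value D D' S A1 A2"
  define local_paths where "local_paths x \<rho> \<longleftrightarrow> \<rho> > 0 \<and>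
      (\<forall>x1\<in>cball x \<rho> \<inter> D'. \<forall>x2\<in>cball x \<rho> \<inter> D'. \<exists>f\<in>X. minimal_path f x1 x2)" for x \<rho>
  have "\<forall>x\<in>K. \<exists>\<rho>. local_paths x \<rho>" using local unfolding local_paths_def by (intro ballI)
  then obtain r where r: "\<forall>x\<in>K. local_paths x (r x)" by (rule bchoice[THEN exE])
  have r_min: "\<exists>f\<in>X. minimal_path f x1 x2"
    if "x \<in> K" "x1 \<in> cball x (r x) \<inter> D'" "x2 \<in> cball x (r x) \<inter> D'" for x x1 x2
    using bspec[OF r that(1)] that(2,3) unfolding local_paths_def by blast
  have r: "r x > 0" if "x \<in> K" for x using bspec[OF r that] by (simp add: local_paths_def)
  have "\<And>x. x \<in> K \<Longrightarrow> open (ball x (r x))" "K \<subseteq> (\<Union>x\<in>K. ball x (r x))" using r by auto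
  then obtain B where B: "B \<subseteq> K" "finite B" "K \<subseteq> (\<Union>x\<in>B. ball x (r x))"
    by (rule compactE_image[OF K(1)])
  then have KB: "K \<subseteq> (\<Union>x\<in>B. cball x (r x))" using ball_subset_cball by blast
  define k where "k = card B"
  define chain where "chain n p \<longleftrightarrow> p 0 \<in> A1 \<and> p k \<in> A2 \<and> (\<forall>j\<le>k. p j \<in> K) \<and>
      (\<forall>j<k. \<exists>x\<in>B. p j \<in> cball x (r x) \<and> p (Suc j) \<in> cball x (r x)) \<and>
      chain_value p k \<le> S (g n)" for n p
  have "\<exists>p. chain n p" for n
  proof -
    have gn: "g n \<in> rect_curves D" "g n \<in> joining D' A1 A2" using g by (auto simp: minimizing_sequence_def)
    obtain h where h: "h \<in> lip_paths" "(1, h) \<in> g n" "h 0 \<in> A1" "h 1 \<in> A2"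
      "S (g n) = action l h 0 1" by (rule rect_curve_lipschitz_path[OF gn])
    have "h ` {0..1} \<subseteq> curve_image (g n)"
      using UN_upper[OF h(2), of "\<lambda>(T, f). f ` {0..T}"] by (simp add: curve_image_def)
    then have "h ` {0..1} \<subseteq> K \<inter> (\<Union>x\<in>B. cball x (r x))" using gK[of n] KB by blast
    from path_chain[OF B(2) k_def[symmetric] h(1) this] obtain p where
      "p 0 = h 0" "p k = h 1" "\<forall>j\<le>k. p j \<in> K"
      "\<forall>j<k. \<exists>x\<in>B. p j \<in> cball x (r x) \<and> p (Suc j) \<in> cball x (r x)"
      "chain_value p k \<le> action l h 0 1" by blast
    then show ?thesis using h(3-5) unfolding chain_def by (intro exI[of _ p]) simp
  qed
  then have "\<forall>n. \<exists>p. chain n p" by blast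
  then obtain P where "\<forall>n. chain n (P n)" by (rule choice[THEN exE])
  then have chain: "chain n (P n)" for n by blast
  have P: "P n 0 \<in> A1" "P n k \<in> A2" "\<And>j. j \<le> k \<Longrightarrow> P n j \<in> K"
    "\<And>j. j < k \<Longrightarrow> \<exists>x\<in>B. P n j \<in> cball x (r x) \<and> P n (Suc j) \<in> cball x (r x)"
    "chain_value (P n) k \<le> S (g n)" for n
    using chain[of n] unfolding chain_def by blast+
  have "\<exists>s p. strict_mono s \<and> (\<forall>j\<le>k. p j \<in> K \<and> (\<lambda>n. P (s n) j) \<longlonglongrightarrow> p j)"
    by (rule finite_family_subseq[OF K(1)]) (rule P(3))
  then obtain s p where s: "strict_mono s" and p: "\<forall>j\<le>k. p j \<in> K \<and> (\<lambda>n. P (s n) j) \<longlonglongrightarrow> p j"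
    by blast
  have pK: "p j \<in> K" and plim: "(\<lambda>n. P (s n) j) \<longlonglongrightarrow> p j" if "j \<le> k" for j using p that by auto
  have closed_limit: "p j \<in> A" if A: "closedin (top_of_set D) A" and j: "j \<le> k" and PA: "\<And>n. P n j \<in> A" for A j
  proof -
    obtain C where C: "closed C" "A = D \<inter> C" using A by (auto simp: closedin_closed)
    have "p j \<in> C" by (rule closed_sequentially[OF C(1) _ plim[OF j]]) (use PA C in auto)
    moreover have "p j \<in> D" using pK[OF j] K D'_subset by blast
    ultimately show ?thesis using C by blast
  qed
  have ends: "p 0 \<in> A1" "p k \<in> A2" using closed_limit[OF A1] closed_limit[OF A2] P(1,2) by auto
  have k: "k > 0"
  proof (rule ccontr)
    assume "\<not> k > 0"
    then have "B = {}" using B(2) by (simp add: k_def)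
    then show False using KB pK[of 0] by auto
  qed
  have links: "\<exists>x\<in>B. p j \<in> cball x (r x) \<and> p (Suc j) \<in> cball x (r x)" if j: "j < k" for j
  proof -
    let ?L = "\<Union>x\<in>B. cball x (r x) \<times> cball x (r x)"
    have "closed ?L" using B(2) by (intro closed_UN ballI closed_Times closed_cball)
    moreover have "(P (s n) j, P (s n) (Suc j)) \<in> ?L" for n using P(4)[OF j] by blast
    moreover have "(\<lambda>n. (P (s n) j, P (s n) (Suc j))) \<longlonglongrightarrow> (p j, p (Suc j))"
      using plim[of j] plim[of "Suc j"] j by (intro tendsto_Pair) auto
    ultimately have "(p j, p (Suc j)) \<in> ?L" by (rule closed_sequentially)
    then show ?thesis by blast
  qed
  let ?V = "chain_value p k"
  \<comment> \<open>Semicontinuity of the value function along the subsequence bounds the limiting chain.\<close>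
  have upper: "?V \<le> ?m"
  proof (rule ennreal_le_epsilon)
    fix e :: real assume e: "0 < e"
    \<comment> \<open>The error is distributed over the \<open>k\<close> links.\<close>
    define d where "d = e / real k"
    have d: "d > 0" using e k by (simp add: d_def)
    have KD': "\<And>x. x \<in> K \<Longrightarrow> x \<in> D'" using K(2) by blast
    have "\<forall>\<^sub>F n in sequentially. V (p j) (p (Suc j)) \<le>
        V (P (s n) j) (P (s n) (Suc j)) + ennreal d" if j: "j \<in> {..<k}" for j
    proof (rule value_lower_semicontinuous[OF _ _ _ _ _ _ d])
      show "p j \<in> D'" "p (Suc j) \<in> D'" using pK j KD' by auto
      show "(\<lambda>n. P (s n) j) \<longlonglongrightarrow> p j" "(\<lambda>n. P (s n) (Suc j)) \<longlonglongrightarrow> p (Suc j)" using plim j by auto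
      show "P (s n) j \<in> D'" "P (s n) (Suc j) \<in> D'" for n using P(3) j KD' by auto
    qed
    then have "\<forall>\<^sub>F n in sequentially. \<forall>j\<in>{..<k}. V (p j) (p (Suc j)) \<le>
        V (P (s n) j) (P (s n) (Suc j)) + ennreal d"
      by (intro eventually_ball_finite) auto
    then have ev: "\<forall>\<^sub>F n in sequentially. ?V \<le> S (g (s n)) + ennreal e"
    proof eventually_elim
      case (elim n)
      have "?V \<le> (\<Sum>j<k. V (P (s n) j) (P (s n) (Suc j)) + ennreal d)"
        using elim by (intro sum_mono) auto
      also have "\<dots> = chain_value (P (s n)) k + of_nat k * ennreal d"
        by (simp add: sum.distrib)
      also have "of_nat k * ennreal d = ennreal e"
        using k d by (simp add: d_def ennreal_of_nat_eq_real_of_nat flip: ennreal_mult')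
      also have "chain_value (P (s n)) k + ennreal e \<le> S (g (s n)) + ennreal e"
        by (intro add_right_mono P(5))
      finally show ?case .
    qed
    have "(\<lambda>n. S (g n)) \<longlonglongrightarrow> ?m" using g by (simp add: minimizing_sequence_def)
    from LIMSEQ_subseq_LIMSEQ[OF this s] have "(\<lambda>n. S (g (s n))) \<longlonglongrightarrow> ?m" by (simp add: o_def)
    then have "(\<lambda>n. S (g (s n)) + ennreal e) \<longlonglongrightarrow> ?m + ennreal e" by (intro tendsto_add tendsto_const)
    then show "?V \<le> ?m + ennreal e" by (rule tendsto_lowerbound[OF _ ev]) simp
  qed
  have "?m \<le> V (p 0) (p k)" by (rule min_value_le_value_between[OF ends])
  also have "\<dots> \<le> ?V" using pK[of 0] K(2) by (intro value_le_chain) auto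
  finally have eq: "?V = ?m" using upper by (rule antisym[rotated])
  obtain k' where k': "k = Suc k'" using k gr0_implies_Suc by blast
  have "\<exists>f\<in>X. minimal_path f (p j) (p (Suc j))" if j: "j < Suc k'" for j
  proof -
    obtain x where x: "x \<in> B" "p j \<in> cball x (r x)" "p (Suc j) \<in> cball x (r x)" using links[of j] j k' by auto
    moreover have "p j \<in> D'" "p (Suc j) \<in> D'" using pK j k' K(2) by auto
    ultimately show ?thesis using B(1) by (intro r_min[of x]) auto
  qed
  from join_chain[where p = p and k = k', OF X X_join this] obtain f where f: "f \<in> X" "f ` {0..1} \<subseteq> D'" "f 0 = p 0" "f 1 = p (Suc k')"
    "action l f 0 1 = chain_value p (Suc k')" by blast
  then show ?thesis using eq ends k' by (intro bexI[of _ f]) auto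
qed

lemma weak_local_minimizing_paths:
  assumes "has_weak_local_minimizers D D' S x"
  shows "\<exists>r>0. \<forall>x1\<in>cball x r \<inter> D'. \<forall>x2\<in>cball x r \<inter> D'.
    \<exists>f\<in>C_tilde D. minimal_path f x1 x2"
proof -
  obtain r \<eta> Kx where r: "r > 0" "\<forall>x1\<in>cball x r \<inter> D'. \<forall>x2\<in>cball x r \<inter> D'. \<exists>\<gamma>\<in>tilde_curves_at D x. weak_minimizer D D' S {x1} {x2} \<gamma> \<and>
             curve_image \<gamma> \<subseteq> Kx \<and> (\<forall>u>0. length_on D (- cball x u) \<gamma> \<le> ennreal (\<eta> u))"
    using assms unfolding has_weak_local_minimizers_def by (elim exE conjE) (rule that)
  have "\<exists>f\<in>C_tilde D. minimal_path f x1 x2"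
    if x12: "x1 \<in> cball x r \<inter> D'" "x2 \<in> cball x r \<inter> D'" for x1 x2
  proof -
    obtain \<gamma> where \<gamma>: "\<gamma> \<in> tilde_curves D" "\<gamma> \<in> joining D' {x1} {x2}" "S \<gamma> = V x1 x2"
      using bspec[OF bspec[OF r(2) x12(1)] x12(2)] by (auto simp: weak_minimizer_def)
    then obtain f where f: "f \<in> tilde_params D \<gamma>" by (auto simp: tilde_curves_def)
    then have "f \<in> C_tilde D" "(1, f) \<in> \<gamma>" by (auto simp: tilde_params_def)
    then show ?thesis using joiningD[OF \<gamma>(2)] S_eq[OF \<gamma>(1) f] \<gamma>(3) by (intro bexI[of _ f]) auto
  qed
  then show ?thesis using r(1) by blast
qed

lemma strong_local_minimizing_paths:
  assumes "has_strong_local_minimizers D D' S x"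
  shows "\<exists>r>0. \<forall>x1\<in>cball x r \<inter> D'. \<forall>x2\<in>cball x r \<inter> D'.
    \<exists>f\<in>lip_paths. minimal_path f x1 x2"
proof -
  obtain r \<eta> Kx where r: "r > 0" "\<forall>x1\<in>cball x r \<inter> D'. \<forall>x2\<in>cball x r \<inter> D'. \<exists>\<gamma>. strong_minimizer D D' S {x1} {x2} \<gamma> \<and>
             curve_image \<gamma> \<subseteq> Kx \<and> curve_length D \<gamma> \<le> ennreal \<eta>"
    using assms unfolding has_strong_local_minimizers_def by (elim exE conjE) (rule that)
  have "\<exists>f\<in>lip_paths. minimal_path f x1 x2"
    if x12: "x1 \<in> cball x r \<inter> D'" "x2 \<in> cball x r \<inter> D'" for x1 x2
  proof -
    obtain \<gamma> where \<gamma>: "\<gamma> \<in> rect_curves D" "\<gamma> \<in> joining D' {x1} {x2}" "S \<gamma> = V x1 x2"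
      using bspec[OF bspec[OF r(2) x12(1)] x12(2)] by (auto simp: strong_minimizer_def)
    obtain h where h: "h \<in> lip_paths" "(1, h) \<in> \<gamma>" "h 0 \<in> {x1}" "h 1 \<in> {x2}"
      "S \<gamma> = action l h 0 1" by (rule rect_curve_lipschitz_path[OF \<gamma>(1,2)])
    then show ?thesis using \<gamma>(3) lip_paths_image by (intro bexI[of _ h]) auto
  qed
  then show ?thesis using r(1) by blast
qed

lemma weak_minimizer_exists:
  assumes "compact K" "K \<subseteq> D'" "closedin (top_of_set D) A1" "closedin (top_of_set D) A2"
    and "minimizing_sequence D D' S A1 A2 g" "\<And>n. curve_image (g n) \<subseteq> K"
    and "\<And>x. x \<in> K \<Longrightarrow> has_weak_local_minimizers D D' S x"
  shows "\<exists>\<gamma>. weak_minimizer D D' S A1 A2 \<gamma>"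
proof -
  have "\<exists>f\<in>C_tilde D. f ` {0..1} \<subseteq> D' \<and> f 0 \<in> A1 \<and> f 1 \<in> A2 \<and>
      action l f 0 1 = min_value D D' S A1 A2"
    by (rule minimizing_path_exists[OF assms(1-6) subset_refl])
      (auto intro: joinpaths_C_tilde weak_local_minimizing_paths assms(7))
  then obtain f where f: "f \<in> C_tilde D" "f ` {0..1} \<subseteq> D'" "f 0 \<in> A1" "f 1 \<in> A2"
    "action l f 0 1 = min_value D D' S A1 A2" by blast
  have "weak_minimizer D D' S A1 A2 (curve_of D f)"
    unfolding weak_minimizer_def using curve_of_tilde(1)[OF f(1)] curve_of_joining[OF f(2-4)] action_of_curve[OF f(1)] f(5)
    by auto
  then show ?thesis by blast
qed

lemma strong_minimizer_exists:
  assumes "compact K" "K \<subseteq> D'" "closedin (top_of_set D) A1" "closedin (top_of_set D) A2"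
    and "minimizing_sequence D D' S A1 A2 g" "\<And>n. curve_image (g n) \<subseteq> K"
    and "\<And>x. x \<in> K \<Longrightarrow> has_strong_local_minimizers D D' S x"
  shows "\<exists>\<gamma>. strong_minimizer D D' S A1 A2 \<gamma>"
proof -
  have "lip_paths \<subseteq> C_tilde D" using lip_paths_C_tilde by blast
  from minimizing_path_exists[OF assms(1-6) this lip_paths_joinpaths strong_local_minimizing_paths[OF assms(7)]]
  obtain f where f: "f \<in> lip_paths" "f ` {0..1} \<subseteq> D'" "f 0 \<in> A1" "f 1 \<in> A2"
    "action l f 0 1 = min_value D D' S A1 A2" by blast
  obtain L where L: "L-lipschitz_on {0..1} f" using f(1) by (auto simp: lip_paths_def)
  note Ct = lip_paths_C_tilde[OF f(1)]
  have "strong_minimizer D D' S A1 A2 (curve_of D f)"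
    unfolding strong_minimizer_def
    using curve_of_rect[OF Ct lipschitz_bv[OF L]] curve_of_joining[OF f(2-4)] action_of_curve[OF Ct] f(5)
    by auto
  then show ?thesis by blast
qed

end

theorem theorem1:
  fixes D D' K A1 A2 :: "'a::euclidean_space set"
    and S :: "'a curve \<Rightarrow> ennreal"
    and g :: "nat \<Rightarrow> 'a curve"
  assumes "open D" and "connected D"
    and "D' \<subseteq> D" and "connected D'" and "closedin (top_of_set D) D'"
    and "\<forall>x\<in>D'. \<forall>\<nu>::real. \<nu> > 0 \<longrightarrow> (\<exists>r>0. \<forall>w \<in> cball x r \<inter> D'.
           \<exists>\<gamma> \<in> rect_curves D \<inter> joining D' {x} {w}. curve_length D \<gamma> \<le> ennreal \<nu>)"
    and "geometric_action D S"
    and "compact K" and "K \<subseteq> D'"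
    and "\<forall>x\<in>K. has_weak_local_minimizers D D' S x"
    and "A1 \<subseteq> D'" and "closedin (top_of_set D) A1"
    and "A2 \<subseteq> D'" and "closedin (top_of_set D) A2"
    and "minimizing_sequence D D' S A1 A2 g"
    and "\<forall>n. curve_image (g n) \<subseteq> K"
  shows "(\<exists>\<gamma>. weak_minimizer D D' S A1 A2 \<gamma>) \<and>
    ((\<forall>x\<in>K. has_strong_local_minimizers D D' S x) \<longrightarrow>
      (\<exists>\<gamma>. strong_minimizer D D' S A1 A2 \<gamma>))"
proof -
  obtain l :: "'a \<Rightarrow> 'a \<Rightarrow> real" where l: "continuous_on (D \<times> UNIV) (\<lambda>(x, y). l x y)"
    "\<forall>x\<in>D. \<forall>y. \<forall>c\<ge>0. l x (c *\<^sub>R y) = c * l x y"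
    "\<forall>\<gamma>\<in>tilde_curves D. \<forall>f\<in>tilde_params D \<gamma>.
        S \<gamma> = (\<integral>\<^sup>+\<alpha>\<in>{0..1}. ennreal (l (f \<alpha>) (vector_derivative f (at \<alpha>))) \<partial>lebesgue)"
    using \<open>geometric_action D S\<close> unfolding geometric_action_def by blast
  interpret action_problem D D' S l
    by unfold_locales (use assms l in \<open>simp_all add: action_def\<close>)
  have gK: "\<And>n. curve_image (g n) \<subseteq> K" using assms by blast
  note hyps = \<open>compact K\<close> \<open>K \<subseteq> D'\<close> \<open>closedin (top_of_set D) A1\<close> \<open>closedin (top_of_set D) A2\<close>
    \<open>minimizing_sequence D D' S A1 A2 g\<close> gK
  show ?thesis
  proof (intro conjI impI)
    show "\<exists>\<gamma>. weak_minimizer D D' S A1 A2 \<gamma>"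
      by (rule weak_minimizer_exists[OF hyps]) (use \<open>\<forall>x\<in>K. has_weak_local_minimizers D D' S x\<close> in simp)
    assume "\<forall>x\<in>K. has_strong_local_minimizers D D' S x"
    then show "\<exists>\<gamma>. strong_minimizer D D' S A1 A2 \<gamma>"
      by (intro strong_minimizer_exists[OF hyps]) simp
  qed
qed

end
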